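(* For any $k\ge 0$ there exists a constant $C_k>0$ (independent of $n$) such that for any $n\ge k+1$, $$\mathbb{E}\bigl\|u^{[k]}-w^{[k]}\bigr\|^2\le\frac{C_k}{n},$$ where $u^{[k]}$ is the AMP iteration and $w^{[k]}$ is the cavity iteration (both defined in the context).
   Context: Setting. Write $[n]=\{1,\dots,n\}$. For each $n$, $A_n=(a_{ij})_{i,j\in[n]}$ is a random symmetric matrix with $a_{ii}=0$ and $(a_{ij})_{i<j}$ i.i.d. standard Gaussian. $\|x\|:=(n^{-1}\sum_{i=1}^n x_i^2)^{1/2}$ for $x\in\mathbb{R}^n$. For each $n$, $u=u^n$ is a random vector in $\mathbb{R}^n$, independent of $A_n$, with $\|u^n\|\le 1$, and the empirical distribution of the coordinates of $u^n$ converges as $n\to\infty$ to the law of a random variable $W_0$ (i.e. $n^{-1}\sum_i\varphi(u^n_i)\to\mathbb{E}\varphi(W_0)$ in probability for every bounded continuous $\varphi$). $(f_k)_{k\ge0}$ is a sequence of bounded smooth functions on $\mathbb{R}$ with bounded derivatives of all orders. Cavity iteration. For $0\le k\le n-1$ let $[n]_k=\{S\subseteq[n]: |S|\le n-(k+1)\}$. For $S\in[n]_0$ set $w_{S,i}^{[0]}=u_i$ for $i\in[n]\setminus S$. For $0\le k\le n-2$ and $S\in[n]_{k+1}$ define iteratively $$w_{S,i}^{[k+1]}=\frac{1}{\sqrt n}\sum_{j\in[n]\setminus(S\cup\{i\})}a_{ij}f_k\bigl(w_{S\cup\{i\},j}^{[k]}\bigr),\qquad i\in[n]\setminus S.$$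 For $S=\emptyset$ write $w^{[k]}=w^{[k]}_\emptyset\in\mathbb{R}^n$. AMP iteration. Set $u^{[0]}=u$, $u_i^{[1]}=\frac1{\sqrt n}\sum_{j=1}^na_{ij}f_0(u^{[0]}_j)$ for $i\in[n]$, and for $k\ge1$ $$u_i^{[k+1]}=\frac1{\sqrt n}\sum_{j=1}^na_{ij}f_k(u_j^{[k]})-\Bigl(\frac1n\sum_{j=1}^nf_k'(u_j^{[k]})\Bigr)f_{k-1}(u_i^{[k-1]}),\qquad i\in[n].$$ *)

theory Defs
  imports "HOL-Probability.Probability"
begin

text \<open>
  A vector in \<open>\<real>\<^sup>n\<close> is a function \<open>nat \<Rightarrow> real\<close> of which only the values on \<open>{1..n}\<close> matter, and
  an \<open>n \<times> n\<close> matrix is a function \<open>nat \<Rightarrow> nat \<Rightarrow> real\<close> restricted to \<open>{1..n} \<times> {1..n}\<close>.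
\<close>

definition nnorm :: "nat \<Rightarrow> (nat \<Rightarrow> real) \<Rightarrow> real" where
  "nnorm n x = sqrt ((1 / real n) * (\<Sum>i=1..n. (x i)\<^sup>2))"

text \<open>The case \<open>m = 0\<close> of the following says that \<open>f\<close> itself is bounded.\<close>

definition bounded_smooth :: "(real \<Rightarrow> real) \<Rightarrow> bool" where
  "bounded_smooth f \<longleftrightarrow>
     (\<forall>m. (deriv ^^ m) f differentiable_on UNIV \<and> bounded (range ((deriv ^^ m) f)))"

definition strict_upper_pairs :: "nat \<Rightarrow> (nat \<times> nat) set" where
  "strict_upper_pairs n = {(i, j). 1 \<le> i \<and> i < j \<and> j \<le> n}"

text \<open>
  The library's \<^const>\<open>prob_space.indep_var\<close> forces the two random variables to have the same
  value type; this is the same notion for two arbitrary value types.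
\<close>

definition indep_rvs ::
  "'a measure \<Rightarrow> 'b measure \<Rightarrow> ('a \<Rightarrow> 'b) \<Rightarrow> 'c measure \<Rightarrow> ('a \<Rightarrow> 'c) \<Rightarrow> bool" where
  "indep_rvs M S X T Y \<longleftrightarrow>
     X \<in> measurable M S \<and> Y \<in> measurable M T \<and>
     prob_space.indep_set M
       (sigma_sets (space M) {X -` A \<inter> space M | A. A \<in> sets S})
       (sigma_sets (space M) {Y -` B \<inter> space M | B. B \<in> sets T})"

lemma (in prob_space) indep_rvs_iff_indep_var:
  "indep_rvs M S X T Y \<longleftrightarrow> indep_var S X T Y"
  by (simp add: indep_rvs_def indep_var_eq)

text \<open>
  \<open>cavity n a f u k S i\<close> is \<open>w\<^bsub>S,i\<^esub>\<close> at step \<open>k\<close>. It is meaningful for \<open>S \<subseteq> {1..n}\<close> with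
  \<open>card S + (k + 1) \<le> n\<close> and \<open>i \<in> {1..n} - S\<close>; the recursion started at such arguments only visits
  such arguments, so the values of the total function elsewhere play no role.
\<close>

fun cavity ::
  "nat \<Rightarrow> (nat \<Rightarrow> nat \<Rightarrow> real) \<Rightarrow> (nat \<Rightarrow> real \<Rightarrow> real) \<Rightarrow> (nat \<Rightarrow> real) \<Rightarrow>
     nat \<Rightarrow> nat set \<Rightarrow> nat \<Rightarrow> real" where
  "cavity n a f u 0 S i = u i"
| "cavity n a f u (Suc k) S i =
     (1 / sqrt (real n)) *
       (\<Sum>j\<in>{1..n} - (S \<union> {i}). a i j * f k (cavity n a f u k (S \<union> {i}) j))"

fun amp ::
  "nat \<Rightarrow> (nat \<Rightarrow> nat \<Rightarrow> real) \<Rightarrow> (nat \<Rightarrow> real \<Rightarrow> real) \<Rightarrow> (nat \<Rightarrow> real) \<Rightarrow>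
     nat \<Rightarrow> nat \<Rightarrow> real" where
  "amp n a f u 0 i = u i"
| "amp n a f u (Suc 0) i =
     (1 / sqrt (real n)) * (\<Sum>j=1..n. a i j * f 0 (u j))"
| "amp n a f u (Suc (Suc k)) i =
     (1 / sqrt (real n)) * (\<Sum>j=1..n. a i j * f (Suc k) (amp n a f u (Suc k) j))
     - ((1 / real n) * (\<Sum>j=1..n. deriv (f (Suc k)) (amp n a f u (Suc k) j)))
         * f k (amp n a f u k i)"

end

theory Submission
  imports Defs
begin

text \<open>
  By independence \<open>u\<close> may be fixed; all bounds are uniform in it.

  Since \<open>w\<^bsub>S,j\<^esub>\<close> does not depend on the matrix entries in the rows of \<open>S\<close>, each cavity step is a
  Gaussian sum conditionally on the other rows. Conditioning on one row at a time shows that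
  \<open>w\<^bsub>S,j\<^esub> - w\<^bsub>S\<union>{i},j\<^esub>\<close> is of order \<open>1 / sqrt n\<close> in every \<open>L\<^sup>p\<close> and that, up to order \<open>1 / n\<close>,
  it is a sum over the lengths \<open>r + 1\<close> of self-avoiding paths from \<open>j\<close> to \<open>i\<close>: a common factor,
  which depends on \<open>i\<close> only, times a linear form in row \<open>i\<close> whose coefficients are independent of
  that row. Substituting this in \<open>1 / sqrt n * (\<Sum>j. a\<^bsub>ij\<^esub> (f\<^sub>k (w\<^sub>j) - f\<^sub>k (w\<^bsub>{i},j\<^esub>)))\<close> yields quadratic
  forms in row \<open>i\<close>. The trace of the one with \<open>r = 0\<close> is the Onsager term, the others have no
  diagonal, and all their fluctuations are of order \<open>1 / sqrt n\<close> in \<open>L\<^sup>2\<close>.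

  Thus \<open>w\<close> satisfies the AMP recursion up to such errors. They propagate at a bounded rate as long as
  the operator norm of \<open>A / sqrt n\<close> is bounded. This fails with exponentially small probability
  only, and then a crude polynomial bound on \<open>u - w\<close> suffices.
\<close>

subsection \<open>Moments of Gaussian linear and quadratic forms\<close>

text \<open>The common factor of the expansion, a value f(w_i), depends on row i and so must not
  enter a quadratic form in that row. It therefore has to be the same for all j, to be pulled out as
  a bounded multiplier that leaves coefficients free of row i. The induction produces it with j
  removed as well, and putting j back costs a further factor 1 / sqrt n. Removing rows one after the
  other enlarges S, so every estimate is uniform in S, i, j and u. A product is estimated by
  doubling the exponent, so the final mean square bound draws on higher moments of the earlier
  quantities. Conditioning is Fubini with the other entries frozen, and expectations are nonnegative
  integrals, hence no integrability has to be carried along. The recursion for u - w is run path by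
  path.\<close>

abbreviation std_gauss :: "real measure" where
  "std_gauss \<equiv> density lborel (\<lambda>x. ennreal (std_normal_density x))"

abbreviation gauss_PiM :: "'e set \<Rightarrow> ('e \<Rightarrow> real) measure" where
  "gauss_PiM J \<equiv> PiM J (\<lambda>_. std_gauss)"

lemma prob_space_std_gauss: "prob_space std_gauss"
  by (rule prob_space_normal_density) simp

interpretation std_gauss: prob_space std_gauss
  by (rule prob_space_std_gauss)

interpretation gauss_PiM: product_sigma_finite "\<lambda>_. std_gauss"
  by unfold_locales

lemma prob_space_gauss_PiM: "prob_space (gauss_PiM J)"
  by (rule prob_space_PiM) (rule prob_space_std_gauss)

text \<open>Completing the square turns the tilted density into a shifted normal density.\<close>

lemma nn_integral_std_gauss_exp:
  "(\<integral>\<^sup>+ y. ennreal (exp (t * y)) \<partial>std_gauss) = ennreal (exp (t\<^sup>2 / 2))"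
proof -
  have eq: "std_normal_density y * exp (t * y) = exp (t\<^sup>2 / 2) * normal_density t 1 y" for y
    by (simp add: normal_density_def exp_add[symmetric] power2_eq_square field_simps)
  have "(\<integral>\<^sup>+ y. ennreal (exp (t * y)) \<partial>std_gauss)
      = (\<integral>\<^sup>+ y. ennreal (exp (t\<^sup>2 / 2)) * ennreal (normal_density t 1 y) \<partial>lborel)"
    by (subst nn_integral_density) (auto simp: eq ennreal_mult[symmetric])
  also have "\<dots> = ennreal (exp (t\<^sup>2 / 2)) * (\<integral>\<^sup>+ y. ennreal (normal_density t 1 y) \<partial>lborel)"
    by (rule nn_integral_cmult) auto
  also have "(\<integral>\<^sup>+ y. ennreal (normal_density t 1 y) \<partial>lborel) = 1"
    by (subst nn_integral_eq_integral) auto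
  finally show ?thesis by simp
qed

lemma nn_integral_gauss_PiM_exp:
  assumes "finite J"
  shows "(\<integral>\<^sup>+ y. ennreal (exp (\<Sum>e\<in>J. c e * y e)) \<partial>gauss_PiM J)
    = ennreal (exp ((\<Sum>e\<in>J. (c e)\<^sup>2) / 2))"
proof -
  have "(\<integral>\<^sup>+ y. ennreal (exp (\<Sum>e\<in>J. c e * y e)) \<partial>gauss_PiM J)
      = (\<integral>\<^sup>+ y. (\<Prod>e\<in>J. ennreal (exp (c e * y e))) \<partial>gauss_PiM J)"
    using assms by (simp add: exp_sum prod_ennreal)
  also have "\<dots> = (\<Prod>e\<in>J. \<integral>\<^sup>+ y. ennreal (exp (c e * y)) \<partial>std_gauss)"
    by (rule gauss_PiM.product_nn_integral_prod) (use assms in auto)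
  also have "\<dots> = ennreal (exp ((\<Sum>e\<in>J. (c e)\<^sup>2) / 2))"
    using assms
    by (simp add: nn_integral_std_gauss_exp prod_ennreal exp_sum[symmetric] sum_divide_distrib)
  finally show ?thesis .
qed

lemma power_le_fact_exp:
  fixes x :: real
  assumes "x \<ge> 0"
  shows "x ^ p \<le> fact p * exp x"
proof -
  have "inverse (fact p) *\<^sub>R x ^ p \<le> exp x"
    unfolding exp_def
    using sum_le_suminf[OF summable_exp_generic[of x], of "{p}"] assms by simp
  then show ?thesis by (simp add: field_simps)
qed

lemma abs_power_le_exp:
  fixes x :: real
  shows "\<bar>x\<bar> ^ p \<le> fact p * (exp x + exp (- x))"
proof -
  have "exp \<bar>x\<bar> \<le> exp x + exp (- x)" by (cases "x \<ge> 0") auto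
  then have "fact p * exp \<bar>x\<bar> \<le> fact p * (exp x + exp (- x))"
    by (intro mult_left_mono) auto
  with power_le_fact_exp[of "\<bar>x\<bar>" p] show ?thesis by linarith
qed

lemma exp_half_le_2: "exp (1 / 2 :: real) \<le> 2"
proof -
  have "(exp (1/2 :: real))\<^sup>2 \<le> 2\<^sup>2"
    using exp_le by (simp add: power2_eq_square exp_add[symmetric])
  then show ?thesis by (rule power2_le_imp_le) simp
qed

text \<open>After scaling to unit variance the power is dominated by
  \<open>fact p * (exp x + exp (- x))\<close>, whose expectation is
  \<open>2 * exp (1 / 2) \<le> 4\<close> times \<open>fact p\<close>. For even \<open>p\<close> the
  scale \<open>s ^ p\<close> is an integer power of the variance.\<close>

lemma gauss_PiM_linear_moment:
  assumes "finite J" "even p" "p > 0"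
  shows "(\<integral>\<^sup>+ y. ennreal (\<bar>\<Sum>e\<in>J. c e * y e\<bar> ^ p) \<partial>gauss_PiM J)
    \<le> ennreal (4 * fact p * (\<Sum>e\<in>J. (c e)\<^sup>2) ^ (p div 2))"
proof (cases "(\<Sum>e\<in>J. (c e)\<^sup>2) = 0")
  case True
  then have "\<forall>e\<in>J. c e = 0" using assms(1) by (simp add: sum_nonneg_eq_0_iff)
  then show ?thesis using assms by (simp add: power_0_left)
next
  case False
  define s where "s = sqrt (\<Sum>e\<in>J. (c e)\<^sup>2)"
  have pos: "(\<Sum>e\<in>J. (c e)\<^sup>2) > 0" using False by (simp add: order_less_le sum_nonneg)
  then have s: "s > 0" "s\<^sup>2 = (\<Sum>e\<in>J. (c e)\<^sup>2)" by (auto simp: s_def)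
  have sp: "(\<Sum>e\<in>J. (c e)\<^sup>2) ^ (p div 2) = s ^ p"
    using assms(2) by (simp add: s(2)[symmetric] power_mult[symmetric])
  have mgf: "(\<integral>\<^sup>+ y. ennreal (exp (\<Sum>e\<in>J. (r * c e / s) * y e)) \<partial>gauss_PiM J) \<le> 2"
    if "r\<^sup>2 = 1" for r
  proof -
    have "(\<Sum>e\<in>J. (r * c e / s)\<^sup>2) = 1"
      using s that False
      by (simp add: power_mult_distrib power_divide sum_divide_distrib[symmetric])
    then show ?thesis
      using exp_half_le_2 ennreal_leI[OF exp_half_le_2]
      by (simp only: nn_integral_gauss_PiM_exp[OF assms(1)] ennreal_numeral)
  qed
  have "(\<integral>\<^sup>+ y. ennreal (\<bar>\<Sum>e\<in>J. c e * y e\<bar> ^ p) \<partial>gauss_PiM J)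
      \<le> (\<integral>\<^sup>+ y. ennreal (s ^ p * fact p) * (ennreal (exp (\<Sum>e\<in>J. (1 * c e / s) * y e))
            + ennreal (exp (\<Sum>e\<in>J. (-1 * c e / s) * y e))) \<partial>gauss_PiM J)"
  proof (rule nn_integral_mono)
    fix y
    define x where "x = (\<Sum>e\<in>J. (c e / s) * y e)"
    have 1: "(\<Sum>e\<in>J. c e * y e) = s * x"
      using s by (simp add: x_def sum_distrib_left field_simps)
    have 2: "(\<Sum>e\<in>J. (-1 * c e / s) * y e) = - x" by (simp add: x_def sum_negf)
    have 3: "(\<Sum>e\<in>J. (1 * c e / s) * y e) = x" by (simp add: x_def)
    have "\<bar>s * x\<bar> ^ p \<le> (s ^ p * fact p) * (exp x + exp (- x))"
      using abs_power_le_exp[of x p] s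
      by (simp add: abs_mult power_mult_distrib mult.assoc)
    then show "ennreal (\<bar>\<Sum>e\<in>J. c e * y e\<bar> ^ p)
        \<le> ennreal (s ^ p * fact p) * (ennreal (exp (\<Sum>e\<in>J. (1 * c e / s) * y e))
            + ennreal (exp (\<Sum>e\<in>J. (-1 * c e / s) * y e)))"
      unfolding 1 2 3 using s
      by (simp add: ennreal_plus[symmetric] ennreal_mult[symmetric]
          del: ennreal_plus)
  qed
  also have "\<dots> = ennreal (s ^ p * fact p)
      * ((\<integral>\<^sup>+ y. ennreal (exp (\<Sum>e\<in>J. (1 * c e / s) * y e)) \<partial>gauss_PiM J)
          + (\<integral>\<^sup>+ y. ennreal (exp (\<Sum>e\<in>J. (-1 * c e / s) * y e)) \<partial>gauss_PiM J))"
    by (subst nn_integral_cmult, measurable, subst nn_integral_add, measurable)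
  also have "\<dots> \<le> ennreal (s ^ p * fact p) * (2 + 2)"
    by (intro mult_left_mono add_mono mgf) auto
  also have "\<dots> = ennreal (s ^ p * fact p) * ennreal 4" by simp
  also have "\<dots> = ennreal (4 * fact p * s ^ p)"
    using s by (subst ennreal_mult[symmetric]) (auto simp: mult_ac)
  finally show ?thesis by (simp add: sp)
qed

text \<open>1, y and y^2 - 1 are Hermite polynomials, orthogonal under the Gaussian law with squared
  norms 1, 1 and 2.\<close>

lemma std_gauss_quadratic_moment:
  "(\<integral>\<^sup>+ y. ennreal ((a + b * y + c * (y\<^sup>2 - 1))\<^sup>2) \<partial>std_gauss) = ennreal (a\<^sup>2 + b\<^sup>2 + 2 * c\<^sup>2)"
proof -
  let ?d = std_normal_density
  have m0: "has_bochner_integral lborel (\<lambda>x. ?d x * x ^ 0) 1"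
    using std_normal_moment_even[of 0] by simp
  have m1: "has_bochner_integral lborel (\<lambda>x. ?d x * x ^ 1) 0"
    using std_normal_moment_odd[of 0] by simp
  have m2: "has_bochner_integral lborel (\<lambda>x. ?d x * x ^ 2) 1"
    using std_normal_moment_even[of 1] by (simp add: fact_numeral)
  have m3: "has_bochner_integral lborel (\<lambda>x. ?d x * x ^ 3) 0"
    using std_normal_moment_odd[of 1] by (simp add: numeral_3_eq_3)
  have m4: "has_bochner_integral lborel (\<lambda>x. ?d x * x ^ 4) 3"
    using std_normal_moment_even[of 2] by (simp add: fact_numeral)
  \<comment> \<open>The square is expanded in monomials, with constant coefficient
    \<open>a - c\<close> before squaring; the moments of order 0 to 4 are 1, 0, 1, 0, 3.\<close>
  have "has_bochner_integral lborel
      (\<lambda>x. (a - c)\<^sup>2 * (?d x * x ^ 0) + 2 * b * (a - c) * (?d x * x ^ 1)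
        + (b\<^sup>2 + 2 * c * (a - c)) * (?d x * x ^ 2) + 2 * b * c * (?d x * x ^ 3) + c\<^sup>2 * (?d x * x ^ 4))
      ((a - c)\<^sup>2 * 1 + 2 * b * (a - c) * 0 + (b\<^sup>2 + 2 * c * (a - c)) * 1 + 2 * b * c * 0 + c\<^sup>2 * 3)"
    by (intro has_bochner_integral_add has_bochner_integral_mult_right m0 m1 m2 m3 m4)
  also have "(\<lambda>x. (a - c)\<^sup>2 * (?d x * x ^ 0) + 2 * b * (a - c) * (?d x * x ^ 1)
        + (b\<^sup>2 + 2 * c * (a - c)) * (?d x * x ^ 2) + 2 * b * c * (?d x * x ^ 3) + c\<^sup>2 * (?d x * x ^ 4))
      = (\<lambda>x. ?d x * (a + b * x + c * (x\<^sup>2 - 1))\<^sup>2)"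
    by (rule ext) algebra
  also have "((a - c)\<^sup>2 * 1 + 2 * b * (a - c) * 0 + (b\<^sup>2 + 2 * c * (a - c)) * 1 + 2 * b * c * 0 + c\<^sup>2 * 3)
      = a\<^sup>2 + b\<^sup>2 + 2 * c\<^sup>2"
    by algebra
  finally have "has_bochner_integral lborel (\<lambda>x. ?d x * (a + b * x + c * (x\<^sup>2 - 1))\<^sup>2)
      (a\<^sup>2 + b\<^sup>2 + 2 * c\<^sup>2)" .
  then have "(\<integral>\<^sup>+ x. ennreal (?d x * (a + b * x + c * (x\<^sup>2 - 1))\<^sup>2) \<partial>lborel)
      = ennreal (a\<^sup>2 + b\<^sup>2 + 2 * c\<^sup>2)"
    by (subst nn_integral_eq_integral) (auto simp: has_bochner_integral_iff)
  then show ?thesis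
    by (subst nn_integral_density) (auto simp: ennreal_mult[symmetric])
qed

lemma gauss_PiM_linear_second_moment:
  assumes "finite J"
  shows "(\<integral>\<^sup>+ y. ennreal ((\<Sum>e\<in>J. c e * y e)\<^sup>2) \<partial>gauss_PiM J) = ennreal (\<Sum>e\<in>J. (c e)\<^sup>2)"
  using assms
proof (induction J rule: finite_induct)
  case empty
  then show ?case by simp
next
  case (insert m J)
  have "(\<integral>\<^sup>+ y. ennreal ((\<Sum>e\<in>insert m J. c e * y e)\<^sup>2) \<partial>gauss_PiM (insert m J))
      = (\<integral>\<^sup>+ x. (\<integral>\<^sup>+ y. ennreal ((\<Sum>e\<in>insert m J. c e * (x(m := y)) e)\<^sup>2) \<partial>std_gauss) \<partial>gauss_PiM J)"
    by (rule gauss_PiM.product_nn_integral_insert) (use insert in auto)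
  also have "\<dots> = (\<integral>\<^sup>+ x. (\<integral>\<^sup>+ y. ennreal (((\<Sum>e\<in>J. c e * x e) + c m * y + 0 * (y\<^sup>2 - 1))\<^sup>2) \<partial>std_gauss) \<partial>gauss_PiM J)"
  proof (intro nn_integral_cong, goal_cases)
    case (1 x y)
    have "(\<Sum>e\<in>insert m J. c e * (x(m := y)) e) = (\<Sum>e\<in>J. c e * x e) + c m * y"
      using insert by (subst sum.insert) (auto intro!: sum.cong)
    then show ?case by (simp del: fun_upd_apply)
  qed
  also have "\<dots> = (\<integral>\<^sup>+ x. ennreal ((\<Sum>e\<in>J. c e * x e)\<^sup>2) + ennreal ((c m)\<^sup>2) \<partial>gauss_PiM J)"
    by (simp add: std_gauss_quadratic_moment[where c = 0, simplified])
  also have "\<dots> = ennreal (\<Sum>e\<in>J. (c e)\<^sup>2) + ennreal ((c m)\<^sup>2)"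
    using prob_space.emeasure_space_1[OF prob_space_gauss_PiM, of J]
    by (subst nn_integral_add) (auto simp: insert.IH)
  also have "\<dots> = ennreal (\<Sum>e\<in>insert m J. (c e)\<^sup>2)"
    using insert by (simp add: ennreal_plus[symmetric] sum_nonneg add.commute del: ennreal_plus)
  finally show ?case .
qed

text \<open>A new coordinate y turns the centred form into the old form, plus a linear form times y,
  plus a multiple of y^2 - 1; given the other coordinates these are orthogonal. The only loss is (a
  + b)^2 \<le> 2 a^2 + 2 b^2, because \<open>H\<close> may be asymmetric.\<close>

lemma gauss_PiM_quadratic_second_moment:
  assumes "finite J"
  shows "(\<integral>\<^sup>+ y. ennreal ((\<Sum>e\<in>J. \<Sum>e'\<in>J. (y e * y e' - (if e = e' then 1 else 0)) * H e e')\<^sup>2)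
      \<partial>gauss_PiM J) \<le> ennreal (2 * (\<Sum>e\<in>J. \<Sum>e'\<in>J. (H e e')\<^sup>2))"
  using assms
proof (induction J rule: finite_induct)
  case empty
  then show ?case by simp
next
  case (insert m J)
  let ?T = "\<lambda>x. \<Sum>e\<in>J. \<Sum>e'\<in>J. (x e * x e' - (if e = e' then 1 else 0)) * H e e'"
  let ?L = "\<lambda>x :: 'a \<Rightarrow> real. \<Sum>e\<in>J. (H m e + H e m) * x e"
  have "(\<integral>\<^sup>+ y. ennreal ((\<Sum>e\<in>insert m J. \<Sum>e'\<in>insert m J. (y e * y e' - (if e = e' then 1 else 0)) * H e e')\<^sup>2)
      \<partial>gauss_PiM (insert m J)) = (\<integral>\<^sup>+ x. (\<integral>\<^sup>+ y. ennreal ((\<Sum>e\<in>insert m J. \<Sum>e'\<in>insert m J. ((x(m := y)) e * (x(m := y)) e' - (if e = e' then 1 else 0)) * H e e')\<^sup>2) \<partial>std_gauss) \<partial>gauss_PiM J)"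
    by (rule gauss_PiM.product_nn_integral_insert) (use insert in auto)
  also have "\<dots> = (\<integral>\<^sup>+ x. (\<integral>\<^sup>+ y. ennreal ((?T x + ?L x * y + H m m * (y\<^sup>2 - 1))\<^sup>2) \<partial>std_gauss) \<partial>gauss_PiM J)"
  proof (intro nn_integral_cong, goal_cases)
    case (1 x y)
    have neq: "e \<noteq> m" if "e \<in> J" for e using that insert by auto
    let ?G = "\<lambda>e e'. ((x(m := y)) e * (x(m := y)) e' - (if e = e' then 1 else 0)) * H e e'"
    have "(\<Sum>e\<in>insert m J. \<Sum>e'\<in>insert m J. ?G e e')
        = (\<Sum>e\<in>J. \<Sum>e'\<in>J. ?G e e') + (\<Sum>e\<in>J. ?G m e) + (\<Sum>e\<in>J. ?G e m) + ?G m m"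
      by (simp only: sum.insert[OF insert(1,2)] sum.distrib ac_simps)
    also have "(\<Sum>e\<in>J. \<Sum>e'\<in>J. ?G e e') = ?T x"
      by (intro sum.cong refl) (use neq in auto)
    also have "(\<Sum>e\<in>J. ?G m e) = (\<Sum>e\<in>J. H m e * x e) * y"
      by (subst sum_distrib_right, intro sum.cong refl) (use neq in auto)
    also have "(\<Sum>e\<in>J. ?G e m) = (\<Sum>e\<in>J. H e m * x e) * y"
      by (subst sum_distrib_right, intro sum.cong refl) (use neq in auto)
    finally have "(\<Sum>e\<in>insert m J. \<Sum>e'\<in>insert m J. ?G e e') = ?T x + ?L x * y + H m m * (y\<^sup>2 - 1)"
      by (simp add: algebra_simps sum.distrib power2_eq_square)
    then show ?case by (simp only:)
  qed
  also have "\<dots> = (\<integral>\<^sup>+ x. ennreal ((?T x)\<^sup>2) + ennreal ((?L x)\<^sup>2) + ennreal (2 * (H m m)\<^sup>2) \<partial>gauss_PiM J)"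
    by (simp add: std_gauss_quadratic_moment)
  also have "\<dots> = (\<integral>\<^sup>+ x. ennreal ((?T x)\<^sup>2) \<partial>gauss_PiM J) + (\<integral>\<^sup>+ x. ennreal ((?L x)\<^sup>2) \<partial>gauss_PiM J) + ennreal (2 * (H m m)\<^sup>2)"
    using prob_space.emeasure_space_1[OF prob_space_gauss_PiM, of J]
    by (subst nn_integral_add, measurable, subst nn_integral_add, measurable) 
  also have "\<dots> \<le> ennreal (2 * (\<Sum>e\<in>J. \<Sum>e'\<in>J. (H e e')\<^sup>2)) + ennreal (\<Sum>e\<in>J. 2 * (H m e)\<^sup>2 + 2 * (H e m)\<^sup>2) + ennreal (2 * (H m m)\<^sup>2)"
  proof (intro add_mono order_refl insert.IH)
    have "(H m e + H e m)\<^sup>2 \<le> 2 * (H m e)\<^sup>2 + 2 * (H e m)\<^sup>2" for e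
      using sum_squares_bound[of "H m e" "H e m"] by (simp add: power2_sum)
    then show "(\<integral>\<^sup>+ x. ennreal ((?L x)\<^sup>2) \<partial>gauss_PiM J) \<le> ennreal (\<Sum>e\<in>J. 2 * (H m e)\<^sup>2 + 2 * (H e m)\<^sup>2)"
      by (subst gauss_PiM_linear_second_moment[OF insert(1)]) (intro ennreal_leI sum_mono)
  qed
  also have "\<dots> = ennreal (2 * (\<Sum>e\<in>J. \<Sum>e'\<in>J. (H e e')\<^sup>2) + (\<Sum>e\<in>J. 2 * (H m e)\<^sup>2 + 2 * (H e m)\<^sup>2) + 2 * (H m m)\<^sup>2)"
    by (simp add: ennreal_plus[symmetric] sum_nonneg del: ennreal_plus)
  also have "2 * (\<Sum>e\<in>J. \<Sum>e'\<in>J. (H e e')\<^sup>2) + (\<Sum>e\<in>J. 2 * (H m e)\<^sup>2 + 2 * (H e m)\<^sup>2) + 2 * (H m m)\<^sup>2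
      = 2 * (\<Sum>e\<in>insert m J. \<Sum>e'\<in>insert m J. (H e e')\<^sup>2)"
    using insert by (simp only: sum.insert[OF insert(1,2)] sum.distrib) (simp add: sum_distrib_left algebra_simps sum.distrib)
  finally show ?case .
qed

subsection \<open>Conditioning on one row of the matrix\<close>

definition row_pairs :: "nat \<Rightarrow> nat \<Rightarrow> (nat \<times> nat) set" where
  "row_pairs n j = {(p, q) \<in> strict_upper_pairs n. p = j \<or> q = j}"

text \<open>The value 0 outside the matrix and on the diagonal gives a measurable function for all
  indices and lets sums include the diagonal for free.\<close>

definition ent :: "nat \<Rightarrow> nat \<Rightarrow> nat \<Rightarrow> (nat \<times> nat \<Rightarrow> real) \<Rightarrow> real" where
  "ent n i j \<omega> = (if i \<in> {1..n} \<and> j \<in> {1..n} \<and> i \<noteq> j then \<omega> (min i j, max i j) else 0)"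

abbreviation goe :: "nat \<Rightarrow> (nat \<times> nat \<Rightarrow> real) measure" where
  "goe n \<equiv> gauss_PiM (strict_upper_pairs n)"

text \<open>Independence of row \<open>j\<close> in pointwise form, without sigma-algebras: in an
  integral over row \<open>j\<close> with the other entries frozen, such an \<open>X\<close> is a
  constant. The property passes trivially to compositions and sums.\<close>

definition row_free :: "nat \<Rightarrow> ((nat \<times> nat \<Rightarrow> real) \<Rightarrow> 'c) \<Rightarrow> bool" where
  "row_free j X \<longleftrightarrow>
     (\<forall>\<omega> \<omega>'. (\<forall>p q. p \<noteq> j \<longrightarrow> q \<noteq> j \<longrightarrow> \<omega> (p, q) = \<omega>' (p, q)) \<longrightarrow> X \<omega> = X \<omega>')"

lemma finite_strict_upper_pairs [simp]: "finite (strict_upper_pairs n)"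
  by (rule finite_subset[of _ "{1..n} \<times> {1..n}"]) (auto simp: strict_upper_pairs_def)

lemma row_subset: "row_pairs n j \<subseteq> strict_upper_pairs n"
  by (auto simp: row_pairs_def)

lemma finite_row [simp]: "finite (row_pairs n j)"
  using row_subset by (rule finite_subset) simp

lemma emeasure_space_goe [simp]: "emeasure (goe n) (space (goe n)) = 1"
  by (rule prob_space.emeasure_space_1[OF prob_space_gauss_PiM])

lemma ent_sym: "ent n i j = ent n j i"
  by (auto simp: ent_def fun_eq_iff min.commute max.commute)

lemma ent_diag [simp]: "ent n i i = (\<lambda>_. 0)"
  by (simp add: ent_def fun_eq_iff)

lemma ent_measurable [measurable]: "ent n i j \<in> borel_measurable (goe n)"
proof (cases "i \<in> {1..n} \<and> j \<in> {1..n} \<and> i \<noteq> j")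
  case True
  have "(\<lambda>\<omega>. \<omega> (min i j, max i j)) \<in> borel_measurable (goe n)"
    using measurable_component_singleton[of "(min i j, max i j)" "strict_upper_pairs n" "\<lambda>_. std_gauss"]
      True by (auto simp: strict_upper_pairs_def)
  then show ?thesis using True by (simp add: ent_def[abs_def])
next
  case False
  then have "ent n i j = (\<lambda>_. 0)" by (auto simp: ent_def fun_eq_iff)
  then show ?thesis by simp
qed

lemma row_freeD:
  "row_free j X \<Longrightarrow> (\<And>p q. p \<noteq> j \<Longrightarrow> q \<noteq> j \<Longrightarrow> \<omega> (p, q) = \<omega>' (p, q)) \<Longrightarrow> X \<omega> = X \<omega>'"
  by (auto simp: row_free_def)

lemma row_free_ent: "i \<noteq> j \<Longrightarrow> l \<noteq> j \<Longrightarrow> row_free j (ent n i l)"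
  by (auto simp: row_free_def ent_def min_def max_def)

lemma row_free_const: "row_free j (\<lambda>_. c)"
  by (simp add: row_free_def)

lemma row_free_comp: "row_free j X \<Longrightarrow> row_free j (\<lambda>\<omega>. g (X \<omega>))"
  unfolding row_free_def by (intro allI impI arg_cong[of _ _ g]) blast

lemma row_free_comp2: "row_free j X \<Longrightarrow> row_free j Y \<Longrightarrow> row_free j (\<lambda>\<omega>. g (X \<omega>) (Y \<omega>))"
  unfolding row_free_def by (intro allI impI arg_cong2[of _ _ _ _ g]) blast+

lemma row_free_sum: "(\<And>l. l \<in> L \<Longrightarrow> row_free j (X l)) \<Longrightarrow> row_free j (\<lambda>\<omega>. \<Sum>l\<in>L. X l \<omega>)"
  unfolding row_free_def by (intro allI impI sum.cong refl) blast

abbreviation row_merge :: "nat \<Rightarrow> nat \<Rightarrow> (nat \<times> nat \<Rightarrow> real) \<Rightarrow> (nat \<times> nat \<Rightarrow> real) \<Rightarrow> nat \<times> nat \<Rightarrow> real" where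
  "row_merge n j x y \<equiv> merge (strict_upper_pairs n - row_pairs n j) (row_pairs n j) (x, y)"

lemma nn_integral_row_split:
  assumes [measurable]: "X \<in> borel_measurable (goe n)"
  shows "(\<integral>\<^sup>+ \<omega>. X \<omega> \<partial>goe n) = (\<integral>\<^sup>+ x. (\<integral>\<^sup>+ y. X (row_merge n j x y)
      \<partial>gauss_PiM (row_pairs n j)) \<partial>gauss_PiM (strict_upper_pairs n - row_pairs n j))"
proof -
  have "(strict_upper_pairs n - row_pairs n j) \<inter> row_pairs n j = {}" by auto
  then show ?thesis
    using gauss_PiM.product_nn_integral_fold[of "strict_upper_pairs n - row_pairs n j" "row_pairs n j" X]
      row_subset[of n j] by (simp add: Un_absorb2)
qed

text \<open>This is conditioning on the entries outside row \<open>j\<close>: they are frozen as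
  \<open>x\<close>, and an inequality between the inner integrals becomes one between
  expectations.\<close>

lemma nn_integral_row_mono:
  assumes "X \<in> borel_measurable (goe n)" "Z \<in> borel_measurable (goe n)"
    and "\<And>x. (\<integral>\<^sup>+ y. X (row_merge n j x y) \<partial>gauss_PiM (row_pairs n j))
      \<le> (\<integral>\<^sup>+ y. Z (row_merge n j x y) \<partial>gauss_PiM (row_pairs n j))"
  shows "(\<integral>\<^sup>+ \<omega>. X \<omega> \<partial>goe n) \<le> (\<integral>\<^sup>+ \<omega>. Z \<omega> \<partial>goe n)"
  unfolding nn_integral_row_split[OF assms(1), of j] nn_integral_row_split[OF assms(2), of j]
  by (intro nn_integral_mono assms(3))

lemma row_free_merge:
  "row_free j X \<Longrightarrow> X (row_merge n j x y)
    = X (row_merge n j x z)"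
  by (erule row_freeD) (auto simp: merge_def row_pairs_def)

lemma ent_merge:
  assumes "j \<in> {1..n}" "l \<in> {1..n} - {j}"
  shows "ent n j l (row_merge n j x y) = y (min j l, max j l)"
  using assms by (auto simp: ent_def merge_def row_pairs_def strict_upper_pairs_def)

text \<open>\<open>fst e + snd e - j\<close> is the endpoint of the pair \<open>e\<close> other than \<open>j\<close>.\<close>

lemma sum_row:
  fixes g :: "nat \<Rightarrow> nat \<times> nat \<Rightarrow> 'c::comm_monoid_add"
  assumes "j \<in> {1..n}"
  shows "(\<Sum>l\<in>{1..n} - {j}. g l (min j l, max j l)) = (\<Sum>e\<in>row_pairs n j. g (fst e + snd e - j) e)"
  by (rule sum.reindex_bij_witness[where i = "\<lambda>e. fst e + snd e - j" and j = "\<lambda>l. (min j l, max j l)"])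
    (use assms in \<open>auto simp: row_pairs_def strict_upper_pairs_def min_def max_def\<close>)

text \<open>With the entries outside row \<open>j\<close> frozen, the \<open>Y l\<close> are
  constants and the entries of the row are i.i.d. standard Gaussian, so the estimate for Gaussian
  linear forms applies to the inner integral.\<close>

lemma goe_linear_moment:
  assumes j: "j \<in> {1..n}" and L: "L \<subseteq> {1..n} - {j}" and p: "even p" "p > 0"
    and Ym: "\<And>l. l \<in> L \<Longrightarrow> Y l \<in> borel_measurable (goe n)"
    and Yf: "\<And>l. l \<in> L \<Longrightarrow> row_free j (Y l)"
  shows "(\<integral>\<^sup>+ \<omega>. ennreal (\<bar>\<Sum>l\<in>L. ent n j l \<omega> * Y l \<omega>\<bar> ^ p) \<partial>goe n)
    \<le> (\<integral>\<^sup>+ \<omega>. ennreal (4 * fact p * (\<Sum>l\<in>L. (Y l \<omega>)\<^sup>2) ^ (p div 2)) \<partial>goe n)"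
proof -
  note Ym[measurable]
  show ?thesis
  proof (rule nn_integral_row_mono[where j = j])
    fix x
    \<comment> \<open>Row \<open>j\<close> may be filled with any value, here 0, since
      \<open>Y l\<close> does not see it. The coefficient 0 outside \<open>L\<close> lets the sum
      run over the whole row.\<close>
    define c where "c l = (if l \<in> L then Y l (row_merge n j x (\<lambda>_. 0)) else 0)" for l
    have Yc: "Y l (row_merge n j x y) = c l" if "l \<in> L" for l y
      using row_free_merge[OF Yf[OF that], of n x y "\<lambda>_. 0"] that by (simp add: c_def)
    have lin: "(\<Sum>l\<in>L. ent n j l (row_merge n j x y) * Y l (row_merge n j x y))
        = (\<Sum>e\<in>row_pairs n j. c (fst e + snd e - j) * y e)" for y
    proof -
      have "(\<Sum>l\<in>L. ent n j l (row_merge n j x y) * Y l (row_merge n j x y))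
          = (\<Sum>l\<in>{1..n} - {j}. ent n j l (row_merge n j x y) * c l)"
        using L by (intro sum.mono_neutral_cong_left) (auto simp: Yc, auto simp: c_def)
      also have "\<dots> = (\<Sum>l\<in>{1..n} - {j}. c l * y (min j l, max j l))"
        by (intro sum.cong refl) (simp only: ent_merge[OF j] mult.commute)
      finally show ?thesis using sum_row[OF j, of "\<lambda>l e. c l * y e"] by simp
    qed
    have sq: "(\<Sum>l\<in>L. (Y l (row_merge n j x y))\<^sup>2) = (\<Sum>e\<in>row_pairs n j. (c (fst e + snd e - j))\<^sup>2)" for y
    proof -
      have "(\<Sum>l\<in>L. (Y l (row_merge n j x y))\<^sup>2) = (\<Sum>l\<in>{1..n} - {j}. (c l)\<^sup>2)"
        using L by (intro sum.mono_neutral_cong_left) (auto simp: Yc, auto simp: c_def)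
      then show ?thesis using sum_row[OF j, of "\<lambda>l e. (c l)\<^sup>2"] by simp
    qed
    show "(\<integral>\<^sup>+ y. ennreal (\<bar>\<Sum>l\<in>L. ent n j l (row_merge n j x y) * Y l (row_merge n j x y)\<bar> ^ p) \<partial>gauss_PiM (row_pairs n j))
      \<le> (\<integral>\<^sup>+ y. ennreal (4 * fact p * (\<Sum>l\<in>L. (Y l (row_merge n j x y))\<^sup>2) ^ (p div 2)) \<partial>gauss_PiM (row_pairs n j))"
      unfolding lin sq
      using gauss_PiM_linear_moment[OF finite_row p]
      by (simp add: prob_space.emeasure_space_1[OF prob_space_gauss_PiM])
  qed measurable
qed

lemma goe_quadratic_moment:
  assumes j: "j \<in> {1..n}"
    and Hm: "\<And>l m. l \<in> {1..n} - {j} \<Longrightarrow> m \<in> {1..n} - {j} \<Longrightarrow> H l m \<in> borel_measurable (goe n)"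
    and Hf: "\<And>l m. l \<in> {1..n} - {j} \<Longrightarrow> m \<in> {1..n} - {j} \<Longrightarrow> row_free j (H l m)"
  shows "(\<integral>\<^sup>+ \<omega>. ennreal ((\<Sum>l\<in>{1..n} - {j}. \<Sum>m\<in>{1..n} - {j}.
        (ent n j l \<omega> * ent n j m \<omega> - (if l = m then 1 else 0)) * H l m \<omega>)\<^sup>2) \<partial>goe n)
    \<le> (\<integral>\<^sup>+ \<omega>. ennreal (2 * (\<Sum>l\<in>{1..n} - {j}. \<Sum>m\<in>{1..n} - {j}. (H l m \<omega>)\<^sup>2)) \<partial>goe n)"
proof -
  note Hm[measurable]
  let ?L = "{1..n} - {j}"
  show ?thesis
  proof (rule nn_integral_row_mono[where j = j])
    fix x
    define c where "c l m = H l m (row_merge n j x (\<lambda>_. 0))" for l m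
    have Hc: "H l m (row_merge n j x y) = c l m" if "l \<in> ?L" "m \<in> ?L" for l m y
      using row_free_merge[OF Hf[OF that], of n x y "\<lambda>_. 0"] that by (simp add: c_def)
    let ?o = "\<lambda>e. fst e + snd e - j"
    \<comment> \<open>Distinct pairs of the row have distinct other endpoints, so the Kronecker term
      for \<open>l = m\<close> becomes the one for \<open>e = e'\<close>.\<close>
    have o_inj: "?o e = ?o e' \<longleftrightarrow> e = e'" if "e \<in> row_pairs n j" "e' \<in> row_pairs n j" for e e'
      using that j by (cases e; cases e') (auto simp: row_pairs_def strict_upper_pairs_def)
    have quad: "(\<Sum>l\<in>?L. \<Sum>m\<in>?L. (ent n j l (row_merge n j x y) * ent n j m (row_merge n j x y) - (if l = m then 1 else 0)) * H l m (row_merge n j x y))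
        = (\<Sum>e\<in>row_pairs n j. \<Sum>e'\<in>row_pairs n j. (y e * y e' - (if e = e' then 1 else 0)) * c (?o e) (?o e'))" for y
    proof -
      have "(\<Sum>l\<in>?L. \<Sum>m\<in>?L. (ent n j l (row_merge n j x y) * ent n j m (row_merge n j x y) - (if l = m then 1 else 0)) * H l m (row_merge n j x y))
          = (\<Sum>l\<in>?L. \<Sum>m\<in>?L. (y (min j l, max j l) * y (min j m, max j m) - (if l = m then 1 else 0)) * c l m)"
        by (intro sum.cong refl) (simp only: ent_merge[OF j] Hc)
      also have "\<dots> = (\<Sum>l\<in>?L. \<Sum>e'\<in>row_pairs n j. (y (min j l, max j l) * y e' - (if l = ?o e' then 1 else 0)) * c l (?o e'))"
        by (intro sum.cong refl) (rule sum_row[OF j, where g = "\<lambda>m e'. (y (min j l, max j l) * y e' - (if l = m then 1 else 0)) * c l m" for l])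
      also have "\<dots> = (\<Sum>e\<in>row_pairs n j. \<Sum>e'\<in>row_pairs n j. (y e * y e' - (if ?o e = ?o e' then 1 else 0)) * c (?o e) (?o e'))"
        by (rule sum_row[OF j, where g = "\<lambda>l e. \<Sum>e'\<in>row_pairs n j. (y e * y e' - (if l = ?o e' then 1 else 0)) * c l (?o e')"])
      also have "\<dots> = (\<Sum>e\<in>row_pairs n j. \<Sum>e'\<in>row_pairs n j. (y e * y e' - (if e = e' then 1 else 0)) * c (?o e) (?o e'))"
        by (intro sum.cong refl) (simp only: o_inj)
      finally show ?thesis .
    qed
    have sq: "(\<Sum>l\<in>?L. \<Sum>m\<in>?L. (H l m (row_merge n j x y))\<^sup>2) = (\<Sum>e\<in>row_pairs n j. \<Sum>e'\<in>row_pairs n j. (c (?o e) (?o e'))\<^sup>2)" for y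
    proof -
      have "(\<Sum>l\<in>?L. \<Sum>m\<in>?L. (H l m (row_merge n j x y))\<^sup>2) = (\<Sum>l\<in>?L. \<Sum>m\<in>?L. (c l m)\<^sup>2)"
        by (intro sum.cong refl) (simp only: Hc)
      also have "\<dots> = (\<Sum>l\<in>?L. \<Sum>e'\<in>row_pairs n j. (c l (?o e'))\<^sup>2)"
        by (intro sum.cong refl) (rule sum_row[OF j, where g = "\<lambda>m e'. (c l m)\<^sup>2" for l])
      also have "\<dots> = (\<Sum>e\<in>row_pairs n j. \<Sum>e'\<in>row_pairs n j. (c (?o e) (?o e'))\<^sup>2)"
        by (rule sum_row[OF j, where g = "\<lambda>l e. \<Sum>e'\<in>row_pairs n j. (c l (?o e'))\<^sup>2"])
      finally show ?thesis .
    qed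
    show "(\<integral>\<^sup>+ y. ennreal ((\<Sum>l\<in>?L. \<Sum>m\<in>?L. (ent n j l (row_merge n j x y) * ent n j m (row_merge n j x y) - (if l = m then 1 else 0)) * H l m (row_merge n j x y))\<^sup>2) \<partial>gauss_PiM (row_pairs n j))
      \<le> (\<integral>\<^sup>+ y. ennreal (2 * (\<Sum>l\<in>?L. \<Sum>m\<in>?L. (H l m (row_merge n j x y))\<^sup>2)) \<partial>gauss_PiM (row_pairs n j))"
      unfolding quad sq
      using gauss_PiM_quadratic_second_moment[OF finite_row, of n j "\<lambda>e e'. c (?o e) (?o e')"]
      by (simp add: prob_space.emeasure_space_1[OF prob_space_gauss_PiM])
  qed measurable
qed

section \<open>Calculus of orders of magnitude in L^p\<close>

text \<open>Jensen for the uniform weights on \<open>L\<close>. If \<open>L\<close> has N < n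
  elements, the missing mass is harmless because \<open>(N / n) ^ q \<le> N / n\<close>.\<close>

lemma power_mean_le:
  fixes x :: "'i \<Rightarrow> real"
  assumes "finite L" "card L \<le> n" "q > 0" "\<And>l. l \<in> L \<Longrightarrow> x l \<ge> 0"
  shows "((\<Sum>l\<in>L. x l) / n) ^ q \<le> (\<Sum>l\<in>L. x l ^ q) / n"
proof (cases "L = {}")
  case True
  then show ?thesis using assms by (simp add: power_0_left)
next
  case False
  define N where "N = real (card L)"
  have N: "N > 0" "N \<le> n" using False assms by (auto simp: N_def card_gt_0_iff)
  have "(\<Sum>l\<in>L. (1 / N) *\<^sub>R x l) ^ q \<le> (\<Sum>l\<in>L. (1 / N) * x l ^ q)"
  proof (rule convex_on_sum[where C = "{0..}" and f = "\<lambda>x. x ^ q"])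
    show "convex_on {0..} (\<lambda>x::real. x ^ q)"
    proof (cases "even q")
      case True
      then show ?thesis by (rule convex_on_subset[OF convex_power_even]) (auto simp: convex_real_interval)
    qed (rule convex_power_odd)
    show "(\<Sum>l\<in>L. 1 / N) = 1" using N by (simp add: N_def)
  qed (use assms False N in auto)
  then have 1: "((\<Sum>l\<in>L. x l) / N) ^ q \<le> (\<Sum>l\<in>L. x l ^ q) / N"
    by (simp add: sum_divide_distrib)
  have "((\<Sum>l\<in>L. x l) / n) ^ q = (N / n) ^ q * ((\<Sum>l\<in>L. x l) / N) ^ q"
  proof -
    have "(\<Sum>l\<in>L. x l) / n = (N / n) * ((\<Sum>l\<in>L. x l) / N)" using N by simp
    then show ?thesis by (simp only: power_mult_distrib)
  qed
  also have "\<dots> \<le> (N / n) ^ q * ((\<Sum>l\<in>L. x l ^ q) / N)"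
    using 1 N by (intro mult_left_mono) auto
  also have "\<dots> \<le> (N / n) * ((\<Sum>l\<in>L. x l ^ q) / N)"
  proof (intro mult_right_mono)
    show "(N / n) ^ q \<le> N / n"
      using power_decreasing[of 1 q "N / n"] N assms(3) by simp
    show "0 \<le> (\<Sum>l\<in>L. x l ^ q) / N" 
      using N assms by (intro divide_nonneg_pos sum_nonneg) auto
  qed
  also have "\<dots> = (\<Sum>l\<in>L. x l ^ q) / n" using N by (simp add: field_simps)
  finally show ?thesis .
qed

text \<open>\<open>Ob n p m c X\<close> says that \<open>X\<close> is of size \<open>n powr (- m / 2)\<close> in \<open>L\<^sup>p\<close>.\<close>

definition Ob :: "nat \<Rightarrow> nat \<Rightarrow> nat \<Rightarrow> real \<Rightarrow> ((nat \<times> nat \<Rightarrow> real) \<Rightarrow> real) \<Rightarrow> bool" where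
  "Ob n p m c X \<longleftrightarrow> 0 \<le> c \<and> X \<in> borel_measurable (goe n) \<and>
     (\<integral>\<^sup>+ \<omega>. ennreal (\<bar>sqrt (real n) ^ m * X \<omega>\<bar> ^ p) \<partial>goe n) \<le> ennreal c"

lemma Ob_measurable: "Ob n p m c X \<Longrightarrow> X \<in> borel_measurable (goe n)"
  by (simp add: Ob_def)

lemma Ob_weaken: "Ob n p m c X \<Longrightarrow> c \<le> d \<Longrightarrow> Ob n p m d X"
  by (auto simp: Ob_def intro: order_trans ennreal_leI)

lemma Ob_dominated:
  assumes X: "Ob n p m c X" and [measurable]: "Z \<in> borel_measurable (goe n)"
    and le: "\<And>\<omega>. \<omega> \<in> space (goe n) \<Longrightarrow> \<bar>Z \<omega>\<bar> \<le> K * \<bar>X \<omega>\<bar>" and K: "K \<ge> 0"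
  shows "Ob n p m (K ^ p * c) Z"
proof -
  have [measurable]: "X \<in> borel_measurable (goe n)" using X by (rule Ob_measurable)
  have "(\<integral>\<^sup>+ \<omega>. ennreal (\<bar>sqrt (real n) ^ m * Z \<omega>\<bar> ^ p) \<partial>goe n)
      \<le> (\<integral>\<^sup>+ \<omega>. ennreal (K ^ p) * ennreal (\<bar>sqrt (real n) ^ m * X \<omega>\<bar> ^ p) \<partial>goe n)"
  proof (rule nn_integral_mono)
    fix \<omega> assume "\<omega> \<in> space (goe n)"
    then have "\<bar>sqrt (real n) ^ m * Z \<omega>\<bar> \<le> K * \<bar>sqrt (real n) ^ m * X \<omega>\<bar>"
      using mult_left_mono[OF le, of \<omega> "sqrt (real n) ^ m"] by (simp add: abs_mult mult_ac)
    then have "\<bar>sqrt (real n) ^ m * Z \<omega>\<bar> ^ p \<le> K ^ p * \<bar>sqrt (real n) ^ m * X \<omega>\<bar> ^ p"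
      by (subst power_mult_distrib[symmetric]) (rule power_mono, auto)
    then show "ennreal (\<bar>sqrt (real n) ^ m * Z \<omega>\<bar> ^ p)
        \<le> ennreal (K ^ p) * ennreal (\<bar>sqrt (real n) ^ m * X \<omega>\<bar> ^ p)"
      using K by (simp add: ennreal_mult[symmetric])
  qed
  also have "\<dots> = ennreal (K ^ p) * (\<integral>\<^sup>+ \<omega>. ennreal (\<bar>sqrt (real n) ^ m * X \<omega>\<bar> ^ p) \<partial>goe n)"
    by (rule nn_integral_cmult) measurable
  also have "\<dots> \<le> ennreal (K ^ p) * ennreal c"
    using X by (intro mult_left_mono) (auto simp: Ob_def)
  also have "\<dots> = ennreal (K ^ p * c)"
    using X K by (simp add: Ob_def ennreal_mult)
  finally show ?thesis using X K by (simp add: Ob_def)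
qed

lemma Ob_bounded:
  assumes [measurable]: "Z \<in> borel_measurable (goe n)"
    and "\<And>\<omega>. \<bar>Z \<omega>\<bar> \<le> K" "K \<ge> 0"
  shows "Ob n p 0 (K ^ p) Z"
proof -
  have "Ob n p 0 1 (\<lambda>_. 1)" by (simp add: Ob_def)
  from Ob_dominated[OF this, of Z K] show ?thesis using assms by simp
qed

lemma Ob_add:
  assumes X: "Ob n p m c X" and Y: "Ob n p m d Y"
  shows "Ob n p m (2 ^ p * (c + d)) (\<lambda>\<omega>. X \<omega> + Y \<omega>)"
proof -
  have [measurable]: "X \<in> borel_measurable (goe n)" "Y \<in> borel_measurable (goe n)"
    using X Y by (auto dest: Ob_measurable)
  let ?s = "sqrt (real n) ^ m"
  have pw: "\<bar>a + b\<bar> ^ p \<le> 2 ^ p * (\<bar>a\<bar> ^ p + \<bar>b\<bar> ^ p)" for a b :: real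
  proof -
    have "\<bar>a + b\<bar> ^ p \<le> (2 * max \<bar>a\<bar> \<bar>b\<bar>) ^ p" by (rule power_mono) auto
    also have "\<dots> \<le> 2 ^ p * (\<bar>a\<bar> ^ p + \<bar>b\<bar> ^ p)"
      by (simp add: power_mult_distrib max_def)
    finally show ?thesis .
  qed
  have "(\<integral>\<^sup>+ \<omega>. ennreal (\<bar>?s * (X \<omega> + Y \<omega>)\<bar> ^ p) \<partial>goe n)
      \<le> (\<integral>\<^sup>+ \<omega>. ennreal (2 ^ p) * (ennreal (\<bar>?s * X \<omega>\<bar> ^ p) + ennreal (\<bar>?s * Y \<omega>\<bar> ^ p)) \<partial>goe n)"
  proof (rule nn_integral_mono)
    fix \<omega>
    show "ennreal (\<bar>?s * (X \<omega> + Y \<omega>)\<bar> ^ p)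
      \<le> ennreal (2 ^ p) * (ennreal (\<bar>?s * X \<omega>\<bar> ^ p) + ennreal (\<bar>?s * Y \<omega>\<bar> ^ p))"
      using pw[of "?s * X \<omega>" "?s * Y \<omega>"]
      by (simp only: ennreal_plus[symmetric] ennreal_mult[symmetric] zero_le_power abs_ge_zero
          add_nonneg_nonneg zero_le_numeral ring_distribs[symmetric] ennreal_leI)
  qed
  also have "\<dots> = ennreal (2 ^ p) * ((\<integral>\<^sup>+ \<omega>. ennreal (\<bar>?s * X \<omega>\<bar> ^ p) \<partial>goe n)
      + (\<integral>\<^sup>+ \<omega>. ennreal (\<bar>?s * Y \<omega>\<bar> ^ p) \<partial>goe n))"
    by (subst nn_integral_cmult, measurable, subst nn_integral_add, measurable)
  also have "\<dots> \<le> ennreal (2 ^ p) * (ennreal c + ennreal d)"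
    using X Y by (intro mult_left_mono add_mono) (auto simp: Ob_def)
  also have "\<dots> = ennreal (2 ^ p * (c + d))"
    using X Y by (simp add: Ob_def ennreal_plus[symmetric] ennreal_mult del: ennreal_plus)
  finally show ?thesis using X Y by (simp add: Ob_def)
qed

lemma Ob_uminus: "Ob n p m c X \<Longrightarrow> Ob n p m c (\<lambda>\<omega>. - X \<omega>)"
  by (simp add: Ob_def)

lemma Ob_diff:
  assumes X: "Ob n p m c X" and Y: "Ob n p m d Y"
  shows "Ob n p m (2 ^ p * (c + d)) (\<lambda>\<omega>. X \<omega> - Y \<omega>)"
  using Ob_add[OF X Ob_uminus[OF Y]] by simp

text \<open>The inequality 2 a b \<le> a^2 + b^2 replaces Cauchy-Schwarz, so the constants add. The
  orders add as well, at the price of a doubled exponent.\<close>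

lemma Ob_mult:
  assumes X: "Ob n (2 * p) m c X" and Y: "Ob n (2 * p) m' d Y"
  shows "Ob n p (m + m') (c + d) (\<lambda>\<omega>. X \<omega> * Y \<omega>)"
proof -
  have [measurable]: "X \<in> borel_measurable (goe n)" "Y \<in> borel_measurable (goe n)"
    using X Y by (auto dest: Ob_measurable)
  let ?s = "sqrt (real n)"
  have am: "\<bar>a * b\<bar> ^ p \<le> \<bar>a\<bar> ^ (2 * p) + \<bar>b\<bar> ^ (2 * p)" for a b :: real
  proof -
    have "2 * \<bar>a\<bar> ^ p * \<bar>b\<bar> ^ p \<le> \<bar>a\<bar> ^ (2 * p) + \<bar>b\<bar> ^ (2 * p)"
      using sum_squares_bound[of "\<bar>a\<bar> ^ p" "\<bar>b\<bar> ^ p"]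
      by (simp only: power_mult[symmetric] mult.commute)
    moreover have "0 \<le> \<bar>a\<bar> ^ p * \<bar>b\<bar> ^ p" by simp
    moreover have "\<bar>a * b\<bar> ^ p = \<bar>a\<bar> ^ p * \<bar>b\<bar> ^ p" by (simp add: abs_mult power_mult_distrib)
    ultimately show ?thesis by linarith
  qed
  have "(\<integral>\<^sup>+ \<omega>. ennreal (\<bar>?s ^ (m + m') * (X \<omega> * Y \<omega>)\<bar> ^ p) \<partial>goe n)
      \<le> (\<integral>\<^sup>+ \<omega>. ennreal (\<bar>?s ^ m * X \<omega>\<bar> ^ (2 * p)) + ennreal (\<bar>?s ^ m' * Y \<omega>\<bar> ^ (2 * p)) \<partial>goe n)"
  proof (rule nn_integral_mono)
    fix \<omega>
    have "?s ^ (m + m') * (X \<omega> * Y \<omega>) = (?s ^ m * X \<omega>) * (?s ^ m' * Y \<omega>)"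
      by (simp add: power_add mult_ac)
    then show "ennreal (\<bar>?s ^ (m + m') * (X \<omega> * Y \<omega>)\<bar> ^ p)
      \<le> ennreal (\<bar>?s ^ m * X \<omega>\<bar> ^ (2 * p)) + ennreal (\<bar>?s ^ m' * Y \<omega>\<bar> ^ (2 * p))"
      using am[of "?s ^ m * X \<omega>" "?s ^ m' * Y \<omega>"]
      by (simp only: ennreal_plus[symmetric] zero_le_power abs_ge_zero ennreal_leI)
  qed
  also have "\<dots> = (\<integral>\<^sup>+ \<omega>. ennreal (\<bar>?s ^ m * X \<omega>\<bar> ^ (2 * p)) \<partial>goe n)
      + (\<integral>\<^sup>+ \<omega>. ennreal (\<bar>?s ^ m' * Y \<omega>\<bar> ^ (2 * p)) \<partial>goe n)"
    by (rule nn_integral_add; measurable)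
  also have "\<dots> \<le> ennreal c + ennreal d"
    using X Y by (intro add_mono) (auto simp: Ob_def)
  also have "\<dots> = ennreal (c + d)"
    using X Y by (simp add: Ob_def)
  finally show ?thesis using X Y by (simp add: Ob_def)
qed

lemma Ob_scale:
  assumes "Ob n p m c X" "n \<ge> 1"
  shows "Ob n p (Suc m) c (\<lambda>\<omega>. (1 / sqrt (real n)) * X \<omega>)"
proof -
  have [measurable]: "X \<in> borel_measurable (goe n)" using assms(1) by (rule Ob_measurable)
  have "sqrt (real n) ^ Suc m * ((1 / sqrt (real n)) * x) = sqrt (real n) ^ m * x" for x
    using assms(2) by simp
  moreover have "(\<lambda>\<omega>. (1 / sqrt (real n)) * X \<omega>) \<in> borel_measurable (goe n)" by measurable
  ultimately show ?thesis using assms(1) by (simp only: Ob_def simp_thms)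
qed

lemma Ob_unscale:
  assumes "Ob n p (Suc m) c X" "n \<ge> 1"
  shows "Ob n p m c (\<lambda>\<omega>. sqrt (real n) * X \<omega>)"
proof -
  have [measurable]: "X \<in> borel_measurable (goe n)" using assms(1) by (rule Ob_measurable)
  have "sqrt (real n) ^ m * (sqrt (real n) * x) = sqrt (real n) ^ Suc m * x" for x
    by simp
  moreover have "(\<lambda>\<omega>. sqrt (real n) * X \<omega>) \<in> borel_measurable (goe n)" by measurable
  ultimately show ?thesis using assms(1) by (simp only: Ob_def simp_thms)
qed

text \<open>By convexity alone, averaging loses nothing in order, whatever the dependence between
  the \<open>Y l\<close>.\<close>

lemma Ob_average:
  assumes L: "finite L" "card L \<le> n" and p: "p > 0" and c: "c \<ge> 0"
    and Y: "\<And>l. l \<in> L \<Longrightarrow> Ob n p m c (Y l)"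
  shows "Ob n p m c (\<lambda>\<omega>. (1 / real n) * (\<Sum>l\<in>L. Y l \<omega>))"
proof (cases "n = 0")
  case True
  then show ?thesis using p c by (simp add: Ob_def power_0_left)
next
  case False
  have [measurable]: "\<And>l. l \<in> L \<Longrightarrow> Y l \<in> borel_measurable (goe n)"
    using Y by (auto dest: Ob_measurable)
  let ?s = "sqrt (real n) ^ m"
  have "(\<integral>\<^sup>+ \<omega>. ennreal (\<bar>?s * ((1 / real n) * (\<Sum>l\<in>L. Y l \<omega>))\<bar> ^ p) \<partial>goe n)
      \<le> (\<integral>\<^sup>+ \<omega>. ennreal (1 / n) * (\<Sum>l\<in>L. ennreal (\<bar>?s * Y l \<omega>\<bar> ^ p)) \<partial>goe n)"
  proof (rule nn_integral_mono)
    fix \<omega>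
    have "\<bar>?s * ((1 / real n) * (\<Sum>l\<in>L. Y l \<omega>))\<bar> = \<bar>\<Sum>l\<in>L. ?s * Y l \<omega>\<bar> / n"
      by (simp add: sum_distrib_left[symmetric] abs_mult)
    also have "\<dots> \<le> (\<Sum>l\<in>L. \<bar>?s * Y l \<omega>\<bar>) / n"
      by (intro divide_right_mono sum_abs) auto
    finally have "\<bar>?s * ((1 / real n) * (\<Sum>l\<in>L. Y l \<omega>))\<bar> ^ p \<le> ((\<Sum>l\<in>L. \<bar>?s * Y l \<omega>\<bar>) / n) ^ p"
      by (intro power_mono) auto
    also have "\<dots> \<le> (\<Sum>l\<in>L. \<bar>?s * Y l \<omega>\<bar> ^ p) / n"
      by (rule power_mean_le) (use L p in auto)
    finally show "ennreal (\<bar>?s * ((1 / real n) * (\<Sum>l\<in>L. Y l \<omega>))\<bar> ^ p)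
        \<le> ennreal (1 / n) * (\<Sum>l\<in>L. ennreal (\<bar>?s * Y l \<omega>\<bar> ^ p))"
      by (subst sum_ennreal) (auto simp: ennreal_mult[symmetric] sum_nonneg ennreal_leI)
  qed
  also have "\<dots> = ennreal (1 / n) * (\<Sum>l\<in>L. \<integral>\<^sup>+ \<omega>. ennreal (\<bar>?s * Y l \<omega>\<bar> ^ p) \<partial>goe n)"
    by (subst nn_integral_cmult, measurable, subst nn_integral_sum) auto
  also have "\<dots> \<le> ennreal (1 / n) * (\<Sum>l\<in>L. ennreal c)"
    using Y by (intro mult_left_mono sum_mono) (auto simp: Ob_def)
  also have "\<dots> = ennreal ((card L / n) * c)"
    using c by (simp add: ennreal_mult[symmetric] ennreal_of_nat_eq_real_of_nat)
  also have "\<dots> \<le> ennreal (1 * c)"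
    using L False c by (intro ennreal_leI mult_right_mono) (auto simp: field_simps)
  finally show ?thesis using c by (simp add: Ob_def)
qed

text \<open>Square-root cancellation: given the entries outside row \<open>j\<close>, the variance
  is \<open>1 / n\<close> times the sum of the squares of the \<open>Y l\<close>, so up to n terms
  with prefactor \<open>1 / sqrt n\<close> keep the order of their coefficients.\<close>

lemma Ob_gauss:
  assumes n: "n \<ge> 1" and j: "j \<in> {1..n}" and L: "L \<subseteq> {1..n} - {j}" and p: "even p" "p > 0" and c: "c \<ge> 0"
    and Y: "\<And>l. l \<in> L \<Longrightarrow> Ob n p m c (Y l)"
    and Yf: "\<And>l. l \<in> L \<Longrightarrow> row_free j (Y l)"
  shows "Ob n p m (4 * fact p * c) (\<lambda>\<omega>. (1 / sqrt (real n)) * (\<Sum>l\<in>L. ent n j l \<omega> * Y l \<omega>))"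
proof -
  have Ym[measurable]: "\<And>l. l \<in> L \<Longrightarrow> Y l \<in> borel_measurable (goe n)"
    using Y by (auto dest: Ob_measurable)
  have fL: "finite L" using L by (rule finite_subset) simp
  have cL: "card L \<le> n" using card_mono[of "{1..n}" L] L by auto
  let ?s = "sqrt (real n) ^ m"
  let ?r = "1 / sqrt (real n)"
  have "(\<integral>\<^sup>+ \<omega>. ennreal (\<bar>?s * (?r * (\<Sum>l\<in>L. ent n j l \<omega> * Y l \<omega>))\<bar> ^ p) \<partial>goe n)
      = (\<integral>\<^sup>+ \<omega>. ennreal (\<bar>\<Sum>l\<in>L. ent n j l \<omega> * (?s * ?r * Y l \<omega>)\<bar> ^ p) \<partial>goe n)"
    by (simp add: sum_distrib_left mult_ac)
  also have "\<dots> \<le> (\<integral>\<^sup>+ \<omega>. ennreal (4 * fact p * (\<Sum>l\<in>L. (?s * ?r * Y l \<omega>)\<^sup>2) ^ (p div 2)) \<partial>goe n)"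
    by (intro goe_linear_moment j L p row_free_comp[OF Yf]) measurable
  also have "\<dots> \<le> (\<integral>\<^sup>+ \<omega>. ennreal (4 * fact p / n) * (\<Sum>l\<in>L. ennreal (\<bar>?s * Y l \<omega>\<bar> ^ p)) \<partial>goe n)"
  proof (rule nn_integral_mono)
    fix \<omega>
    have "(\<Sum>l\<in>L. (?s * ?r * Y l \<omega>)\<^sup>2) = (\<Sum>l\<in>L. (?s * Y l \<omega>)\<^sup>2) / n"
      by (simp add: sum_divide_distrib power_mult_distrib power_divide)
    then have "(\<Sum>l\<in>L. (?s * ?r * Y l \<omega>)\<^sup>2) ^ (p div 2) \<le> (\<Sum>l\<in>L. ((?s * Y l \<omega>)\<^sup>2) ^ (p div 2)) / n"
      using power_mean_le[OF fL cL, of "p div 2" "\<lambda>l. (?s * Y l \<omega>)\<^sup>2"] p by auto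
    also have "(\<Sum>l\<in>L. ((?s * Y l \<omega>)\<^sup>2) ^ (p div 2)) = (\<Sum>l\<in>L. \<bar>?s * Y l \<omega>\<bar> ^ p)"
      using p by (intro sum.cong refl) (simp add: power_mult[symmetric] power_even_abs)
    finally have "4 * fact p * (\<Sum>l\<in>L. (?s * ?r * Y l \<omega>)\<^sup>2) ^ (p div 2)
        \<le> (4 * fact p / n) * (\<Sum>l\<in>L. \<bar>?s * Y l \<omega>\<bar> ^ p)"
      unfolding times_divide_eq_left
      by (subst times_divide_eq_right[symmetric], intro mult_left_mono) auto
    then show "ennreal (4 * fact p * (\<Sum>l\<in>L. (?s * ?r * Y l \<omega>)\<^sup>2) ^ (p div 2))
        \<le> ennreal (4 * fact p / n) * (\<Sum>l\<in>L. ennreal (\<bar>?s * Y l \<omega>\<bar> ^ p))"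
      by (subst sum_ennreal) (auto simp: ennreal_mult[symmetric] sum_nonneg intro!: ennreal_leI)
  qed
  also have "\<dots> = ennreal (4 * fact p / n) * (\<Sum>l\<in>L. \<integral>\<^sup>+ \<omega>. ennreal (\<bar>?s * Y l \<omega>\<bar> ^ p) \<partial>goe n)"
    by (subst nn_integral_cmult, measurable, subst nn_integral_sum) auto
  also have "\<dots> \<le> ennreal (4 * fact p / n) * (\<Sum>l\<in>L. ennreal c)"
    using Y by (intro mult_left_mono sum_mono) (auto simp: Ob_def)
  also have "\<dots> = ennreal ((card L / n) * (4 * fact p * c))"
    using c by (simp add: ennreal_mult[symmetric] ennreal_of_nat_eq_real_of_nat mult_ac)
  also have "\<dots> \<le> ennreal (1 * (4 * fact p * c))"
    using cL n c by (intro ennreal_leI mult_right_mono) (auto simp: field_simps)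
  finally show ?thesis using c by (simp add: Ob_def)
qed

lemma Ob_ent:
  assumes "n \<ge> 1" "even p" "p > 0"
  shows "Ob n p 0 (4 * fact p) (ent n i j)"
proof (cases "i \<in> {1..n} \<and> j \<in> {1..n} \<and> i \<noteq> j")
  case True
  have "Ob n p 0 1 (\<lambda>_. 1)" by (simp add: Ob_def)
  have "(\<integral>\<^sup>+ \<omega>. ennreal (\<bar>\<Sum>l\<in>{j}. ent n i l \<omega> * 1\<bar> ^ p) \<partial>goe n)
    \<le> (\<integral>\<^sup>+ \<omega>. ennreal (4 * fact p * (\<Sum>l\<in>{j}. 1\<^sup>2) ^ (p div 2)) \<partial>goe n)"
    by (intro goe_linear_moment row_free_const) (use True assms in auto)
  then show ?thesis by (simp add: Ob_def)
next
  case False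
  then have "ent n i j = (\<lambda>_. 0)" by (auto simp: ent_def)
  then show ?thesis using assms by (simp add: Ob_def power_0_left)
qed

text \<open>Given the entries outside row \<open>i\<close>, the double sum has second moment at most
  twice the sum of its squared coefficients. This has mean of order n, since each of the fewer than
  n rows of \<open>h\<close> has bounded mean square mass, and the prefactor \<open>1 / n\<close>
  leaves order \<open>1 / sqrt n\<close>. The row masses enter linearly, so their first moments
  suffice.\<close>

lemma Ob_quadratic:
  assumes n: "n \<ge> 1" and i: "i \<in> {1..n}"
    and cm: "\<And>j. c j \<in> borel_measurable (goe n)"
    and hm: "\<And>j l. h j l \<in> borel_measurable (goe n)"
    and cb: "\<And>j \<omega>. \<bar>c j \<omega>\<bar> \<le> b"
    and cf: "\<And>j. j \<in> {1..n} - {i} \<Longrightarrow> row_free i (c j)"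
    and hf: "\<And>j l. j \<in> {1..n} - {i} \<Longrightarrow> l \<in> {1..n} - {i} \<Longrightarrow> row_free i (h j l)"
    and C: "C \<ge> 0"
    and hC: "\<And>j. j \<in> {1..n} - {i} \<Longrightarrow> (\<integral>\<^sup>+ \<omega>. ennreal (\<Sum>l\<in>{1..n}. (h j l \<omega>)\<^sup>2) \<partial>goe n) \<le> ennreal C"
  shows "Ob n 2 1 (2 * b\<^sup>2 * C) (\<lambda>\<omega>. (1 / real n) * (\<Sum>j\<in>{1..n} - {i}. \<Sum>l\<in>{1..n} - {i}.
      (ent n i j \<omega> * ent n i l \<omega> - (if j = l then 1 else 0)) * (c j \<omega> * h j l \<omega>)))"
proof -
  note [measurable] = cm hm
  let ?L = "{1..n} - {i}"
  let ?Z = "\<lambda>\<omega>. \<Sum>j\<in>?L. \<Sum>l\<in>?L.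
    (ent n i j \<omega> * ent n i l \<omega> - (if j = l then 1 else 0)) * (c j \<omega> * h j l \<omega>)"
  have "(\<integral>\<^sup>+ \<omega>. ennreal ((?Z \<omega>)\<^sup>2) \<partial>goe n)
    \<le> (\<integral>\<^sup>+ \<omega>. ennreal (2 * (\<Sum>j\<in>?L. \<Sum>l\<in>?L. (c j \<omega> * h j l \<omega>)\<^sup>2)) \<partial>goe n)"
    by (rule goe_quadratic_moment[OF i]) (measurable, intro row_free_comp2[where g = "(*)"] cf hf)
  also have "\<dots> \<le> (\<integral>\<^sup>+ \<omega>. ennreal (2 * b\<^sup>2) * (\<Sum>j\<in>?L. ennreal (\<Sum>l\<in>{1..n}. (h j l \<omega>)\<^sup>2)) \<partial>goe n)"
  proof (rule nn_integral_mono)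
    fix \<omega>
    have "(\<Sum>j\<in>?L. \<Sum>l\<in>?L. (c j \<omega> * h j l \<omega>)\<^sup>2) \<le> (\<Sum>j\<in>?L. \<Sum>l\<in>?L. b\<^sup>2 * (h j l \<omega>)\<^sup>2)"
    proof (intro sum_mono)
      fix j l
      have "(c j \<omega>)\<^sup>2 \<le> b\<^sup>2" using power_mono[OF cb, of j \<omega> 2] by simp
      then show "(c j \<omega> * h j l \<omega>)\<^sup>2 \<le> b\<^sup>2 * (h j l \<omega>)\<^sup>2"
        by (simp add: power_mult_distrib mult_right_mono)
    qed
    also have "\<dots> \<le> (\<Sum>j\<in>?L. \<Sum>l\<in>{1..n}. b\<^sup>2 * (h j l \<omega>)\<^sup>2)"
      by (intro sum_mono sum_mono2) auto
    also have "\<dots> = b\<^sup>2 * (\<Sum>j\<in>?L. \<Sum>l\<in>{1..n}. (h j l \<omega>)\<^sup>2)"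
      by (simp only: sum_distrib_left)
    finally have "2 * (\<Sum>j\<in>?L. \<Sum>l\<in>?L. (c j \<omega> * h j l \<omega>)\<^sup>2)
        \<le> 2 * b\<^sup>2 * (\<Sum>j\<in>?L. \<Sum>l\<in>{1..n}. (h j l \<omega>)\<^sup>2)"
      by linarith
    then have "ennreal (2 * (\<Sum>j\<in>?L. \<Sum>l\<in>?L. (c j \<omega> * h j l \<omega>)\<^sup>2))
      \<le> ennreal (2 * b\<^sup>2 * (\<Sum>j\<in>?L. \<Sum>l\<in>{1..n}. (h j l \<omega>)\<^sup>2))"
      by (rule ennreal_leI)
    also have "\<dots> = ennreal (2 * b\<^sup>2) * ennreal (\<Sum>j\<in>?L. \<Sum>l\<in>{1..n}. (h j l \<omega>)\<^sup>2)"
      by (rule ennreal_mult) (simp, intro sum_nonneg, simp)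
    also have "ennreal (\<Sum>j\<in>?L. \<Sum>l\<in>{1..n}. (h j l \<omega>)\<^sup>2) = (\<Sum>j\<in>?L. ennreal (\<Sum>l\<in>{1..n}. (h j l \<omega>)\<^sup>2))"
      by (rule sum_ennreal[symmetric]) (intro sum_nonneg, simp)
    finally show "ennreal (2 * (\<Sum>j\<in>?L. \<Sum>l\<in>?L. (c j \<omega> * h j l \<omega>)\<^sup>2))
      \<le> ennreal (2 * b\<^sup>2) * (\<Sum>j\<in>?L. ennreal (\<Sum>l\<in>{1..n}. (h j l \<omega>)\<^sup>2))" .
  qed
  also have "\<dots> = ennreal (2 * b\<^sup>2) * (\<Sum>j\<in>?L. \<integral>\<^sup>+ \<omega>. ennreal (\<Sum>l\<in>{1..n}. (h j l \<omega>)\<^sup>2) \<partial>goe n)"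
    by (subst nn_integral_cmult, measurable, subst nn_integral_sum, measurable)
  also have "\<dots> \<le> ennreal (2 * b\<^sup>2) * (\<Sum>j\<in>?L. ennreal C)"
    by (intro mult_left_mono sum_mono hC) auto
  also have "(\<Sum>j\<in>?L. ennreal C) = ennreal (\<Sum>j\<in>?L. C)"
    by (rule sum_ennreal) (rule C)
  also have "\<dots> = ennreal (real (card ?L) * C)"
    by (simp only: sum_constant)
  also have "ennreal (2 * b\<^sup>2) * \<dots> = ennreal (2 * b\<^sup>2 * (real (card ?L) * C))"
    by (rule ennreal_mult[symmetric]) (use C in auto)
  finally have Z: "(\<integral>\<^sup>+ \<omega>. ennreal ((?Z \<omega>)\<^sup>2) \<partial>goe n) \<le> ennreal (2 * b\<^sup>2 * (real (card ?L) * C))" .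
  have "(\<integral>\<^sup>+ \<omega>. ennreal (\<bar>sqrt (real n) ^ 1 * ((1 / real n) * ?Z \<omega>)\<bar>\<^sup>2) \<partial>goe n)
    = (\<integral>\<^sup>+ \<omega>. ennreal (1 / n) * ennreal ((?Z \<omega>)\<^sup>2) \<partial>goe n)"
  proof (rule nn_integral_cong)
    have "\<bar>sqrt (real n) ^ 1 * ((1 / real n) * z)\<bar>\<^sup>2 = (1 / n) * z\<^sup>2" for z
    proof -
      have "\<bar>sqrt (real n) ^ 1 * ((1 / real n) * z)\<bar>\<^sup>2 = real n * ((1 / real n)\<^sup>2 * z\<^sup>2)"
        by (simp add: power_mult_distrib power_divide)
      then show ?thesis using n by (simp add: power2_eq_square)
    qed
    then show "ennreal (\<bar>sqrt (real n) ^ 1 * ((1 / real n) * ?Z \<omega>)\<bar>\<^sup>2) = ennreal (1 / n) * ennreal ((?Z \<omega>)\<^sup>2)" for \<omega>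
      by (simp only: ennreal_mult[symmetric] zero_le_power2 zero_le_divide_1_iff of_nat_0_le_iff)
  qed
  also have "\<dots> = ennreal (1 / n) * (\<integral>\<^sup>+ \<omega>. ennreal ((?Z \<omega>)\<^sup>2) \<partial>goe n)"
    by (rule nn_integral_cmult) measurable
  also have "\<dots> \<le> ennreal (1 / n) * ennreal (2 * b\<^sup>2 * (real (card ?L) * C))"
    by (rule mult_left_mono[OF Z]) simp
  also have "\<dots> = ennreal (1 / n * (2 * b\<^sup>2 * (real (card ?L) * C)))"
    by (rule ennreal_mult[symmetric]) (use C in auto)
  also have "\<dots> \<le> ennreal (2 * b\<^sup>2 * C)"
  proof (rule ennreal_leI)
    have "real (card ?L) \<le> real n" using card_mono[of "{1..n}" ?L] by auto
    then have "real (card ?L) / n \<le> 1" using n by simp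
    then have "real (card ?L) / n * (2 * b\<^sup>2 * C) \<le> 1 * (2 * b\<^sup>2 * C)"
      using C by (intro mult_right_mono) auto
    then show "1 / n * (2 * b\<^sup>2 * (real (card ?L) * C)) \<le> 2 * b\<^sup>2 * C" by (simp add: mult_ac)
  qed
  finally show ?thesis
    using C unfolding Ob_def by (intro conjI) (simp, measurable)
qed

lemma Ob_sum:
  assumes "\<And>r. r < K \<Longrightarrow> Ob n p m c (X r)" "c \<ge> 0" "p > 0"
  shows "Ob n p m ((2 ^ Suc p) ^ K * c) (\<lambda>\<omega>. \<Sum>r<K. X r \<omega>)"
  using assms(1)
proof (induction K)
  case 0
  show ?case
    using assms(2,3) by (simp add: Ob_def power_0_left)
next
  case (Suc K)
  have "Ob n p m (2 ^ p * ((2 ^ Suc p) ^ K * c + c)) (\<lambda>\<omega>. (\<Sum>r<K. X r \<omega>) + X K \<omega>)"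
    using Suc by (intro Ob_add) auto
  then have "Ob n p m (2 ^ p * ((2 ^ Suc p) ^ K * c + c)) (\<lambda>\<omega>. \<Sum>r<Suc K. X r \<omega>)" by simp
  then show ?case
  proof (rule Ob_weaken)
    have "1 * c \<le> (2 ^ Suc p) ^ K * c" using assms(2) by (intro mult_right_mono one_le_power) auto
    then have "2 ^ p * ((2 ^ Suc p) ^ K * c + c) \<le> 2 ^ p * (2 * ((2 ^ Suc p) ^ K * c))"
      by (intro mult_left_mono) (linarith, simp)
    then show "2 ^ p * ((2 ^ Suc p) ^ K * c + c) \<le> (2 ^ Suc p) ^ Suc K * c" by (simp add: mult_ac)
  qed
qed

text \<open>By monotonicity the sum of finitely many constants serves for all of them.\<close>

lemma uniform_constant:
  assumes "\<And>r. r < K \<Longrightarrow> \<exists>C\<ge>0. P r C"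
    and mono: "\<And>r C D. r < K \<Longrightarrow> P r C \<Longrightarrow> C \<le> D \<Longrightarrow> P r D"
  shows "\<exists>C\<ge>(0::real). \<forall>r<K::nat. P r C"
proof -
  from assms(1) obtain C where C: "\<And>r. r < K \<Longrightarrow> C r \<ge> 0 \<and> P r (C r)" by metis
  have "P r (\<Sum>r<K. C r)" if "r < K" for r
  proof (rule mono[OF that])
    show "P r (C r)" using C[OF that] by simp
    show "C r \<le> (\<Sum>r<K. C r)" using C that by (intro member_le_sum) auto
  qed
  moreover have "(\<Sum>r<K. C r) \<ge> 0" using C by (intro sum_nonneg) auto
  ultimately show ?thesis by blast
qed

subsection \<open>First-order expansion of the cavity iteration\<close>

locale smooth_nonlinearities =
  fixes f :: "nat \<Rightarrow> real \<Rightarrow> real" and B :: "nat \<Rightarrow> real"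
  assumes B_ge_1: "B k \<ge> 1"
    and f_measurable [measurable]: "f k \<in> borel_measurable borel"
    and df_measurable [measurable]: "deriv (f k) \<in> borel_measurable borel"
    and f_bounded: "\<bar>f k x\<bar> \<le> B k"
    and df_bounded: "\<bar>deriv (f k) x\<bar> \<le> B k"
    and f_lipschitz: "\<bar>f k x - f k y\<bar> \<le> B k * \<bar>x - y\<bar>"
    and df_lipschitz: "\<bar>deriv (f k) x - deriv (f k) y\<bar> \<le> B k * \<bar>x - y\<bar>"
    and f_taylor: "\<bar>f k x - f k y - deriv (f k) y * (x - y)\<bar> \<le> B k * (x - y)\<^sup>2"
begin

lemma B_nonneg: "B k \<ge> 0"
  using B_ge_1[of k] by linarith

text \<open>Here \<open>u\<close> is a fixed parameter and only the matrix is random.\<close>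

definition cav :: "nat \<Rightarrow> (nat \<Rightarrow> real) \<Rightarrow> nat \<Rightarrow> nat set \<Rightarrow> nat \<Rightarrow> (nat \<times> nat \<Rightarrow> real) \<Rightarrow> real" where
  "cav n u k S j \<omega> = cavity n (\<lambda>i j. ent n i j \<omega>) f u k S j"

lemma cav_0 [simp]: "cav n u 0 S j \<omega> = u j"
  by (simp add: cav_def)

lemma cav_Suc: "cav n u (Suc k) S j \<omega> = (1 / sqrt (real n)) *
    (\<Sum>m\<in>{1..n} - insert j S. ent n j m \<omega> * f k (cav n u k (insert j S) m \<omega>))"
  by (simp add: cav_def)

lemma cavity_measurable:
  assumes [measurable]: "\<And>i j. a i j \<in> borel_measurable M" "\<And>i. u i \<in> borel_measurable M"
  shows "(\<lambda>\<omega>. cavity n (\<lambda>i j. a i j \<omega>) f (\<lambda>i. u i \<omega>) k S i) \<in> borel_measurable M"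
proof (induction k arbitrary: S i)
  case (Suc k)
  note [measurable] = Suc
  show ?case unfolding cavity.simps by measurable
qed simp

lemma amp_measurable:
  assumes [measurable]: "\<And>i j. a i j \<in> borel_measurable M" "\<And>i. u i \<in> borel_measurable M"
  shows "(\<lambda>\<omega>. amp n (\<lambda>i j. a i j \<omega>) f (\<lambda>i. u i \<omega>) k i) \<in> borel_measurable M"
proof (induction k arbitrary: i rule: less_induct)
  case (less k)
  consider "k = 0" | "k = Suc 0" | s where "k = Suc (Suc s)" by (metis not0_implies_Suc)
  then show ?case
  proof cases
    case (3 s)
    have [measurable]: "(\<lambda>\<omega>. amp n (\<lambda>i j. a i j \<omega>) f (\<lambda>i. u i \<omega>) (Suc s) i) \<in> borel_measurable M"
      "(\<lambda>\<omega>. amp n (\<lambda>i j. a i j \<omega>) f (\<lambda>i. u i \<omega>) s i) \<in> borel_measurable M" for i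
      using less[of "Suc s"] less[of s] 3 by auto
    show ?thesis unfolding 3 amp.simps by measurable
  qed (simp_all, measurable)
qed

lemma cav_measurable [measurable]: "cav n u k S j \<in> borel_measurable (goe n)"
  unfolding cav_def[abs_def] by (rule cavity_measurable) measurable

text \<open>Started outside \<open>S\<close>, the recursion only visits entries with both indices
  outside \<open>S\<close>, because the removed set can only grow.\<close>

lemma cav_row_free: "i \<in> S \<Longrightarrow> j \<notin> S \<Longrightarrow> row_free i (cav n u k S j)"
proof (induction k arbitrary: S j)
  case 0
  then show ?case by (simp add: cav_def[abs_def] row_free_const)
next
  case (Suc k)
  have "row_free i (\<lambda>\<omega>. (1 / sqrt (real n)) *
      (\<Sum>m\<in>{1..n} - insert j S. ent n j m \<omega> * f k (cav n u k (insert j S) m \<omega>)))"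
  proof (intro row_free_comp[where g = "\<lambda>x. (1 / sqrt (real n)) * x"] row_free_sum
      row_free_comp2[where g = "(*)"] row_free_comp[where g = "f k"])
    fix m assume m: "m \<in> {1..n} - insert j S"
    show "row_free i (ent n j m)" using Suc.prems m by (intro row_free_ent) auto
    show "row_free i (cav n u k (insert j S) m)" using Suc.prems m by (intro Suc.IH) auto
  qed
  then show ?case by (simp only: cav_Suc[abs_def])
qed

section \<open>Effect of removing one index\<close>

text \<open>The cardinality of \<open>S\<close> is left free: when the indices run out the sums are
  empty and the estimates still hold, so inductions that enlarge \<open>S\<close> require no
  counting.\<close>

definition adm :: "nat \<Rightarrow> nat set \<Rightarrow> nat \<Rightarrow> nat \<Rightarrow> bool" where
  "adm n S i j \<longleftrightarrow> i \<in> {1..n} \<and> j \<in> {1..n} \<and> i \<noteq> j \<and> i \<notin> S \<and> j \<notin> S"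

definition cavd :: "nat \<Rightarrow> (nat \<Rightarrow> real) \<Rightarrow> nat \<Rightarrow> nat set \<Rightarrow> nat \<Rightarrow> nat \<Rightarrow> (nat \<times> nat \<Rightarrow> real) \<Rightarrow> real" where
  "cavd n u k S i j \<omega> = cav n u k S j \<omega> - cav n u k (insert i S) j \<omega>"

lemma cavd_measurable [measurable]: "cavd n u k S i j \<in> borel_measurable (goe n)"
  unfolding cavd_def[abs_def] by measurable

lemma cavd_0: "cavd n u 0 S i j = (\<lambda>_. 0)"
  by (simp add: cavd_def fun_eq_iff)

text \<open>The sums for \<open>S\<close> and for \<open>insert i S\<close> differ by the summand
  \<open>m = i\<close>, the direct edge from \<open>j\<close> to \<open>i\<close>, and by the
  removal of \<open>i\<close> inside the arguments of \<open>f k\<close>.\<close>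

lemma cavd_Suc:
  assumes "adm n S i j"
  shows "cavd n u (Suc k) S i j \<omega> =
    (1 / sqrt (real n)) * (ent n j i \<omega> * f k (cav n u k (insert j S) i \<omega>)) +
    (1 / sqrt (real n)) * (\<Sum>m\<in>{1..n} - insert i (insert j S). ent n j m \<omega> *
      (f k (cav n u k (insert j S) m \<omega>) - f k (cav n u k (insert i (insert j S)) m \<omega>)))"
proof -
  have eq: "{1..n} - insert j S = insert i ({1..n} - insert i (insert j S))"
    using assms by (auto simp: adm_def)
  have "cav n u (Suc k) S j \<omega> = (1 / sqrt (real n)) * (ent n j i \<omega> * f k (cav n u k (insert j S) i \<omega>)) +
    (1 / sqrt (real n)) * (\<Sum>m\<in>{1..n} - insert i (insert j S). ent n j m \<omega> *
      f k (cav n u k (insert j S) m \<omega>))"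
    unfolding cav_Suc eq by (subst sum.insert) (auto simp: algebra_simps)
  then show ?thesis
    unfolding cavd_def by (simp add: cav_Suc[of n u k "insert i S"] insert_commute right_diff_distrib sum_subtractf)
qed

text \<open>In \<open>cavd_Suc\<close> the direct edge is a single entry times a bounded factor and
  \<open>1 / sqrt n\<close>. The rest is a Gaussian sum in row \<open>j\<close> whose coefficients,
  taken with \<open>j\<close> removed, are of order \<open>1 / sqrt n\<close> by induction and the
  Lipschitz bound.\<close>

lemma cavd_bound:
  assumes p: "even p" "p > 0"
  shows "\<exists>C\<ge>0. \<forall>n\<ge>1. \<forall>u S i j. adm n S i j \<longrightarrow> Ob n p 1 C (cavd n u k S i j)"
proof (induction k)
  case 0
  show ?case using p by (intro exI[of _ 0]) (simp add: cavd_0 Ob_def power_0_left)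
next
  case (Suc k)
  then obtain C where C: "C \<ge> 0"
    "\<And>n u S i j. n \<ge> 1 \<Longrightarrow> adm n S i j \<Longrightarrow> Ob n p 1 C (cavd n u k S i j)" by blast
  define c where "c = 2 ^ p * (B k ^ p * (4 * fact p) + 4 * fact p * (B k ^ p * C))"
  have "Ob n p 1 c (cavd n u (Suc k) S i j)" if n: "n \<ge> 1" and adm: "adm n S i j" for n u S i j
  proof -
    have "Ob n p 0 (B k ^ p * (4 * fact p)) (\<lambda>\<omega>. ent n j i \<omega> * f k (cav n u k (insert j S) i \<omega>))"
      by (rule Ob_dominated[OF Ob_ent[OF n p, of j i]])
        (auto simp: abs_mult mult.commute[of "B k"] B_nonneg f_bounded intro!: mult_left_mono)
    from Ob_scale[OF this n]
    have 1: "Ob n p 1 (B k ^ p * (4 * fact p))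
      (\<lambda>\<omega>. (1 / sqrt (real n)) * (ent n j i \<omega> * f k (cav n u k (insert j S) i \<omega>)))" by simp
    have 2: "Ob n p 1 (4 * fact p * (B k ^ p * C)) (\<lambda>\<omega>. (1 / sqrt (real n)) *
        (\<Sum>m\<in>{1..n} - insert i (insert j S). ent n j m \<omega> *
      (f k (cav n u k (insert j S) m \<omega>) - f k (cav n u k (insert i (insert j S)) m \<omega>))))"
    proof (rule Ob_gauss[OF n _ _ p])
      fix m assume m: "m \<in> {1..n} - insert i (insert j S)"
      then have "adm n (insert j S) i m" using adm by (auto simp: adm_def)
      from C(2)[OF n this, of u]
      show "Ob n p 1 (B k ^ p * C) (\<lambda>\<omega>. f k (cav n u k (insert j S) m \<omega>) - f k (cav n u k (insert i (insert j S)) m \<omega>))"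
        by (rule Ob_dominated) (auto simp: cavd_def B_nonneg f_lipschitz)
      show "row_free j (\<lambda>\<omega>. f k (cav n u k (insert j S) m \<omega>) - f k (cav n u k (insert i (insert j S)) m \<omega>))"
        using m by (intro row_free_comp2[where g = "\<lambda>x y. f k x - f k y"] cav_row_free) auto
    qed (use adm C(1) B_nonneg in \<open>auto simp: adm_def\<close>)
    show ?thesis
      using Ob_add[OF 1 2] by (simp add: cavd_Suc[OF adm, abs_def] c_def)
  qed
  moreover have "c \<ge> 0" using C B_nonneg[of k] by (simp add: c_def)
  ultimately show ?case by blast
qed

text \<open>
  \<open>H n u i r k S j l\<close> is the coefficient of \<open>a\<^bsub>il\<^esub>\<close> in the contribution of the paths of length
  \<open>r + 1\<close> from \<open>j\<close> to \<open>i\<close> to the first-order expansion of \<open>cavd n u k S i j\<close>.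
\<close>

fun H :: "nat \<Rightarrow> (nat \<Rightarrow> real) \<Rightarrow> nat \<Rightarrow> nat \<Rightarrow> nat \<Rightarrow> nat set \<Rightarrow> nat \<Rightarrow> nat \<Rightarrow> (nat \<times> nat \<Rightarrow> real) \<Rightarrow> real" where
  "H n u i 0 k S j l \<omega> = (if j = l then 1 else 0)"
| "H n u i (Suc r) 0 S j l \<omega> = 0"
| "H n u i (Suc r) (Suc k) S j l \<omega> = (1 / sqrt (real n)) *
     (\<Sum>m\<in>{1..n} - insert i (insert j S). ent n j m \<omega> *
       (deriv (f k) (cav n u k (insert i (insert j S)) m \<omega>) * H n u i r k (insert j S) m l \<omega>))"

text \<open>The weighted sum of all paths with \<open>r + 1\<close> edges from \<open>j\<close> to
  \<open>i\<close>, written as a linear form in the last edge.\<close>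

definition Q :: "nat \<Rightarrow> (nat \<Rightarrow> real) \<Rightarrow> nat \<Rightarrow> nat \<Rightarrow> nat \<Rightarrow> nat set \<Rightarrow> nat \<Rightarrow> (nat \<times> nat \<Rightarrow> real) \<Rightarrow> real" where
  "Q n u i r k S j \<omega> = (\<Sum>l\<in>{1..n}. H n u i r k S j l \<omega> * ent n i l \<omega>)"

lemma H_measurable [measurable]: "H n u i r k S j l \<in> borel_measurable (goe n)"
proof (induction r arbitrary: k S j)
  case 0
  then show ?case by simp
next
  case (Suc r)
  note [measurable] = Suc
  show ?case
  proof (cases k)
    case 0
    then show ?thesis by simp
  next
    case (Suc k')
    have "(\<lambda>\<omega>. H n u i (Suc r) (Suc k') S j l \<omega>) \<in> borel_measurable (goe n)"
      unfolding H.simps by measurable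
    then show ?thesis using Suc by simp
  qed
qed

lemma Q_measurable [measurable]: "Q n u i r k S j \<in> borel_measurable (goe n)"
  unfolding Q_def[abs_def] by measurable

text \<open>The case \<open>q = i\<close> is the important one: all cavity values along the path
  have \<open>i\<close> removed, so row \<open>i\<close> enters \<open>Q\<close> only through the
  last edge.\<close>

lemma H_row_free:
  "q \<in> insert i S \<Longrightarrow> j \<notin> insert i S \<Longrightarrow> row_free q (H n u i r k S j l)"
proof (induction r arbitrary: k S j)
  case 0
  then show ?case by (simp add: row_free_const)
next
  case (Suc r)
  show ?case
  proof (cases k)
    case 0
    then show ?thesis by (simp add: row_free_const)
  next
    case (Suc k')
    have "row_free q (\<lambda>\<omega>. H n u i (Suc r) (Suc k') S j l \<omega>)"
      unfolding H.simps
    proof (intro row_free_comp[where g = "\<lambda>x. (1 / sqrt (real n)) * x"] row_free_sum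
        row_free_comp2[where g = "(*)"] row_free_comp[where g = "deriv (f k')"])
      fix m assume m: "m \<in> {1..n} - insert i (insert j S)"
      show "row_free q (ent n j m)" using Suc.prems m by (intro row_free_ent) auto
      show "row_free q (cav n u k' (insert i (insert j S)) m)"
        using Suc.prems m by (intro cav_row_free) auto
      show "row_free q (H n u i r k' (insert j S) m l)"
        using Suc.prems m by (intro Suc.IH) auto
    qed
    then show ?thesis using Suc by simp
  qed
qed

lemma H_eq_0: "l \<in> insert i S \<Longrightarrow> j \<notin> insert i S \<Longrightarrow> H n u i r k S j l \<omega> = 0"
proof (induction r arbitrary: k S j)
  case 0
  then show ?case by auto
next
  case (Suc r)
  show ?case
  proof (cases k)
    case (Suc k')
    have "H n u i r k' (insert j S) m l \<omega> = 0" if "m \<in> {1..n} - insert i (insert j S)" for m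
      using that Suc.prems by (intro Suc.IH) auto
    then show ?thesis by (simp add: Suc)
  qed simp
qed

text \<open>After the first edge \<open>j\<close> belongs to the removed set, so the path cannot
  return to it. Hence only \<open>r = 0\<close> will contribute a trace.\<close>

lemma H_diag: "H n u i (Suc r) k S j j \<omega> = 0"
  by (cases k) (simp_all add: H_eq_0)

lemma Q_0: "j \<in> {1..n} \<Longrightarrow> Q n u i 0 k S j = ent n i j"
  by (rule ext) (simp add: Q_def if_distrib[of "\<lambda>x. x * _"] cong: if_cong)

lemma Q_Suc: "Q n u i (Suc r) (Suc k) S j \<omega> = (1 / sqrt (real n)) *
     (\<Sum>m\<in>{1..n} - insert i (insert j S). ent n j m \<omega> *
       (deriv (f k) (cav n u k (insert i (insert j S)) m \<omega>) * Q n u i r k (insert j S) m \<omega>))"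
proof -
  let ?L = "{1..n} - insert i (insert j S)"
  let ?d = "\<lambda>m. deriv (f k) (cav n u k (insert i (insert j S)) m \<omega>)"
  have "Q n u i (Suc r) (Suc k) S j \<omega>
    = (\<Sum>l\<in>{1..n}. \<Sum>m\<in>?L. (1 / sqrt (real n)) * (ent n j m \<omega> * (?d m * (H n u i r k (insert j S) m l \<omega> * ent n i l \<omega>))))"
    unfolding Q_def H.simps
    by (intro sum.cong refl) (simp only: sum_distrib_left sum_distrib_right mult_ac)
  also have "\<dots> = (\<Sum>m\<in>?L. \<Sum>l\<in>{1..n}. (1 / sqrt (real n)) * (ent n j m \<omega> * (?d m * (H n u i r k (insert j S) m l \<omega> * ent n i l \<omega>))))"
    by (rule sum.swap)
  finally show ?thesis
    unfolding Q_def by (simp only: sum_distrib_left)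
qed

lemma Q_row_free:
  assumes "q \<in> S" "q \<noteq> i" "j \<notin> insert i S"
  shows "row_free q (Q n u i r k S j)"
proof -
  have "row_free q (\<lambda>\<omega>. H n u i r k S j l \<omega> * ent n i l \<omega>)" for l
  \<comment> \<open>For \<open>l = q\<close> the last edge does lie in row \<open>q\<close>, but its
    coefficient vanishes because paths avoid \<open>S\<close>.\<close>
  proof (cases "l = q")
    case True
    then show ?thesis using assms by (simp add: H_eq_0 row_free_const)
  next
    case False
    then show ?thesis using assms
      by (intro row_free_comp2[where g = "(*)"] H_row_free row_free_ent) auto
  qed
  then show ?thesis unfolding Q_def[abs_def] by (intro row_free_sum)
qed

text \<open>Every further edge is a Gaussian sum in the row of the starting point with prefactor
  \<open>1 / sqrt n\<close>, so the order does not depend on the length of the path.\<close>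

lemma Q_bound:
  assumes p: "even p" "p > 0"
  shows "\<exists>C\<ge>0. \<forall>n\<ge>1. \<forall>u S i j. adm n S i j \<longrightarrow> Ob n p 0 C (Q n u i r k S j)"
proof (induction r arbitrary: k)
  case 0
  have "Ob n p 0 (4 * fact p) (Q n u i 0 k S j)" if "n \<ge> 1" "adm n S i j" for n u S i j
    using Ob_ent[OF that(1) p, of i j] that(2) by (simp add: Q_0 adm_def)
  then show ?case by (intro exI[of _ "4 * fact p"]) auto
next
  case (Suc r)
  show ?case
  proof (cases k)
    case 0
    then show ?thesis using p by (intro exI[of _ 0]) (simp add: Q_def[abs_def] Ob_def power_0_left)
  next
    case (Suc k')
    obtain C where C: "C \<ge> 0"
      "\<And>n u S i j. n \<ge> 1 \<Longrightarrow> adm n S i j \<Longrightarrow> Ob n p 0 C (Q n u i r k' S j)" using Suc.IH[of k'] by blast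
    have "Ob n p 0 (4 * fact p * (B k' ^ p * C)) (Q n u i (Suc r) k S j)"
      if n: "n \<ge> 1" and adm: "adm n S i j" for n u S i j
      unfolding Suc Q_Suc[abs_def]
    proof (rule Ob_gauss[OF n _ _ p])
      let ?d = "\<lambda>m \<omega>. deriv (f k') (cav n u k' (insert i (insert j S)) m \<omega>)"
      fix m assume m: "m \<in> {1..n} - insert i (insert j S)"
      then have "adm n (insert j S) i m" using adm by (auto simp: adm_def)
      from C(2)[OF n this, of u]
      show "Ob n p 0 (B k' ^ p * C) (\<lambda>\<omega>. ?d m \<omega> * Q n u i r k' (insert j S) m \<omega>)"
        by (rule Ob_dominated) (auto simp: abs_mult B_nonneg df_bounded intro!: mult_right_mono)
      show "row_free j (\<lambda>\<omega>. ?d m \<omega> * Q n u i r k' (insert j S) m \<omega>)"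
        using m adm
        by (intro row_free_comp2[where g = "(*)"] row_free_comp[where g = "deriv (f k')"]
            cav_row_free Q_row_free) (auto simp: adm_def)
    qed (use adm C(1) B_nonneg in \<open>auto simp: adm_def\<close>)
    moreover have "4 * fact p * (B k' ^ p * C) \<ge> 0" using C B_nonneg[of k'] by simp
    ultimately show ?thesis by blast
  qed
qed

text \<open>For each \<open>l\<close> the first edge gives a Gaussian sum. Summing the second
  moments over \<open>l\<close> bounds the whole by a constant times an average over
  \<open>m\<close> of the same quantity for shorter paths.\<close>

lemma H_second_moment:
  "\<exists>C\<ge>0. \<forall>n\<ge>1. \<forall>u S i j. adm n S i j \<longrightarrow>
    (\<integral>\<^sup>+ \<omega>. ennreal (\<Sum>l\<in>{1..n}. (H n u i r k S j l \<omega>)\<^sup>2) \<partial>goe n) \<le> ennreal C"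
proof (induction r arbitrary: k)
  case 0
  have "(\<Sum>l\<in>{1..n}. (if j = l then 1 else 0 :: real)\<^sup>2) \<le> 1" for n j :: nat
    by (simp add: if_distrib[of "\<lambda>x. x\<^sup>2"] cong: if_cong)
  then show ?case by (intro exI[of _ 1]) (auto intro!: nn_integral_mono order_trans[OF nn_integral_mono[of _ _ "\<lambda>_. 1"]] simp: ennreal_le_1)
next
  case (Suc r)
  show ?case
  proof (cases k)
    case 0
    then show ?thesis by (intro exI[of _ 0]) simp
  next
    case (Suc k')
    obtain C where C: "C \<ge> 0"
      "\<And>n u S i j. n \<ge> 1 \<Longrightarrow> adm n S i j \<Longrightarrow>
        (\<integral>\<^sup>+ \<omega>. ennreal (\<Sum>l\<in>{1..n}. (H n u i r k' S j l \<omega>)\<^sup>2) \<partial>goe n) \<le> ennreal C"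
      using Suc.IH[of k'] by blast
    \<comment> \<open>The factor 8 is \<open>4 * fact 2\<close>, the constant of the linear estimate
      for exponent 2.\<close>
    have "(\<integral>\<^sup>+ \<omega>. ennreal (\<Sum>l\<in>{1..n}. (H n u i (Suc r) k S j l \<omega>)\<^sup>2) \<partial>goe n) \<le> ennreal (8 * ((B k')\<^sup>2 * C))"
      if n: "n \<ge> 1" and adm: "adm n S i j" for n u S i j
    proof -
      let ?L = "{1..n} - insert i (insert j S)"
      let ?d = "\<lambda>m \<omega>. deriv (f k') (cav n u k' (insert i (insert j S)) m \<omega>)"
      let ?h = "\<lambda>m l \<omega>. H n u i r k' (insert j S) m l \<omega>"
      let ?Y = "\<lambda>l m \<omega>. (1 / sqrt (real n)) * (?d m \<omega> * ?h m l \<omega>)"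
      have "(\<integral>\<^sup>+ \<omega>. ennreal (\<Sum>l\<in>{1..n}. (H n u i (Suc r) k S j l \<omega>)\<^sup>2) \<partial>goe n)
        = (\<Sum>l\<in>{1..n}. \<integral>\<^sup>+ \<omega>. ennreal (\<bar>\<Sum>m\<in>?L. ent n j m \<omega> * ?Y l m \<omega>\<bar>\<^sup>2) \<partial>goe n)"
        unfolding Suc
        by (subst nn_integral_sum[symmetric], measurable)
          (simp add: sum_ennreal sum_distrib_left mult_ac)
      also have "\<dots> \<le> (\<Sum>l\<in>{1..n}. \<integral>\<^sup>+ \<omega>. ennreal (4 * fact 2 * (\<Sum>m\<in>?L. (?Y l m \<omega>)\<^sup>2) ^ (2 div 2)) \<partial>goe n)"
        using adm
        by (intro sum_mono goe_linear_moment row_free_comp2[where g = "(*)"]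
            row_free_comp[where g = "\<lambda>x. (1 / sqrt (real n)) * x"]
            row_free_comp[where g = "deriv (f k')"] cav_row_free H_row_free) (auto simp: adm_def)
      also have "\<dots> \<le> (\<Sum>l\<in>{1..n}. \<integral>\<^sup>+ \<omega>. ennreal (8 * (B k')\<^sup>2 / n) * (\<Sum>m\<in>?L. ennreal ((?h m l \<omega>)\<^sup>2)) \<partial>goe n)"
      proof (intro sum_mono nn_integral_mono)
        fix l \<omega>
        have "(\<Sum>m\<in>?L. (?Y l m \<omega>)\<^sup>2) \<le> ((B k')\<^sup>2 / n) * (\<Sum>m\<in>?L. (?h m l \<omega>)\<^sup>2)"
          unfolding sum_distrib_left
        proof (rule sum_mono)
          fix m
          have "(?d m \<omega>)\<^sup>2 \<le> (B k')\<^sup>2"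
            using power_mono[OF df_bounded[of k'], of "cav n u k' (insert i (insert j S)) m \<omega>" 2] by simp
          then have "(?d m \<omega>)\<^sup>2 * (?h m l \<omega>)\<^sup>2 / n \<le> (B k')\<^sup>2 * (?h m l \<omega>)\<^sup>2 / n"
            by (intro divide_right_mono mult_right_mono) auto
          then show "(?Y l m \<omega>)\<^sup>2 \<le> ((B k')\<^sup>2 / n) * (?h m l \<omega>)\<^sup>2"
            by (simp add: power_mult_distrib power_divide)
        qed
        then have "8 * (\<Sum>m\<in>?L. (?Y l m \<omega>)\<^sup>2) \<le> 8 * (((B k')\<^sup>2 / n) * (\<Sum>m\<in>?L. (?h m l \<omega>)\<^sup>2))"
          by (rule mult_left_mono) simp
        moreover have "4 * fact 2 * x ^ (2 div 2) = 8 * x" for x :: real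
          by (simp add: fact_numeral)
        ultimately have "4 * fact 2 * (\<Sum>m\<in>?L. (?Y l m \<omega>)\<^sup>2) ^ (2 div 2) \<le> 8 * (B k')\<^sup>2 / n * (\<Sum>m\<in>?L. (?h m l \<omega>)\<^sup>2)"
          by (simp only: times_divide_eq_left times_divide_eq_right mult.assoc)
        then show "ennreal (4 * fact 2 * (\<Sum>m\<in>?L. (?Y l m \<omega>)\<^sup>2) ^ (2 div 2)) \<le> ennreal (8 * (B k')\<^sup>2 / n) * (\<Sum>m\<in>?L. ennreal ((?h m l \<omega>)\<^sup>2))"
          by (subst sum_ennreal) (auto simp: ennreal_mult[symmetric] sum_nonneg intro!: ennreal_leI)
      qed
      also have "\<dots> = (\<Sum>l\<in>{1..n}. ennreal (8 * (B k')\<^sup>2 / n) * (\<Sum>m\<in>?L. \<integral>\<^sup>+ \<omega>. ennreal ((?h m l \<omega>)\<^sup>2) \<partial>goe n))"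
        by (intro sum.cong refl, subst nn_integral_cmult, measurable, subst nn_integral_sum, measurable)
      also have "\<dots> = ennreal (8 * (B k')\<^sup>2 / n) * (\<Sum>m\<in>?L. \<Sum>l\<in>{1..n}. \<integral>\<^sup>+ \<omega>. ennreal ((?h m l \<omega>)\<^sup>2) \<partial>goe n)"
        by (subst sum_distrib_left[symmetric], subst sum.swap) (rule refl)
      also have "\<dots> = ennreal (8 * (B k')\<^sup>2 / n) * (\<Sum>m\<in>?L. \<integral>\<^sup>+ \<omega>. ennreal (\<Sum>l\<in>{1..n}. (?h m l \<omega>)\<^sup>2) \<partial>goe n)"
        by (subst nn_integral_sum[symmetric]) (auto simp: sum_ennreal)
      also have "\<dots> \<le> ennreal (8 * (B k')\<^sup>2 / n) * (\<Sum>m\<in>?L. ennreal C)"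
        using adm by (intro mult_left_mono sum_mono C(2) n) (auto simp: adm_def)
      also have "\<dots> = ennreal ((card ?L / n) * (8 * ((B k')\<^sup>2 * C)))"
        using C(1) by (simp add: ennreal_mult[symmetric] ennreal_of_nat_eq_real_of_nat mult_ac)
      also have "\<dots> \<le> ennreal (1 * (8 * ((B k')\<^sup>2 * C)))"
      proof (intro ennreal_leI mult_right_mono)
        have "card ?L \<le> n" using card_mono[of "{1..n}" ?L] by auto
        then show "real (card ?L) / real n \<le> 1" using n by simp
      qed (use C(1) in auto)
      finally show ?thesis by simp
    qed
    moreover have "8 * ((B k')\<^sup>2 * C) \<ge> 0" using C by simp
    ultimately show ?thesis by blast
  qed
qed

section \<open>The remainder of the expansion is of order 1 / n\<close>

text \<open>A path with \<open>r + 1\<close> edges arrives at \<open>i\<close> at time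
  \<open>k - 1 - r\<close>, and the value of \<open>f\<close> there is the common factor; it does
  not mention \<open>j\<close>. As \<open>r < k\<close>, the subtraction is exact.\<close>

definition remainder :: "nat \<Rightarrow> (nat \<Rightarrow> real) \<Rightarrow> nat \<Rightarrow> nat set \<Rightarrow> nat \<Rightarrow> nat \<Rightarrow> (nat \<times> nat \<Rightarrow> real) \<Rightarrow> real" where
  "remainder n u k S i j \<omega> = cavd n u k S i j \<omega>
     - (1 / sqrt (real n)) * (\<Sum>r<k. f (k - 1 - r) (cav n u (k - 1 - r) S i \<omega>) * Q n u i r k S j \<omega>)"

lemma remainder_measurable [measurable]: "remainder n u k S i j \<in> borel_measurable (goe n)"
  unfolding remainder_def[abs_def] by measurable

text \<open>Expanding \<open>cavd n u k (insert j S) i m\<close> gives the right paths, but a common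
  factor with \<open>j\<close> removed. The first sum is the cost of putting \<open>j\<close> back;
  the second collects the Taylor error and the remainder of the previous step.\<close>

lemma remainder_Suc:
  assumes "adm n S i j"
  shows "remainder n u (Suc k) S i j \<omega> =
    (1 / sqrt (real n)) * (\<Sum>r<Suc k. (f (k - r) (cav n u (k - r) (insert j S) i \<omega>)
        - f (k - r) (cav n u (k - r) S i \<omega>)) * Q n u i r (Suc k) S j \<omega>)
    + (1 / sqrt (real n)) * (\<Sum>m\<in>{1..n} - insert i (insert j S). ent n j m \<omega> *
        (f k (cav n u k (insert j S) m \<omega>) - f k (cav n u k (insert i (insert j S)) m \<omega>)
         - deriv (f k) (cav n u k (insert i (insert j S)) m \<omega>) *
           (cavd n u k (insert j S) i m \<omega> - remainder n u k (insert j S) i m \<omega>)))"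
proof -
  let ?e = "1 / sqrt (real n)"
  let ?L = "{1..n} - insert i (insert j S)"
  let ?d = "\<lambda>m. deriv (f k) (cav n u k (insert i (insert j S)) m \<omega>)"
  let ?g = "\<lambda>r. f (k - r) (cav n u (k - r) (insert j S) i \<omega>)"
  have "?e * (\<Sum>m\<in>?L. ent n j m \<omega> * (?d m * (cavd n u k (insert j S) i m \<omega> - remainder n u k (insert j S) i m \<omega>)))
      = ?e * (\<Sum>m\<in>?L. \<Sum>r<k. ?e * (?g (Suc r) * (ent n j m \<omega> * (?d m * Q n u i r k (insert j S) m \<omega>))))"
    unfolding remainder_def
    by (intro arg_cong2[of _ _ _ _ "(*)"] sum.cong refl) (simp add: sum_distrib_left mult_ac)
  also have "\<dots> = ?e * (\<Sum>r<k. \<Sum>m\<in>?L. ?e * (?g (Suc r) * (ent n j m \<omega> * (?d m * Q n u i r k (insert j S) m \<omega>))))"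
    by (subst sum.swap) (rule refl)
  also have "\<dots> = ?e * (\<Sum>r<k. ?g (Suc r) * Q n u i (Suc r) (Suc k) S j \<omega>)"
    unfolding Q_Suc by (simp add: sum_distrib_left mult_ac)
  finally have 1: "?e * (\<Sum>m\<in>?L. ent n j m \<omega> * (?d m * (cavd n u k (insert j S) i m \<omega> - remainder n u k (insert j S) i m \<omega>)))
      = ?e * (\<Sum>r<k. ?g (Suc r) * Q n u i (Suc r) (Suc k) S j \<omega>)" .
  \<comment> \<open>The direct edge from \<open>j\<close> to \<open>i\<close> is the path
    \<open>r = 0\<close>; any other path is an edge from \<open>j\<close> to some \<open>m\<close>
    followed by a shorter path.\<close>
  have 2: "(\<Sum>r<Suc k. ?g r * Q n u i r (Suc k) S j \<omega>)
      = ent n j i \<omega> * f k (cav n u k (insert j S) i \<omega>) + (\<Sum>r<k. ?g (Suc r) * Q n u i (Suc r) (Suc k) S j \<omega>)"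
    using assms by (subst sum.lessThan_Suc_shift) (simp add: Q_0 adm_def ent_sym[of n j i])
  have 3: "e * a + e * x - e * g' = e * (g - g') + e * (x - y)"
    if "e * y = e * s" "g = a + s" for e y s g a x g' :: real
    using that by (simp add: algebra_simps)
  have 4: "(\<Sum>r<Suc k. (?g r - f (k - r) (cav n u (k - r) S i \<omega>)) * Q n u i r (Suc k) S j \<omega>)
      = (\<Sum>r<Suc k. ?g r * Q n u i r (Suc k) S j \<omega>)
        - (\<Sum>r<Suc k. f (k - r) (cav n u (k - r) S i \<omega>) * Q n u i r (Suc k) S j \<omega>)"
    by (simp only: left_diff_distrib sum_subtractf)
  have 5: "(\<Sum>m\<in>?L. ent n j m \<omega> * (x m - y m)) = (\<Sum>m\<in>?L. ent n j m \<omega> * x m) - (\<Sum>m\<in>?L. ent n j m \<omega> * y m)"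
    for x y by (simp only: right_diff_distrib sum_subtractf)
  show ?thesis
    unfolding remainder_def[of n u "Suc k"] cavd_Suc[OF assms] 4 diff_Suc_1
    by (subst 5[of "\<lambda>m. f k (cav n u k (insert j S) m \<omega>) - f k (cav n u k (insert i (insert j S)) m \<omega>)"])
      (rule 3[OF 1 2])
qed

lemma Q_bound_uniform:
  assumes p: "even p" "p > 0"
  shows "\<exists>C\<ge>0. \<forall>r<K. \<forall>n\<ge>1. \<forall>u S i j. adm n S i j \<longrightarrow> Ob n p 0 C (Q n u i r k S j)"
  by (rule uniform_constant) (use Q_bound[OF p] in \<open>blast intro: Ob_weaken\<close>)+

lemma cavd_bound_uniform:
  assumes p: "even p" "p > 0"
  shows "\<exists>C\<ge>0. \<forall>k<K. \<forall>n\<ge>1. \<forall>u S i j. adm n S i j \<longrightarrow> Ob n p 1 C (cavd n u k S i j)"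
  by (rule uniform_constant) (use cavd_bound[OF p] in \<open>blast intro: Ob_weaken\<close>)+

text \<open>The second-order Taylor term is bounded by the square of \<open>cavd\<close>, whence the
  exponent \<open>2 * p\<close> and the order \<open>1 / n\<close>. Since the derivative multiplies
  the explicit expansion only, the remainder reappears with a bounded factor.\<close>

lemma taylor_error_bound:
  assumes n: "n \<ge> 1"
    and D: "Ob n (2 * p) 1 C (cavd n u k S i m)"
    and R: "Ob n p 2 C' (remainder n u k S i m)"
  shows "Ob n p 2 (2 ^ p * (B k ^ p * (C + C) + B k ^ p * C'))
    (\<lambda>\<omega>. f k (cav n u k S m \<omega>) - f k (cav n u k (insert i S) m \<omega>)
         - deriv (f k) (cav n u k (insert i S) m \<omega>) *
           (cavd n u k S i m \<omega> - remainder n u k S i m \<omega>))"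
proof -
  let ?F = "\<lambda>\<omega>. f k (cav n u k S m \<omega>) - f k (cav n u k (insert i S) m \<omega>)"
  let ?d = "\<lambda>\<omega>. deriv (f k) (cav n u k (insert i S) m \<omega>)"
  have sq: "Ob n p 2 (C + C) (\<lambda>\<omega>. cavd n u k S i m \<omega> * cavd n u k S i m \<omega>)"
    using Ob_mult[OF D D] by (simp add: numeral_2_eq_2)
  have 1: "Ob n p 2 (B k ^ p * (C + C)) (\<lambda>\<omega>. ?F \<omega> - ?d \<omega> * cavd n u k S i m \<omega>)"
  proof (rule Ob_dominated[OF sq])
    fix \<omega>
    show "\<bar>?F \<omega> - ?d \<omega> * cavd n u k S i m \<omega>\<bar> \<le> B k * \<bar>cavd n u k S i m \<omega> * cavd n u k S i m \<omega>\<bar>"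
      using f_taylor[of k "cav n u k S m \<omega>" "cav n u k (insert i S) m \<omega>"]
      by (simp add: cavd_def power2_eq_square)
  qed (measurable, rule B_nonneg)
  have 2: "Ob n p 2 (B k ^ p * C') (\<lambda>\<omega>. ?d \<omega> * remainder n u k S i m \<omega>)"
    by (rule Ob_dominated[OF R]) (auto simp: abs_mult B_nonneg df_bounded intro!: mult_right_mono)
  show ?thesis using Ob_add[OF 1 2] by (simp add: algebra_simps)
qed

lemma remainder_row_free:
  assumes "j \<in> S" "i \<notin> S" "m \<notin> S" "m \<noteq> i"
  shows "row_free j (remainder n u k S i m)"
proof -
  have "row_free j (\<lambda>\<omega>. (cav n u k S m \<omega> - cav n u k (insert i S) m \<omega>)
     - (1 / sqrt (real n)) * (\<Sum>r<k. f (k - 1 - r) (cav n u (k - 1 - r) S i \<omega>) * Q n u i r k S m \<omega>))"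
    using assms
    by (intro row_free_comp2[where g = "(-)"] cav_row_free row_free_sum row_free_comp2[where g = "(*)"]
        row_free_comp[where g = "\<lambda>x. (1 / sqrt (real n)) * x"] Q_row_free row_free_comp[where g = "f (k - 1 - r)" for r]) auto
  then show ?thesis unfolding remainder_def[abs_def] cavd_def .
qed

text \<open>In the first sum of \<open>remainder_Suc\<close> a difference of order
  \<open>1 / sqrt n\<close> meets a path sum of order 1 and the prefactor \<open>1 / sqrt n\<close>.
  The second is a Gaussian sum in row \<open>j\<close> with coefficients of order
  \<open>1 / n\<close>.\<close>

lemma remainder_bound:
  assumes p: "even p" "p > 0"
  shows "\<exists>C\<ge>0. \<forall>n\<ge>1. \<forall>u S i j. adm n S i j \<longrightarrow> Ob n p 2 C (remainder n u k S i j)"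
proof (induction k)
  case 0
  show ?case using p
    by (intro exI[of _ 0]) (simp add: remainder_def[abs_def] cavd_0 Ob_def power_0_left)
next
  case (Suc k)
  then obtain C where C: "C \<ge> 0"
    "\<And>n u S i j. n \<ge> 1 \<Longrightarrow> adm n S i j \<Longrightarrow> Ob n p 2 C (remainder n u k S i j)" by blast
  have p2: "even (2 * p)" "2 * p > 0" using p by auto
  obtain C1 where C1: "C1 \<ge> 0" "\<And>k' n u S i j. k' < Suc k \<Longrightarrow> n \<ge> 1 \<Longrightarrow> adm n S i j \<Longrightarrow> Ob n (2 * p) 1 C1 (cavd n u k' S i j)"
    using cavd_bound_uniform[OF p2, of "Suc k"] by blast
  obtain C2 where C2: "C2 \<ge> 0" "\<And>r n u S i j. r < Suc k \<Longrightarrow> n \<ge> 1 \<Longrightarrow> adm n S i j \<Longrightarrow> Ob n (2 * p) 0 C2 (Q n u i r (Suc k) S j)"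
    using Q_bound_uniform[OF p2, of "Suc k" "Suc k"] by blast
  define b where "b = (\<Sum>r<Suc k. B r)"
  have b: "B r \<le> b" if "r < Suc k" for r
    unfolding b_def using that by (intro member_le_sum) (auto simp: B_nonneg)
  have b0: "b \<ge> 0" unfolding b_def by (intro sum_nonneg B_nonneg)
  define c1 where "c1 = (2 ^ Suc p) ^ Suc k * (b ^ (2 * p) * C1 + C2)"
  define c2 where "c2 = 2 ^ p * (B k ^ p * (C1 + C1) + B k ^ p * C)"
  define c where "c = 2 ^ p * (c1 + 4 * fact p * c2)"
  have nonneg: "c2 \<ge> 0" "c \<ge> 0" using C C1 C2 b0 B_nonneg[of k] by (auto simp: c_def c1_def c2_def)
  have "Ob n p 2 c (remainder n u (Suc k) S i j)" if n: "n \<ge> 1" and adm: "adm n S i j" for n u S i j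
  proof -
    let ?G = "\<lambda>r \<omega>. f (k - r) (cav n u (k - r) (insert j S) i \<omega>) - f (k - r) (cav n u (k - r) S i \<omega>)"
    \<comment> \<open>The roles of \<open>i\<close> and \<open>j\<close> are exchanged: the change
      of the factor at \<open>i\<close> is a cavity difference caused by removing
      \<open>j\<close>.\<close>
    have adm': "adm n S j i" using adm by (auto simp: adm_def)
    have "Ob n p 1 c1 (\<lambda>\<omega>. \<Sum>r<Suc k. ?G r \<omega> * Q n u i r (Suc k) S j \<omega>)"
      unfolding c1_def
    proof (rule Ob_sum)
      fix r assume r: "r < Suc k"
      have "Ob n (2 * p) 1 (b ^ (2 * p) * C1) (\<lambda>\<omega>. ?G r \<omega>)"
      proof (rule Ob_dominated[OF C1(2)[OF _ n adm', of "k - r" u]])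
        fix \<omega>
        have "\<bar>?G r \<omega>\<bar>
            \<le> B (k - r) * \<bar>cavd n u (k - r) S j i \<omega>\<bar>"
          using f_lipschitz[of "k - r" "cav n u (k - r) (insert j S) i \<omega>" "cav n u (k - r) S i \<omega>"]
          by (simp add: cavd_def abs_minus_commute)
        also have "\<dots> \<le> b * \<bar>cavd n u (k - r) S j i \<omega>\<bar>" by (intro mult_right_mono b) auto
        finally show "\<bar>?G r \<omega>\<bar>
            \<le> b * \<bar>cavd n u (k - r) S j i \<omega>\<bar>" .
      qed (use b0 in auto)
      from Ob_mult[OF this C2(2)[OF r n adm, of u]]
      show "Ob n p 1 (b ^ (2 * p) * C1 + C2) (\<lambda>\<omega>. ?G r \<omega> * Q n u i r (Suc k) S j \<omega>)" by simp
    qed (use b0 C1 C2 p in auto)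
    from Ob_scale[OF this n]
    have 1: "Ob n p 2 c1 (\<lambda>\<omega>. (1 / sqrt (real n)) * (\<Sum>r<Suc k. ?G r \<omega> * Q n u i r (Suc k) S j \<omega>))"
      by (simp only: numeral_2_eq_2 One_nat_def)
    let ?E = "\<lambda>m \<omega>. f k (cav n u k (insert j S) m \<omega>) - f k (cav n u k (insert i (insert j S)) m \<omega>)
         - deriv (f k) (cav n u k (insert i (insert j S)) m \<omega>) *
           (cavd n u k (insert j S) i m \<omega> - remainder n u k (insert j S) i m \<omega>)"
    have 2: "Ob n p 2 (4 * fact p * c2) (\<lambda>\<omega>. (1 / sqrt (real n)) *
        (\<Sum>m\<in>{1..n} - insert i (insert j S). ent n j m \<omega> * ?E m \<omega>))"
    proof (rule Ob_gauss[OF n _ _ p nonneg(1)])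
      fix m assume m: "m \<in> {1..n} - insert i (insert j S)"
      then have admm: "adm n (insert j S) i m" using adm by (auto simp: adm_def)
      show "Ob n p 2 c2 (?E m)"
        unfolding c2_def by (intro taylor_error_bound n C1(2) C(2) admm) auto
      have "row_free j (\<lambda>\<omega>. f k (cav n u k (insert j S) m \<omega>) - f k (cav n u k (insert i (insert j S)) m \<omega>)
         - deriv (f k) (cav n u k (insert i (insert j S)) m \<omega>) *
           ((cav n u k (insert j S) m \<omega> - cav n u k (insert i (insert j S)) m \<omega>) - remainder n u k (insert j S) i m \<omega>))"
        using m adm
        by (intro row_free_comp2[where g = "(-)"] row_free_comp2[where g = "(*)"] cav_row_free
            row_free_comp[where g = "f k"] row_free_comp[where g = "deriv (f k)"] remainder_row_free)
          (auto simp: adm_def)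
      then show "row_free j (?E m)" by (simp only: cavd_def)
    qed (use adm in \<open>auto simp: adm_def\<close>)
    show ?thesis
      using Ob_add[OF 1 2] by (simp only: remainder_Suc[OF adm, abs_def] c_def)
  qed
  then show ?case using nonneg by blast
qed

subsection \<open>The cavity iteration almost satisfies the AMP recursion\<close>

text \<open>The defect of the cavity iterates in the AMP recursion for step \<open>k + 2\<close>:
  the subtracted sum with \<open>{i}\<close> removed, including its prefactor, is the cavity iterate
  \<open>k + 2\<close> at \<open>i\<close>.\<close>

definition Err :: "nat \<Rightarrow> (nat \<Rightarrow> real) \<Rightarrow> nat \<Rightarrow> nat \<Rightarrow> (nat \<times> nat \<Rightarrow> real) \<Rightarrow> real" where
  "Err n u k i \<omega> = (1 / sqrt (real n)) * (\<Sum>j\<in>{1..n} - {i}. ent n i j \<omega> *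
       (f (Suc k) (cav n u (Suc k) {} j \<omega>) - f (Suc k) (cav n u (Suc k) {i} j \<omega>)))
     - ((1 / real n) * (\<Sum>j\<in>{1..n}. deriv (f (Suc k)) (cav n u (Suc k) {} j \<omega>))) * f k (cav n u k {} i \<omega>)"

text \<open>Inserting the expansion into row \<open>i\<close> gives quadratic forms in that row.
  Centring them splits off the trace, present only for \<open>r = 0\<close>. It cancels the Onsager
  term up to two errors: its derivatives are taken with \<open>i\<close> removed, and its sum lacks
  \<open>j = i\<close>.\<close>

lemma Err_decomposition:
  fixes n k i :: nat and u :: "nat \<Rightarrow> real" and \<omega> :: "nat \<times> nat \<Rightarrow> real"
  assumes n: "n \<ge> 1" and i: "i \<in> {1..n}"
  defines "L \<equiv> {1..n} - {i}"
  defines "c \<equiv> \<lambda>j \<omega>. deriv (f (Suc k)) (cav n u (Suc k) {i} j \<omega>)"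
  defines "g \<equiv> \<lambda>r \<omega>. f (k - r) (cav n u (k - r) {} i \<omega>)"
  defines "E \<equiv> \<lambda>j \<omega>. f (Suc k) (cav n u (Suc k) {} j \<omega>) - f (Suc k) (cav n u (Suc k) {i} j \<omega>)
      - c j \<omega> * (cavd n u (Suc k) {} i j \<omega> - remainder n u (Suc k) {} i j \<omega>)"
  shows "Err n u k i \<omega> =
    (1 / real n) * (\<Sum>j\<in>L. sqrt (real n) * (ent n i j \<omega> * E j \<omega>))
    + (\<Sum>r<Suc k. g r \<omega> * ((1 / real n) * (\<Sum>j\<in>L. \<Sum>l\<in>L.
        (ent n i j \<omega> * ent n i l \<omega> - (if j = l then 1 else 0)) * (c j \<omega> * H n u i r (Suc k) {} j l \<omega>))))
    + g 0 \<omega> * ((1 / real n) * (\<Sum>j\<in>L. c j \<omega> - deriv (f (Suc k)) (cav n u (Suc k) {} j \<omega>)))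
    - (1 / sqrt (real n)) * ((1 / sqrt (real n)) * (g 0 \<omega> * deriv (f (Suc k)) (cav n u (Suc k) {} i \<omega>)))"
proof -
  let ?e = "1 / sqrt (real n)"
  have ee: "?e * ?e = 1 / real n" by simp
  have es: "?e = (1 / real n) * sqrt (real n)" 
  proof -
    have "sqrt (real n) * sqrt (real n) = real n" "sqrt (real n) > 0" using n by simp_all
    then show ?thesis by (metis nonzero_divide_mult_cancel_right mult.commute times_divide_eq_left mult_1 less_numeral_extra(3))
  qed
  let ?a = "\<lambda>j. ent n i j \<omega>"
  let ?d = "\<lambda>j. deriv (f (Suc k)) (cav n u (Suc k) {} j \<omega>)"
  let ?h = "\<lambda>r j l. H n u i r (Suc k) {} j l \<omega>"
  have fdiff: "f (Suc k) (cav n u (Suc k) {} j \<omega>) - f (Suc k) (cav n u (Suc k) {i} j \<omega>)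
      = E j \<omega> + c j \<omega> * (?e * (\<Sum>r<Suc k. g r \<omega> * Q n u i r (Suc k) {} j \<omega>))" for j
    by (simp only: E_def remainder_def g_def diff_Suc_1) simp
  have Qsum: "Q n u i r (Suc k) {} j \<omega> = (\<Sum>l\<in>L. ?h r j l * ?a l)" for r j
    unfolding Q_def L_def by (rule sum.mono_neutral_right) auto
  have diag: "(\<Sum>j\<in>L. \<Sum>l\<in>L. (if j = l then 1 else 0) * (c j \<omega> * ?h r j l))
      = (if r = 0 then (\<Sum>j\<in>L. c j \<omega>) else 0)" for r
  proof -
    have "(\<Sum>j\<in>L. \<Sum>l\<in>L. (if j = l then 1 else 0) * (c j \<omega> * ?h r j l)) = (\<Sum>j\<in>L. c j \<omega> * ?h r j j)"
      by (intro sum.cong refl) (simp add: L_def if_distrib[of "\<lambda>x. x * _"] cong: if_cong)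
    also have "\<dots> = (if r = 0 then (\<Sum>j\<in>L. c j \<omega>) else 0)"
      by (cases r) (simp_all add: H_diag)
    finally show ?thesis .
  qed
  have quad: "(\<Sum>j\<in>L. ?a j * (c j \<omega> * Q n u i r (Suc k) {} j \<omega>))
      = (\<Sum>j\<in>L. \<Sum>l\<in>L. (?a j * ?a l - (if j = l then 1 else 0)) * (c j \<omega> * ?h r j l))
        + (if r = 0 then (\<Sum>j\<in>L. c j \<omega>) else 0)" for r
    unfolding diag[symmetric] Qsum sum.distrib[symmetric]
    by (intro sum.cong refl) (simp add: sum_distrib_left algebra_simps)
  have "?e * (\<Sum>j\<in>L. ?a j * (f (Suc k) (cav n u (Suc k) {} j \<omega>) - f (Suc k) (cav n u (Suc k) {i} j \<omega>)))
     = ?e * (\<Sum>j\<in>L. ?a j * E j \<omega>) + ?e * (?e * (\<Sum>j\<in>L. \<Sum>r<Suc k. g r \<omega> * (?a j * (c j \<omega> * Q n u i r (Suc k) {} j \<omega>))))"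
    unfolding fdiff distrib_left sum.distrib
    by (intro arg_cong2[of _ _ _ _ "(+)"] refl) (simp only: sum_distrib_left mult_ac)
  also have "?e * (\<Sum>j\<in>L. ?a j * E j \<omega>) = (1 / real n) * (\<Sum>j\<in>L. sqrt (real n) * (ent n i j \<omega> * E j \<omega>))"
    by (subst es) (simp only: sum_distrib_left mult_ac)
  also have "(\<Sum>j\<in>L. \<Sum>r<Suc k. g r \<omega> * (?a j * (c j \<omega> * Q n u i r (Suc k) {} j \<omega>)))
     = (\<Sum>r<Suc k. g r \<omega> * (\<Sum>j\<in>L. ?a j * (c j \<omega> * Q n u i r (Suc k) {} j \<omega>)))"
    by (subst sum.swap) (simp only: sum_distrib_left)
  also have "\<dots> = (\<Sum>r<Suc k. g r \<omega> * (\<Sum>j\<in>L. \<Sum>l\<in>L. (?a j * ?a l - (if j = l then 1 else 0)) * (c j \<omega> * ?h r j l)))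
      + (\<Sum>r<Suc k. if r = 0 then g 0 \<omega> * (\<Sum>j\<in>L. c j \<omega>) else 0)"
    unfolding quad distrib_left sum.distrib
    by (intro arg_cong2[of _ _ _ _ "(+)"] refl sum.cong) auto
  also have "(\<Sum>r<Suc k. if r = 0 then g 0 \<omega> * (\<Sum>j\<in>L. c j \<omega>) else 0) = g 0 \<omega> * (\<Sum>j\<in>L. c j \<omega>)"
    by (subst sum.delta) auto
  finally have main: "?e * (\<Sum>j\<in>L. ?a j * (f (Suc k) (cav n u (Suc k) {} j \<omega>) - f (Suc k) (cav n u (Suc k) {i} j \<omega>)))
     = (1 / real n) * (\<Sum>j\<in>L. sqrt (real n) * (ent n i j \<omega> * E j \<omega>))
      + ?e * (?e * ((\<Sum>r<Suc k. g r \<omega> * (\<Sum>j\<in>L. \<Sum>l\<in>L. (?a j * ?a l - (if j = l then 1 else 0)) * (c j \<omega> * ?h r j l)))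
      + g 0 \<omega> * (\<Sum>j\<in>L. c j \<omega>)))" .
  have dsum: "(\<Sum>j\<in>{1..n}. ?d j) = ?d i + (\<Sum>j\<in>L. ?d j)"
    unfolding L_def using i by (rule sum.remove[rotated]) simp
  have inv: "(\<Sum>r<Suc k. g r \<omega> * ((1 / real n) * (\<Sum>j\<in>L. \<Sum>l\<in>L. (?a j * ?a l - (if j = l then 1 else 0)) * (c j \<omega> * ?h r j l))))
    = (1 / real n) * (\<Sum>r<Suc k. g r \<omega> * (\<Sum>j\<in>L. \<Sum>l\<in>L. (?a j * ?a l - (if j = l then 1 else 0)) * (c j \<omega> * ?h r j l)))"
    by (simp only: sum_distrib_left mult_ac)
  have alg: "t + ?e * (?e * (z + g0 * x)) - (1 / real n) * (di + y) * g0
      = t + (1 / real n) * z + g0 * ((1 / real n) * (x - y)) - ?e * (?e * (g0 * di))" for t z g0 x di y :: real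
    unfolding mult.assoc[symmetric] ee by (simp add: algebra_simps diff_divide_distrib add_divide_distrib)
  have g0: "f k (cav n u k {} i \<omega>) = g 0 \<omega>" by (simp add: g_def)
  show ?thesis
    unfolding Err_def L_def[symmetric] main dsum inv sum_subtractf g0
    by (rule alg)
qed

text \<open>The four terms of the decomposition are at most of order \<open>1 / sqrt n\<close> for
  different reasons: a Taylor error of order \<open>1 / n\<close> against \<open>sqrt n\<close>,
  fluctuations of quadratic forms with bounded multipliers, an average of small differences of
  derivatives, and one summand out of n.\<close>

lemma Err_bound:
  "\<exists>C\<ge>0. \<forall>n\<ge>1. \<forall>u. \<forall>i\<in>{1..n}. Ob n 2 1 C (Err n u k i)"
proof -
  let ?k = "Suc k"
  \<comment> \<open>Exponent 8: the product with a matrix entry raises 2 to 4, and the square in the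
    Taylor error raises 4 to 8.\<close>
  obtain C8 where C8: "C8 \<ge> 0" "\<And>n u S i j. n \<ge> 1 \<Longrightarrow> adm n S i j \<Longrightarrow> Ob n (2 * 4) 1 C8 (cavd n u ?k S i j)"
    using cavd_bound[of "2 * 4" ?k] by auto
  obtain C2 where C2: "C2 \<ge> 0" "\<And>n u S i j. n \<ge> 1 \<Longrightarrow> adm n S i j \<Longrightarrow> Ob n 2 1 C2 (cavd n u ?k S i j)"
    using cavd_bound[of 2 ?k] by auto
  obtain C4 where C4: "C4 \<ge> 0" "\<And>n u S i j. n \<ge> 1 \<Longrightarrow> adm n S i j \<Longrightarrow> Ob n 4 2 C4 (remainder n u ?k S i j)"
    using remainder_bound[of 4 ?k] by auto
  have "\<exists>C\<ge>0. \<forall>r<?k. \<forall>n\<ge>1. \<forall>u S i j. adm n S i j \<longrightarrow>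
    (\<integral>\<^sup>+ \<omega>. ennreal (\<Sum>l\<in>{1..n}. (H n u i r ?k S j l \<omega>)\<^sup>2) \<partial>goe n) \<le> ennreal C"
    by (rule uniform_constant[OF H_second_moment]) (meson ennreal_leI order_trans)
  then obtain CH where CH: "CH \<ge> 0" "\<And>r n u S i j. r < ?k \<Longrightarrow> n \<ge> 1 \<Longrightarrow> adm n S i j \<Longrightarrow>
    (\<integral>\<^sup>+ \<omega>. ennreal (\<Sum>l\<in>{1..n}. (H n u i r ?k S j l \<omega>)\<^sup>2) \<partial>goe n) \<le> ennreal CH" by blast
  define b where "b = (\<Sum>r<Suc ?k. B r)"
  have b: "B r \<le> b" if "r < Suc ?k" for r
    unfolding b_def using that by (intro member_le_sum) (auto simp: B_nonneg)
  have b0: "b \<ge> 0" unfolding b_def by (intro sum_nonneg B_nonneg)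
  define c1 where "c1 = 4 * fact (2 * 2) + 2 ^ 4 * (B ?k ^ 4 * (C8 + C8) + B ?k ^ 4 * C4)"
  define cz where "cz = 2 * b\<^sup>2 * CH"
  define c2 where "c2 = (2 ^ Suc 2) ^ ?k * (b\<^sup>2 * cz)"
  define c3 where "c3 = b\<^sup>2 * (b\<^sup>2 * C2)"
  define c4 where "c4 = (b * b)\<^sup>2"
  define C where "C = 2 ^ 2 * (2 ^ 2 * (2 ^ 2 * (c1 + c2) + c3) + c4)"
  have nonneg: "c1 \<ge> 0" "cz \<ge> 0" "c2 \<ge> 0" "c3 \<ge> 0" "C \<ge> 0"
    using C8 C2 C4 CH b0 B_nonneg[of ?k] by (auto simp: c1_def cz_def c2_def c3_def c4_def C_def)
  have "Ob n 2 1 C (Err n u k i)" if n: "n \<ge> 1" and i: "i \<in> {1..n}" for n u i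
  proof -
    let ?L = "{1..n} - {i}"
    define c where "c = (\<lambda>j \<omega>. deriv (f ?k) (cav n u ?k {i} j \<omega>))"
    define g where "g = (\<lambda>r \<omega>. f (k - r) (cav n u (k - r) {} i \<omega>))"
    define E where "E = (\<lambda>j \<omega>. f ?k (cav n u ?k {} j \<omega>) - f ?k (cav n u ?k {i} j \<omega>)
      - c j \<omega> * (cavd n u ?k {} i j \<omega> - remainder n u ?k {} i j \<omega>))"
    have [measurable]: "\<And>j. c j \<in> borel_measurable (goe n)" "\<And>r. g r \<in> borel_measurable (goe n)"
      "\<And>j. E j \<in> borel_measurable (goe n)"
      unfolding c_def g_def E_def by measurable
    have cb: "\<bar>c j \<omega>\<bar> \<le> b" for j \<omega>
      unfolding c_def using df_bounded[of ?k] b[of ?k] by (meson lessI order_trans)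
    have gb: "\<bar>g r \<omega>\<bar> \<le> b" for r \<omega>
      unfolding g_def using f_bounded[of "k - r"] b[of "k - r"] by (meson diff_le_self le_imp_less_Suc le_SucI order_trans)
    have admj: "adm n {} i j" if "j \<in> ?L" for j using that i by (auto simp: adm_def)
    have cardL: "card ?L \<le> n" using card_mono[of "{1..n}" ?L] by auto
    have 1: "Ob n 2 1 c1 (\<lambda>\<omega>. (1 / real n) * (\<Sum>j\<in>?L. sqrt (real n) * (ent n i j \<omega> * E j \<omega>)))"
    proof (rule Ob_average[OF _ cardL])
      fix j assume j: "j \<in> ?L"
      have "Ob n 4 2 (2 ^ 4 * (B ?k ^ 4 * (C8 + C8) + B ?k ^ 4 * C4)) (E j)"
        unfolding E_def c_def by (intro taylor_error_bound n C8(2) C4(2) admj j)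
      then have "Ob n (2 * 2) 2 (2 ^ 4 * (B ?k ^ 4 * (C8 + C8) + B ?k ^ 4 * C4)) (E j)" by simp
      moreover have "Ob n (2 * 2) 0 (4 * fact (2 * 2)) (ent n i j)"
        by (rule Ob_ent[OF n]) auto
      ultimately have "Ob n 2 (0 + 2) c1 (\<lambda>\<omega>. ent n i j \<omega> * E j \<omega>)"
        unfolding c1_def by (intro Ob_mult)
      then have "Ob n 2 (Suc 1) c1 (\<lambda>\<omega>. ent n i j \<omega> * E j \<omega>)" by (simp only: add_0 Suc_1)
      from Ob_unscale[OF this n]
      show "Ob n 2 1 c1 (\<lambda>\<omega>. sqrt (real n) * (ent n i j \<omega> * E j \<omega>))" .
    qed (use nonneg in auto)
    have 2: "Ob n 2 1 c2 (\<lambda>\<omega>. \<Sum>r<?k. g r \<omega> * ((1 / real n) * (\<Sum>j\<in>?L. \<Sum>l\<in>?L.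
        (ent n i j \<omega> * ent n i l \<omega> - (if j = l then 1 else 0)) * (c j \<omega> * H n u i r ?k {} j l \<omega>))))"
      unfolding c2_def
    proof (rule Ob_sum)
      fix r assume r: "r < ?k"
      let ?Z = "\<lambda>\<omega>. \<Sum>j\<in>?L. \<Sum>l\<in>?L.
        (ent n i j \<omega> * ent n i l \<omega> - (if j = l then 1 else 0)) * (c j \<omega> * H n u i r ?k {} j l \<omega>)"
      have "Ob n 2 1 cz (\<lambda>\<omega>. (1 / real n) * ?Z \<omega>)"
        unfolding cz_def
      proof (rule Ob_quadratic[OF n i])
        show "row_free i (c j)" if "j \<in> {1..n} - {i}" for j
          unfolding c_def using that by (intro row_free_comp[where g = "deriv (f ?k)"] cav_row_free) auto
        show "row_free i (H n u i r ?k {} j l)" if "j \<in> {1..n} - {i}" "l \<in> {1..n} - {i}" for j l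
          using that by (intro H_row_free) auto
        show "(\<integral>\<^sup>+ \<omega>. ennreal (\<Sum>l\<in>{1..n}. (H n u i r ?k {} j l \<omega>)\<^sup>2) \<partial>goe n) \<le> ennreal CH"
          if "j \<in> {1..n} - {i}" for j
          by (rule CH(2)[OF r n admj[OF that]])
      qed (use cb CH(1) in measurable)
      then show "Ob n 2 1 (b\<^sup>2 * cz) (\<lambda>\<omega>. g r \<omega> * ((1 / real n) * ?Z \<omega>))"
      proof (rule Ob_dominated)
        fix \<omega>
        show "\<bar>g r \<omega> * ((1 / real n) * ?Z \<omega>)\<bar> \<le> b * \<bar>(1 / real n) * ?Z \<omega>\<bar>"
          unfolding abs_mult[of "g r \<omega>"] by (intro mult_right_mono gb) auto
      qed (measurable, rule b0)
    qed (use nonneg in auto)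
    let ?T = "\<lambda>\<omega>. (1 / real n) * (\<Sum>j\<in>?L. c j \<omega> - deriv (f ?k) (cav n u ?k {} j \<omega>))"
    have 3: "Ob n 2 1 c3 (\<lambda>\<omega>. g 0 \<omega> * ?T \<omega>)"
      unfolding c3_def
    proof (rule Ob_dominated)
      show "Ob n 2 1 (b\<^sup>2 * C2) (\<lambda>\<omega>. ?T \<omega>)"
      proof (rule Ob_average[OF _ cardL])
        fix j assume "j \<in> ?L"
        from C2(2)[OF n admj[OF this], of u]
        show "Ob n 2 1 (b\<^sup>2 * C2) (\<lambda>\<omega>. c j \<omega> - deriv (f ?k) (cav n u ?k {} j \<omega>))"
        proof (rule Ob_dominated)
          fix \<omega>
          have "\<bar>c j \<omega> - deriv (f ?k) (cav n u ?k {} j \<omega>)\<bar> \<le> B ?k * \<bar>cavd n u ?k {} i j \<omega>\<bar>"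
            unfolding c_def cavd_def
            using df_lipschitz[of ?k "cav n u ?k {} j \<omega>" "cav n u ?k {i} j \<omega>"] by (simp add: abs_minus_commute)
          also have "\<dots> \<le> b * \<bar>cavd n u ?k {} i j \<omega>\<bar>" by (intro mult_right_mono b) auto
          finally show "\<bar>c j \<omega> - deriv (f ?k) (cav n u ?k {} j \<omega>)\<bar> \<le> b * \<bar>cavd n u ?k {} i j \<omega>\<bar>" .
        qed (measurable, rule b0)
      qed (use C2 b0 in auto)
      fix \<omega>
      show "\<bar>g 0 \<omega> * ?T \<omega>\<bar>
        \<le> b * \<bar>?T \<omega>\<bar>"
        unfolding abs_mult[of "g 0 \<omega>"] by (intro mult_right_mono gb) auto
    qed (measurable, rule b0)
    \<comment> \<open>This term has two factors \<open>1 / sqrt n\<close>; one is estimated by 1,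
      the other gives the order.\<close>
    have "Ob n 2 0 c4 (\<lambda>\<omega>. (1 / sqrt (real n)) * (g 0 \<omega> * deriv (f ?k) (cav n u ?k {} i \<omega>)))"
      unfolding c4_def
    proof (rule Ob_bounded)
      fix \<omega>
      have "\<bar>deriv (f ?k) (cav n u ?k {} i \<omega>)\<bar> \<le> b"
        using df_bounded[of ?k] b[of ?k] by (meson lessI order_trans)
      then have "\<bar>g 0 \<omega> * deriv (f ?k) (cav n u ?k {} i \<omega>)\<bar> \<le> b * b"
        unfolding abs_mult by (intro mult_mono gb) (auto simp: b0)
      moreover have "1 / sqrt (real n) \<le> 1" using n by simp
      ultimately have "(1 / sqrt (real n)) * \<bar>g 0 \<omega> * deriv (f ?k) (cav n u ?k {} i \<omega>)\<bar> \<le> 1 * (b * b)"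
        by (intro mult_mono) auto
      then show "\<bar>(1 / sqrt (real n)) * (g 0 \<omega> * deriv (f ?k) (cav n u ?k {} i \<omega>))\<bar> \<le> b * b"
        by (simp add: abs_mult)
    qed measurable
    from Ob_scale[OF this n]
    have 4: "Ob n 2 1 c4 (\<lambda>\<omega>. (1 / sqrt (real n)) * ((1 / sqrt (real n)) * (g 0 \<omega> * deriv (f ?k) (cav n u ?k {} i \<omega>))))"
      by (simp only: One_nat_def)
    show ?thesis
      using Ob_diff[OF Ob_add[OF Ob_add[OF 1 2] 3] 4] unfolding E_def c_def g_def
      by (simp only: C_def Err_decomposition[OF n i, abs_def])
  qed
  then show ?thesis using nonneg by blast
qed

end

subsection \<open>The operator norm\<close>

definition bil :: "nat \<Rightarrow> (nat \<Rightarrow> nat \<Rightarrow> real) \<Rightarrow> (nat \<Rightarrow> real) \<Rightarrow> (nat \<Rightarrow> real) \<Rightarrow> real" where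
  "bil n a x y = (\<Sum>i\<in>{1..n}. \<Sum>j\<in>{1..n}. x i * a i j * y j)"

lemma bil_add_left: "bil n a (\<lambda>i. x i + x' i) y = bil n a x y + bil n a x' y"
  by (simp add: bil_def algebra_simps sum.distrib)

lemma bil_add_right: "bil n a x (\<lambda>i. y i + y' i) = bil n a x y + bil n a x y'"
  by (simp add: bil_def algebra_simps sum.distrib)

lemma bil_scale_left: "bil n a (\<lambda>i. c * x i) y = c * bil n a x y"
  by (simp add: bil_def sum_distrib_left mult_ac)

lemma bil_scale_right: "bil n a x (\<lambda>i. c * y i) = c * bil n a x y"
  by (simp add: bil_def sum_distrib_left mult_ac)

lemma bil_sym:
  assumes "\<And>i j. i \<in> {1..n} \<Longrightarrow> j \<in> {1..n} \<Longrightarrow> a i j = a j i"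
  shows "bil n a x y = bil n a y x"
proof -
  have "bil n a x y = (\<Sum>j\<in>{1..n}. \<Sum>i\<in>{1..n}. x i * a i j * y j)"
    unfolding bil_def by (rule sum.swap)
  also have "\<dots> = bil n a y x"
    unfolding bil_def using assms by (intro sum.cong refl) (simp add: mult_ac)
  finally show ?thesis .
qed

text \<open>Polarisation with s x + y / s and s x - y / s, where s^2 = t; the weight
  \<open>t\<close> balances arguments of different norms.\<close>

lemma bil_polarization:
  assumes sym: "\<And>i j. i \<in> {1..n} \<Longrightarrow> j \<in> {1..n} \<Longrightarrow> a i j = a j i"
    and q: "\<And>x. \<bar>bil n a x x\<bar> \<le> K * (\<Sum>i\<in>{1..n}. (x i)\<^sup>2)" and t: "t > 0"
  shows "\<bar>bil n a x y\<bar> \<le> K / 2 * (t * (\<Sum>i\<in>{1..n}. (x i)\<^sup>2) + (\<Sum>i\<in>{1..n}. (y i)\<^sup>2) / t)"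
proof -
  define s where "s = sqrt t"
  have s: "s > 0" "s\<^sup>2 = t" using t by (auto simp: s_def)
  let ?p = "\<lambda>i. s * x i + (1 / s) * y i" and ?m = "\<lambda>i. s * x i + (- 1 / s) * y i"
  have "bil n a ?p ?p - bil n a ?m ?m = 4 * bil n a x y"
    using s bil_sym[of n a y x, OF sym]
    by (simp only: bil_add_left bil_add_right bil_scale_left bil_scale_right) (simp add: field_simps)
  then have "4 * \<bar>bil n a x y\<bar> \<le> \<bar>bil n a ?p ?p\<bar> + \<bar>bil n a ?m ?m\<bar>" by linarith
  also have "\<dots> \<le> K * (\<Sum>i\<in>{1..n}. (?p i)\<^sup>2) + K * (\<Sum>i\<in>{1..n}. (?m i)\<^sup>2)"
    by (intro add_mono q)
  also have "\<dots> = K * (\<Sum>i\<in>{1..n}. (?p i)\<^sup>2 + (?m i)\<^sup>2)" by (simp only: distrib_left sum.distrib)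
  also have "(\<Sum>i\<in>{1..n}. (?p i)\<^sup>2 + (?m i)\<^sup>2) = (\<Sum>i\<in>{1..n}. 2 * (t * (x i)\<^sup>2 + (y i)\<^sup>2 / t))"
  proof (rule sum.cong[OF refl])
    fix i
    have "(p + r)\<^sup>2 + (p + - r)\<^sup>2 = 2 * (p\<^sup>2 + r\<^sup>2)" for p r :: real by algebra
    from this[of "s * x i" "(1 / s) * y i"]
    show "(?p i)\<^sup>2 + (?m i)\<^sup>2 = 2 * (t * (x i)\<^sup>2 + (y i)\<^sup>2 / t)"
      by (simp add: power_mult_distrib power_divide s)
  qed
  also have "\<dots> = 2 * (t * (\<Sum>i\<in>{1..n}. (x i)\<^sup>2) + (\<Sum>i\<in>{1..n}. (y i)\<^sup>2) / t)"
    by (simp only: sum_distrib_left[symmetric] sum.distrib sum_divide_distrib[symmetric])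
  finally have "4 * \<bar>bil n a x y\<bar> \<le> 4 * (K / 2 * (t * (\<Sum>i\<in>{1..n}. (x i)\<^sup>2) + (\<Sum>i\<in>{1..n}. (y i)\<^sup>2) / t))"
    by (simp only: mult.left_commute[of K] times_divide_eq_left times_divide_eq_right) simp
  then show ?thesis by linarith
qed

text \<open>Testing the form against the image \<open>w\<close> of \<open>x\<close>, with weight
  \<open>1 / K\<close>, bounds the squared norm of \<open>w\<close> by half of itself plus
  \<open>K\<^sup>2 / 2\<close> times that of \<open>x\<close>.\<close>

lemma bil_le_imp_norm_le:
  assumes sym: "\<And>i j. i \<in> {1..n} \<Longrightarrow> j \<in> {1..n} \<Longrightarrow> a i j = a j i"
    and q: "\<And>x. \<bar>bil n a x x\<bar> \<le> K * (\<Sum>i\<in>{1..n}. (x i)\<^sup>2)" and K: "K > 0"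
  shows "(\<Sum>i\<in>{1..n}. (\<Sum>j\<in>{1..n}. a i j * x j)\<^sup>2) \<le> K\<^sup>2 * (\<Sum>i\<in>{1..n}. (x i)\<^sup>2)"
proof -
  define w where "w i = (\<Sum>j\<in>{1..n}. a i j * x j)" for i
  let ?W = "\<Sum>i\<in>{1..n}. (w i)\<^sup>2"
  have "?W = bil n a w x"
    by (simp add: bil_def w_def power2_eq_square sum_distrib_left mult.assoc)
  also have "\<dots> \<le> K / 2 * ((1 / K) * ?W + (\<Sum>i\<in>{1..n}. (x i)\<^sup>2) / (1 / K))"
    using bil_polarization[of n a K "1 / K" w x, OF sym q] K by (simp only: abs_le_iff) simp
  also have "\<dots> = ?W / 2 + K\<^sup>2 * (\<Sum>i\<in>{1..n}. (x i)\<^sup>2) / 2"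
    using K by (simp add: field_simps power2_eq_square)
  finally show ?thesis by (simp add: w_def)
qed

text \<open>
  The half-integer vectors form a net of the ball of radius \<open>sqrt n\<close>: rounding \<open>2 x\<close> to an integer
  vector moves \<open>x\<close> by at most a quarter of that radius, and the loss is absorbed in the supremum.
\<close>

lemma bil_bound_from_integer_net:
  assumes n: "n \<ge> 1"
    and sym: "\<And>i j. i \<in> {1..n} \<Longrightarrow> j \<in> {1..n} \<Longrightarrow> a i j = a j i"
    and net: "\<And>z :: nat \<Rightarrow> int. (\<Sum>i\<in>{1..n}. (z i)\<^sup>2) \<le> 7 * int n \<Longrightarrow>
        \<bar>bil n a (\<lambda>i. of_int (z i)) (\<lambda>i. of_int (z i))\<bar> \<le> K * n"
    and K: "K \<ge> 0"
  shows "\<bar>bil n a x x\<bar> \<le> K * (\<Sum>i\<in>{1..n}. (x i)\<^sup>2)"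
proof -
  let ?N = "\<lambda>x :: nat \<Rightarrow> real. \<Sum>i\<in>{1..n}. (x i)\<^sup>2"
  define V where "V = {\<bar>bil n a x x\<bar> | x. ?N x \<le> n}"
  define R where "R = Sup V"
  have coord: "\<bar>x i\<bar> \<le> sqrt n" if "?N x \<le> n" "i \<in> {1..n}" for x :: "nat \<Rightarrow> real" and i
  proof -
    have "(x i)\<^sup>2 \<le> ?N x" using that by (intro member_le_sum) auto
    then show ?thesis using that by (intro real_le_rsqrt) simp
  qed
  \<comment> \<open>Finiteness of the supremum is what later allows a multiple of \<open>R\<close>
    to be absorbed.\<close>
  have bdd: "bdd_above V"
  proof (rule bdd_aboveI)
    fix v assume "v \<in> V"
    then obtain x where x: "v = \<bar>bil n a x x\<bar>" "?N x \<le> n" by (auto simp: V_def)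
    have "v \<le> (\<Sum>i\<in>{1..n}. \<Sum>j\<in>{1..n}. \<bar>x i * a i j * x j\<bar>)"
      unfolding x bil_def by (rule order_trans[OF sum_abs]) (intro sum_mono sum_abs)
    also have "\<dots> \<le> (\<Sum>i\<in>{1..n}. \<Sum>j\<in>{1..n}. sqrt n * \<bar>a i j\<bar> * sqrt n)"
      unfolding abs_mult using x by (intro sum_mono mult_mono coord) auto
    finally show "v \<le> (\<Sum>i\<in>{1..n}. \<Sum>j\<in>{1..n}. sqrt n * \<bar>a i j\<bar> * sqrt n)" .
  qed
  have R_ge: "\<bar>bil n a x x\<bar> \<le> R" if "?N x \<le> n" for x
    unfolding R_def using that by (intro cSup_upper bdd) (auto simp: V_def)
  have R0: "R \<ge> 0" using R_ge[of "\<lambda>_. 0"] abs_ge_zero order_trans by fastforce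
  have R_hom: "\<bar>bil n a x x\<bar> \<le> (R / n) * ?N x" for x
  proof (cases "?N x = 0")
    case True
    then have "\<forall>i\<in>{1..n}. x i = 0" by (subst (asm) sum_nonneg_eq_0_iff) auto
    then have "bil n a x x = 0" by (simp add: bil_def)
    then show ?thesis using True by simp
  next
    case False
    then have pos: "?N x > 0" by (simp add: order_less_le sum_nonneg)
    define c where "c = sqrt (n / ?N x)"
    have c2: "c\<^sup>2 = n / ?N x" using pos by (simp add: c_def)
    have "?N (\<lambda>i. c * x i) = c\<^sup>2 * ?N x" by (simp add: power_mult_distrib sum_distrib_left)
    then have "?N (\<lambda>i. c * x i) \<le> n" using pos c2 by simp
    from R_ge[OF this] have "c\<^sup>2 * \<bar>bil n a x x\<bar> \<le> R"
      by (simp add: bil_scale_left bil_scale_right power2_eq_square abs_mult mult.assoc)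
    then show ?thesis unfolding c2 using pos n by (simp add: field_simps)
  qed
  have step: "\<bar>bil n a x x\<bar> \<le> K * n / 4 + (29 / 50) * R" if x: "?N x \<le> n" for x
  proof -
    define z where "z i = round (2 * x i)" for i
    define y where "y i = of_int (z i) / (2 :: real)" for i
    define e where "e i = x i - y i" for i
    have e_bound: "(e i)\<^sup>2 \<le> 1 / 16" for i
    proof -
      have "\<bar>of_int (z i) - 2 * x i\<bar> \<le> 1 / 2" unfolding z_def by (rule of_int_round_abs_le)
      then have "\<bar>e i\<bar> \<le> 1 / 4" unfolding e_def y_def by linarith
      then have "\<bar>e i\<bar>\<^sup>2 \<le> (1 / 4)\<^sup>2" by (intro power_mono) auto
      then show ?thesis by (simp add: power_divide)
    qed
    have Ne: "?N e \<le> n / 16"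
    proof -
      have "?N e \<le> (\<Sum>i\<in>{1..n}. 1 / 16 :: real)" by (intro sum_mono e_bound)
      then show ?thesis by simp
    qed
    \<comment> \<open>The radius comes from 5 + 20 / 16 < 7.\<close>
    have Nz: "(\<Sum>i\<in>{1..n}. (z i)\<^sup>2) \<le> 7 * int n"
    proof -
      have "(real_of_int (z i))\<^sup>2 \<le> 5 * (x i)\<^sup>2 + 20 * (e i)\<^sup>2" for i
      proof -
        have zi: "real_of_int (z i) = 2 * (x i - e i)" by (simp add: e_def y_def)
        have "5 * (x i)\<^sup>2 + 20 * (e i)\<^sup>2 - (real_of_int (z i))\<^sup>2 = (x i + 4 * e i)\<^sup>2"
          unfolding zi by algebra
        then have "0 \<le> 5 * (x i)\<^sup>2 + 20 * (e i)\<^sup>2 - (real_of_int (z i))\<^sup>2"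
          by (simp only: zero_le_power2)
        then show ?thesis by linarith
      qed
      then have "(\<Sum>i\<in>{1..n}. (real_of_int (z i))\<^sup>2) \<le> (\<Sum>i\<in>{1..n}. 5 * (x i)\<^sup>2 + 20 * (e i)\<^sup>2)"
        by (intro sum_mono)
      also have "\<dots> = 5 * ?N x + 20 * ?N e" by (simp only: sum.distrib sum_distrib_left)
      also have "\<dots> \<le> 7 * real n" using x Ne by linarith
      finally have "real_of_int (\<Sum>i\<in>{1..n}. (z i)\<^sup>2) \<le> real_of_int (7 * int n)" by simp
      then show ?thesis by (simp only: of_int_le_iff)
    qed
    have qy: "\<bar>bil n a y y\<bar> \<le> K * n / 4"
    proof -
      have "y = (\<lambda>i. (1 / 2) * of_int (z i))" by (simp add: y_def fun_eq_iff)
      then have "bil n a y y = (1 / 4) * bil n a (\<lambda>i. of_int (z i)) (\<lambda>i. of_int (z i))"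
        by (simp only: bil_scale_left bil_scale_right)
      then show ?thesis using net[OF Nz] by (simp add: abs_mult)
    qed
    define v where "v i = x i + y i" for i
    have Nv: "?N v \<le> 5 * n + 5 * n / 16"
    proof -
      have "(v i)\<^sup>2 \<le> 5 * (x i)\<^sup>2 + 5 * (e i)\<^sup>2" for i
      proof -
        have vi: "v i = 2 * x i - e i" by (simp add: v_def e_def)
        have "5 * (x i)\<^sup>2 + 5 * (e i)\<^sup>2 - (v i)\<^sup>2 = (x i + 2 * e i)\<^sup>2"
          unfolding vi by algebra
        then have "0 \<le> 5 * (x i)\<^sup>2 + 5 * (e i)\<^sup>2 - (v i)\<^sup>2"
          by (simp only: zero_le_power2)
        then show ?thesis by linarith
      qed
      then have "?N v \<le> (\<Sum>i\<in>{1..n}. 5 * (x i)\<^sup>2 + 5 * (e i)\<^sup>2)" by (intro sum_mono)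
      also have "\<dots> = 5 * ?N x + 5 * ?N e" by (simp only: sum.distrib sum_distrib_left)
      finally show ?thesis using x Ne by linarith
    qed
    \<comment> \<open>By symmetry the quadratic forms at x and y differ by the bilinear form at x -
      y and x + y.\<close>
    have "bil n a x x = bil n a y y + bil n a e v"
    proof -
      have xe: "x = (\<lambda>i. y i + e i)" and ve: "v = (\<lambda>i. (y i + e i) + y i)"
        by (simp_all add: e_def v_def fun_eq_iff)
      have "bil n a (\<lambda>i. y i + e i) (\<lambda>i. y i + e i) = bil n a y y + bil n a e (\<lambda>i. (y i + e i) + y i)"
        unfolding bil_add_left bil_add_right using bil_sym[of n a y e, OF sym] by linarith
      then show ?thesis by (simp only: xe[symmetric] ve)
    qed
    \<comment> \<open>The weight 9 is close to sqrt 85, the ratio of the norm bounds of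
      \<open>v\<close> and \<open>e\<close>. It yields (9 / 16 + 85 / 144) / 2 < 29 / 50, and 29 /
      50 + 1 / 4 < 1 leaves room for the absorption.\<close>
    moreover have "\<bar>bil n a e v\<bar> \<le> (R / n) / 2 * (9 * ?N e + ?N v / 9)"
      by (rule bil_polarization[OF sym R_hom]) auto
    moreover have "(R / n) / 2 * (9 * ?N e + ?N v / 9) \<le> (R / n) / 2 * (9 * (n / 16) + (5 * n + 5 * n / 16) / 9)"
      using R0 Ne Nv by (intro mult_left_mono add_mono divide_right_mono) auto
    moreover have "(R / n) / 2 * (9 * (n / 16) + (5 * n + 5 * n / 16) / 9) \<le> (29 / 50) * R"
      using n R0 by (simp add: field_simps)
    ultimately show ?thesis using qy by linarith
  qed
  have "R \<le> K * n / 4 + (29 / 50) * R"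
    unfolding R_def
  proof (rule cSup_least)
    show "V \<noteq> {}" unfolding V_def by (auto intro!: exI[of _ "\<lambda>_. 0"])
  qed (use step in \<open>auto simp: V_def R_def\<close>)
  moreover have "0 \<le> K * n" using K by simp
  ultimately have "R \<le> K * n" by linarith
  then have "R / n \<le> K" using n by (simp add: field_simps)
  then have "(R / n) * ?N x \<le> K * ?N x" by (intro mult_right_mono sum_nonneg) auto
  then show ?thesis using R_hom[of x] by linarith
qed

section \<open>Exponential moments of the form on the integer net\<close>

lemma sum_offdiag:
  fixes g :: "nat \<Rightarrow> nat \<Rightarrow> real"
  assumes sym: "\<And>i j. g i j = g j i" and diag: "\<And>i. g i i = 0"
  shows "(\<Sum>i\<in>{1..n}. \<Sum>j\<in>{1..n}. g i j) = 2 * (\<Sum>(i, j)\<in>strict_upper_pairs n. g i j)"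
proof -
  let ?E = "strict_upper_pairs n"
  let ?E' = "prod.swap ` ?E"
  have "(\<Sum>i\<in>{1..n}. \<Sum>j\<in>{1..n}. g i j) = (\<Sum>(i, j)\<in>{1..n} \<times> {1..n}. g i j)"
    by (rule sum.cartesian_product)
  also have "\<dots> = (\<Sum>(i, j)\<in>?E \<union> ?E'. g i j)"
  proof (rule sum.mono_neutral_right)
    show "\<forall>p\<in>{1..n} \<times> {1..n} - (?E \<union> ?E'). (case p of (i, j) \<Rightarrow> g i j) = 0"
    proof
      fix p assume p: "p \<in> {1..n} \<times> {1..n} - (?E \<union> ?E')"
      obtain i j where ij: "p = (i, j)" by (cases p)
      have "(j, i) \<notin> ?E" using p ij by (auto intro: image_eqI[of _ _ "(j, i)"])
      then have "i = j" using p ij by (auto simp: strict_upper_pairs_def)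
      then show "(case p of (i, j) \<Rightarrow> g i j) = 0" by (simp add: diag ij)
    qed
  qed (auto simp: strict_upper_pairs_def)
  also have "\<dots> = (\<Sum>(i, j)\<in>?E. g i j) + (\<Sum>(i, j)\<in>?E'. g i j)"
    by (rule sum.union_disjoint) (simp, simp, auto simp: strict_upper_pairs_def)
  also have "(\<Sum>(i, j)\<in>?E'. g i j) = (\<Sum>(i, j)\<in>?E. g i j)"
    by (subst sum.reindex) (auto intro!: sum.cong simp: sym)
  finally show ?thesis by simp
qed

lemma bil_ent:
  "bil n (\<lambda>i j. ent n i j \<omega>) x x = (\<Sum>e\<in>strict_upper_pairs n. 2 * (x (fst e) * x (snd e)) * \<omega> e)"
proof -
  have "bil n (\<lambda>i j. ent n i j \<omega>) x x = 2 * (\<Sum>(i, j)\<in>strict_upper_pairs n. x i * ent n i j \<omega> * x j)"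
    unfolding bil_def by (rule sum_offdiag) (simp_all add: ent_sym[of n] mult_ac)
  also have "(\<Sum>(i, j)\<in>strict_upper_pairs n. x i * ent n i j \<omega> * x j)
      = (\<Sum>e\<in>strict_upper_pairs n. (x (fst e) * x (snd e)) * \<omega> e)"
    by (intro sum.cong refl) (auto simp: strict_upper_pairs_def ent_def)
  finally show ?thesis by (simp add: sum_distrib_left mult_ac)
qed

text \<open>The box contains all integer points of the ball, since |z_i| \<le> z_i^2 \<le> 7 n; it
  makes the set finite and is a product set, which the counting exploits. The extensional function
  space gives each point a single representative.\<close>

definition int_net :: "nat \<Rightarrow> (nat \<Rightarrow> int) set" where
  "int_net n = {z \<in> {1..n} \<rightarrow>\<^sub>E {- int (7 * n)..int (7 * n)}. (\<Sum>i\<in>{1..n}. (z i)\<^sup>2) \<le> 7 * int n}"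

lemma finite_int_net [simp]: "finite (int_net n)"
proof (rule finite_subset)
  show "int_net n \<subseteq> {1..n} \<rightarrow>\<^sub>E {- int (7 * n)..int (7 * n)}" unfolding int_net_def by blast
qed (intro finite_PiE finite_atLeastAtMost finite_atLeastAtMost_int)

lemma int_interval_Suc:
  fixes M :: int assumes "M \<ge> 0"
  shows "{- (M + 1)..M + 1} = insert (M + 1) (insert (- (M + 1)) {- M..M})"
proof (rule set_eqI)
  fix x show "x \<in> {- (M + 1)..M + 1} \<longleftrightarrow> x \<in> insert (M + 1) (insert (- (M + 1)) {- M..M})"
    unfolding atLeastAtMost_iff insert_iff using assms by linarith
qed

lemma sum_half_powers:
  "(\<Sum>k\<in>{- int m..int m}. (1 / 2 :: real) ^ nat \<bar>k\<bar>) = 3 - 2 * (1 / 2) ^ m"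
proof (induction m)
  case 0
  show ?case by simp
next
  case (Suc m)
  let ?g = "\<lambda>k :: int. (1 / 2 :: real) ^ nat \<bar>k\<bar>"
  let ?M = "int m"
  have n1: "?M + 1 \<notin> insert (- (?M + 1)) {- ?M..?M}" "- (?M + 1) \<notin> {- ?M..?M}" by auto
  have "sum ?g {- int (Suc m)..int (Suc m)} = sum ?g {- (?M + 1)..?M + 1}"
    by (simp only: of_nat_Suc add.commute)
  also have "\<dots> = ?g (?M + 1) + (?g (- (?M + 1)) + sum ?g {- ?M..?M})"
    using n1 by (simp only: int_interval_Suc[of ?M, OF of_nat_0_le_iff] sum.insert finite_insert finite_atLeastAtMost_int) simp
  also have "nat \<bar>?M + 1\<bar> = Suc m" by simp
  also have "nat \<bar>- (?M + 1)\<bar> = Suc m" by simp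
  finally show ?case using Suc by simp
qed

lemma abs_int_le_square: "\<bar>k\<bar> \<le> k\<^sup>2" for k :: int
proof (cases "k = 0")
  case False
  then have "\<bar>k\<bar> * 1 \<le> \<bar>k\<bar> * \<bar>k\<bar>" by (intro mult_left_mono) auto
  then show ?thesis by (simp add: power2_eq_square)
qed simp

text \<open>Dominates the theta series by a geometric one, whose two-sided sum is at most 3.\<close>

lemma exp_neg_square_le: "exp (- (real_of_int k)\<^sup>2) \<le> (1 / 2) ^ nat \<bar>k\<bar>"
proof -
  have "\<bar>k\<bar> \<le> k\<^sup>2" by (rule abs_int_le_square)
  then have 1: "real (nat \<bar>k\<bar>) \<le> (real_of_int k)\<^sup>2"
    by (metis nat_0_le abs_ge_zero of_int_le_iff of_int_of_nat_eq of_int_power)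
  have "exp (- (real_of_int k)\<^sup>2) \<le> exp (real (nat \<bar>k\<bar>) * (- 1))" using 1 by simp
  also have "\<dots> = exp (- 1) ^ nat \<bar>k\<bar>" by (rule exp_of_nat_mult)
  also have "\<dots> \<le> (1 / 2) ^ nat \<bar>k\<bar>"
  proof (rule power_mono)
    have "2 \<le> exp (1 :: real)" using exp_ge_add_one_self[of "1 :: real"] by simp
    then show "exp (- 1 :: real) \<le> 1 / 2" by (simp add: exp_minus field_simps)
  qed simp
  finally show ?thesis .
qed

text \<open>Integer points of a ball are counted by means of the theta series \<open>\<Sum>k. exp (- k\<^sup>2)\<close>.\<close>

lemma card_int_net: "real (card (int_net n)) \<le> exp (9 * real n)"
proof -
  let ?I = "{- int (7 * n)..int (7 * n)}"
  have "real (card (int_net n)) = (\<Sum>z\<in>int_net n. 1)" by simp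
  \<comment> \<open>On the net the exponential weight is at least 1. Over the full box the sum
    factorises into one theta sum per coordinate, each at most \<open>3 \<le> exp 2\<close>; hence
    the exponent 9 = 7 + 2.\<close>
  also have "\<dots> \<le> (\<Sum>z\<in>int_net n. exp (7 * real n) * (\<Prod>i\<in>{1..n}. exp (- (real_of_int (z i))\<^sup>2)))"
  proof (rule sum_mono)
    fix z assume "z \<in> int_net n"
    then have "real_of_int (\<Sum>i\<in>{1..n}. (z i)\<^sup>2) \<le> real_of_int (7 * int n)"
      unfolding int_net_def by (simp only: of_int_le_iff mem_Collect_eq)
    then have "1 \<le> exp (7 * real n - (\<Sum>i\<in>{1..n}. (real_of_int (z i))\<^sup>2))" by simp
    also have "\<dots> = exp (7 * real n) * (\<Prod>i\<in>{1..n}. exp (- (real_of_int (z i))\<^sup>2))"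
      by (simp only: exp_sum[symmetric] finite_atLeastAtMost exp_add[symmetric]) (simp add: sum_negf)
    finally show "1 \<le> exp (7 * real n) * (\<Prod>i\<in>{1..n}. exp (- (real_of_int (z i))\<^sup>2))" .
  qed
  also have "\<dots> \<le> (\<Sum>z\<in>{1..n} \<rightarrow>\<^sub>E ?I. exp (7 * real n) * (\<Prod>i\<in>{1..n}. exp (- (real_of_int (z i))\<^sup>2)))"
    by (intro sum_mono2 finite_PiE) (auto simp: int_net_def intro!: mult_nonneg_nonneg prod_nonneg)
  also have "\<dots> = exp (7 * real n) * (\<Prod>i\<in>{1..n}. \<Sum>k\<in>?I. exp (- (real_of_int k)\<^sup>2))"
    by (subst prod_sum_PiE) (auto simp: sum_distrib_left)
  also have "\<dots> \<le> exp (7 * real n) * (\<Prod>i\<in>{1..n}. 3)"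
  proof (intro mult_left_mono prod_mono conjI)
    have "(\<Sum>k\<in>?I. exp (- (real_of_int k)\<^sup>2)) \<le> (\<Sum>k\<in>?I. (1 / 2) ^ nat \<bar>k\<bar>)"
      by (intro sum_mono exp_neg_square_le)
    also have "\<dots> = 3 - 2 * (1 / 2) ^ (7 * n)" by (rule sum_half_powers)
    also have "\<dots> \<le> 3" by simp
    finally show "(\<Sum>k\<in>?I. exp (- (real_of_int k)\<^sup>2)) \<le> 3" .
  qed (auto intro!: sum_nonneg)
  also have "(\<Prod>i\<in>{1..n}. 3 :: real) \<le> exp 2 ^ n"
  proof -
    have "(3 :: real) \<le> exp 2" using exp_ge_add_one_self[of "2 :: real"] by simp
    then show ?thesis by (simp add: power_mono)
  qed
  finally show ?thesis by (simp add: exp_of_nat_mult[symmetric] exp_add[symmetric])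
qed

text \<open>Union bound and Chernoff bound packed into one nonnegative variable: it is at least 1 as
  soon as the form divided by \<open>sqrt n\<close> reaches \<open>60 * n\<close> in absolute value
  at some net point. It dominates the indicator of a large operator norm, so that no event has to be
  measured.\<close>

definition tail_weight :: "nat \<Rightarrow> (nat \<times> nat \<Rightarrow> real) \<Rightarrow> real" where
  "tail_weight n \<omega> = (\<Sum>z\<in>int_net n. \<Sum>s\<in>{-1, 1}.
     exp (s / sqrt (real n) * bil n (\<lambda>i j. ent n i j \<omega>) (\<lambda>i. of_int (z i)) (\<lambda>i. of_int (z i)) - 60 * real n))"

lemma tail_weight_nonneg: "tail_weight n \<omega> \<ge> 0"
  unfolding tail_weight_def by (intro sum_nonneg) auto

lemma bil_ent_measurable [measurable]:
  "(\<lambda>\<omega>. bil n (\<lambda>i j. ent n i j \<omega>) x y) \<in> borel_measurable (goe n)"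
  unfolding bil_def by measurable

lemma tail_weight_measurable [measurable]: "tail_weight n \<in> borel_measurable (goe n)"
  unfolding tail_weight_def[abs_def] by measurable

text \<open>An exponential moment is at most \<open>exp (49 * n)\<close>, and net points and signs
  number at most \<open>2 * exp (9 * n)\<close>, so the level 60 leaves
  \<open>2 * exp (- 2 * n) \<le> exp (- n)\<close>.\<close>

lemma tail_weight_integral:
  assumes n: "n \<ge> 1"
  shows "(\<integral>\<^sup>+ \<omega>. ennreal (tail_weight n \<omega>) \<partial>goe n) \<le> ennreal (exp (- real n))"
proof -
  let ?q = "\<lambda>z \<omega>. bil n (\<lambda>i j. ent n i j \<omega>) (\<lambda>i. of_int (z i)) (\<lambda>i. of_int (z i))"
  have single: "(\<integral>\<^sup>+ \<omega>. ennreal (exp (s / sqrt (real n) * ?q z \<omega> - 60 * real n)) \<partial>goe n) \<le> ennreal (exp (- 11 * real n))"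
    if z: "z \<in> int_net n" and s: "s\<^sup>2 = 1" for z and s :: real
  proof -
    define c where "c e = s / sqrt (real n) * (2 * (of_int (z (fst e)) * of_int (z (snd e))))" for e
    have "(\<integral>\<^sup>+ \<omega>. ennreal (exp (s / sqrt (real n) * ?q z \<omega> - 60 * real n)) \<partial>goe n)
      = (\<integral>\<^sup>+ \<omega>. ennreal (exp (- 60 * real n)) * ennreal (exp (\<Sum>e\<in>strict_upper_pairs n. c e * \<omega> e)) \<partial>goe n)"
    proof (rule nn_integral_cong)
      fix \<omega>
      have "s / sqrt (real n) * ?q z \<omega> = (\<Sum>e\<in>strict_upper_pairs n. c e * \<omega> e)"
        unfolding bil_ent c_def by (simp add: sum_distrib_left mult_ac)
      then show "ennreal (exp (s / sqrt (real n) * ?q z \<omega> - 60 * real n)) = ennreal (exp (- 60 * real n)) * ennreal (exp (\<Sum>e\<in>strict_upper_pairs n. c e * \<omega> e))"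
        by (simp add: ennreal_mult[symmetric] exp_add[symmetric])
    qed
    also have "\<dots> = ennreal (exp (- 60 * real n)) * ennreal (exp ((\<Sum>e\<in>strict_upper_pairs n. (c e)\<^sup>2) / 2))"
      by (subst nn_integral_cmult) (auto simp: nn_integral_gauss_PiM_exp)
    also have "\<dots> \<le> ennreal (exp (- 60 * real n)) * ennreal (exp (49 * real n))"
    proof (intro mult_left_mono ennreal_leI)
      define Z where "Z = (\<Sum>i\<in>{1..n}. (real_of_int (z i))\<^sup>2)"
      have "real_of_int (\<Sum>i\<in>{1..n}. (z i)\<^sup>2) \<le> real_of_int (7 * int n)"
        using z unfolding int_net_def by (simp only: of_int_le_iff mem_Collect_eq)
      then have Z: "Z \<le> 7 * n" "Z \<ge> 0" by (auto simp: Z_def intro: sum_nonneg)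
      \<comment> \<open>Half the variance, written as a sum over ordered pairs, is at most Z^2 / n;
        then Z \<le> 7 n gives 49 n.\<close>
      have "(\<Sum>e\<in>strict_upper_pairs n. (c e)\<^sup>2) / 2
          = (1 / n) * (2 * (\<Sum>(i, j)\<in>strict_upper_pairs n. if i = j then 0 else (real_of_int (z i))\<^sup>2 * (real_of_int (z j))\<^sup>2))"
        unfolding sum_divide_distrib sum_distrib_left
        by (intro sum.cong refl)
          (auto simp: c_def power_mult_distrib power_divide s strict_upper_pairs_def)
      also have "2 * (\<Sum>(i, j)\<in>strict_upper_pairs n. if i = j then 0 else (real_of_int (z i))\<^sup>2 * (real_of_int (z j))\<^sup>2)
          = (\<Sum>i\<in>{1..n}. \<Sum>j\<in>{1..n}. if i = j then 0 else (real_of_int (z i))\<^sup>2 * (real_of_int (z j))\<^sup>2)"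
        by (rule sum_offdiag[symmetric]) (auto simp: mult_ac)
      also have "(1 / n) * \<dots> \<le> (1 / n) * (\<Sum>i\<in>{1..n}. \<Sum>j\<in>{1..n}. (real_of_int (z i))\<^sup>2 * (real_of_int (z j))\<^sup>2)"
        by (intro mult_left_mono sum_mono) auto
      also have "\<dots> = (1 / n) * (Z * Z)"
        by (simp add: Z_def sum_product)
      also have "\<dots> \<le> (1 / n) * ((7 * real n) * (7 * real n))"
        using Z by (intro mult_left_mono mult_mono) auto
      also have "\<dots> = 49 * real n" using n by simp
      finally show "exp ((\<Sum>e\<in>strict_upper_pairs n. (c e)\<^sup>2) / 2) \<le> exp (49 * real n)" by simp
    qed auto
    also have "\<dots> = ennreal (exp (- 11 * real n))"
      by (simp add: ennreal_mult[symmetric] exp_add[symmetric])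
    finally show ?thesis .
  qed
  have "(\<integral>\<^sup>+ \<omega>. ennreal (tail_weight n \<omega>) \<partial>goe n)
    = (\<integral>\<^sup>+ \<omega>. (\<Sum>z\<in>int_net n. \<Sum>s\<in>{-1, 1}. ennreal (exp (s / sqrt (real n) * ?q z \<omega> - 60 * real n))) \<partial>goe n)"
    unfolding tail_weight_def by (intro nn_integral_cong) (simp add: sum_ennreal sum_nonneg ennreal_plus[symmetric] del: ennreal_plus)
  also have "\<dots> = (\<Sum>z\<in>int_net n. \<Sum>s\<in>{-1, 1}. \<integral>\<^sup>+ \<omega>. ennreal (exp (s / sqrt (real n) * ?q z \<omega> - 60 * real n)) \<partial>goe n)"
    by (subst nn_integral_sum, measurable, intro sum.cong refl, subst nn_integral_sum) auto
  also have "\<dots> \<le> (\<Sum>z\<in>int_net n. \<Sum>s\<in>{-1, 1 :: real}. ennreal (exp (- 11 * real n)))"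
    by (intro sum_mono single) auto
  also have "\<dots> = ennreal (\<Sum>z\<in>int_net n. \<Sum>s\<in>{-1, 1 :: real}. exp (- 11 * real n))"
    by (simp only: sum_ennreal exp_ge_zero sum_nonneg)
  also have "\<dots> \<le> ennreal (exp (- real n))"
  proof (rule ennreal_leI)
    have "(\<Sum>z\<in>int_net n. \<Sum>s\<in>{-1, 1 :: real}. exp (- 11 * real n)) = 2 * real (card (int_net n)) * exp (- 11 * real n)"
      by simp
    also have "\<dots> \<le> exp 1 * exp (9 * real n) * exp (- 11 * real n)"
      using exp_ge_add_one_self[of "1 :: real"] card_int_net[of n] by (intro mult_right_mono mult_mono) auto
    also have "\<dots> = exp (1 - 2 * real n)" by (simp add: exp_add[symmetric])
    also have "\<dots> \<le> exp (- real n)" using n by simp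
    finally show "(\<Sum>z\<in>int_net n. \<Sum>s\<in>{-1, 1 :: real}. exp (- 11 * real n)) \<le> exp (- real n)" .
  qed
  finally show ?thesis .
qed

definition op_norm_sq_le :: "nat \<Rightarrow> real \<Rightarrow> (nat \<times> nat \<Rightarrow> real) \<Rightarrow> bool" where
  "op_norm_sq_le n K \<omega> \<longleftrightarrow> (\<forall>x. (\<Sum>i\<in>{1..n}. ((1 / sqrt (real n)) * (\<Sum>j\<in>{1..n}. ent n i j \<omega> * x j))\<^sup>2)
    \<le> K * (\<Sum>i\<in>{1..n}. (x i)\<^sup>2))"

text \<open>If no net point triggers the weight, the quadratic form is at most
  \<open>60 * sqrt n\<close> times the squared norm; normalising by \<open>sqrt n\<close> and
  squaring gives 3600.\<close>

lemma norm_bound_or_tail_weight: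
  assumes n: "n \<ge> 1"
  shows "tail_weight n \<omega> \<ge> 1 \<or> op_norm_sq_le n 3600 \<omega>"
proof (cases "tail_weight n \<omega> \<ge> 1")
  case False
  let ?a = "\<lambda>i j. ent n i j \<omega>"
  let ?q = "\<lambda>z :: nat \<Rightarrow> int. bil n ?a (\<lambda>i. of_int (z i)) (\<lambda>i. of_int (z i))"
  have net: "\<bar>?q z\<bar> \<le> (60 * sqrt n) * n" if z: "(\<Sum>i\<in>{1..n}. (z i)\<^sup>2) \<le> 7 * int n" for z
  proof -
    \<comment> \<open>Restriction picks the representative in the extensional function space and
      leaves the form unchanged.\<close>
    define z' where "z' = restrict z {1..n}"
    have qz: "?q z' = ?q z" by (simp add: bil_def z'_def)
    have "z i \<in> {- int (7 * n)..int (7 * n)}" if "i \<in> {1..n}" for i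
    proof -
      have "\<bar>z i\<bar> \<le> (z i)\<^sup>2" by (rule abs_int_le_square)
      also have "\<dots> \<le> (\<Sum>i\<in>{1..n}. (z i)\<^sup>2)" using that by (intro member_le_sum) auto
      finally show ?thesis using z by auto
    qed
    then have z': "z' \<in> int_net n" using z by (auto simp: int_net_def z'_def)
    have le: "s / sqrt (real n) * ?q z \<le> 60 * real n" if s: "s \<in> {-1, 1}" for s :: real
    proof -
      have "exp (s / sqrt (real n) * ?q z' - 60 * real n) \<le> (\<Sum>s\<in>{-1, 1}. exp (s / sqrt (real n) * ?q z' - 60 * real n))"
        using s by (intro member_le_sum) auto
      also have "\<dots> \<le> tail_weight n \<omega>"
        unfolding tail_weight_def using z'
        by (intro member_le_sum[of z' _ "\<lambda>z. \<Sum>s\<in>{-1, 1}. exp (s / sqrt (real n) * ?q z - 60 * real n)"]) (auto intro: sum_nonneg)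
      also have "\<dots> < 1" using False by simp
      finally show ?thesis by (simp add: qz)
    qed
    have sn: "sqrt n > 0" using n by simp
    have "\<bar>?q z\<bar> / sqrt n \<le> 60 * real n" using le[of 1] le[of "-1"] by (auto simp: abs_if)
    then show ?thesis using sn by (simp add: divide_le_eq mult_ac)
  qed
  have q: "\<bar>bil n ?a x x\<bar> \<le> (60 * sqrt n) * (\<Sum>i\<in>{1..n}. (x i)\<^sup>2)" for x
    by (rule bil_bound_from_integer_net[OF n _ net]) (auto simp: ent_sym[of n])
  have "(\<Sum>i\<in>{1..n}. ((1 / sqrt (real n)) * (\<Sum>j\<in>{1..n}. ent n i j \<omega> * x j))\<^sup>2) \<le> 3600 * (\<Sum>i\<in>{1..n}. (x i)\<^sup>2)" for x
  proof -
    have "(\<Sum>i\<in>{1..n}. (\<Sum>j\<in>{1..n}. ?a i j * x j)\<^sup>2) \<le> (60 * sqrt n)\<^sup>2 * (\<Sum>i\<in>{1..n}. (x i)\<^sup>2)"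
      by (rule bil_le_imp_norm_le[OF _ q]) (use n in \<open>auto simp: ent_sym[of n]\<close>)
    also have "\<dots> = real n * (3600 * (\<Sum>i\<in>{1..n}. (x i)\<^sup>2))" by (simp add: power_mult_distrib)
    finally have "(\<Sum>i\<in>{1..n}. (\<Sum>j\<in>{1..n}. ?a i j * x j)\<^sup>2) / n \<le> 3600 * (\<Sum>i\<in>{1..n}. (x i)\<^sup>2)"
      using n by (simp add: divide_le_eq mult_ac)
    moreover have "((1 / sqrt (real n)) * y)\<^sup>2 = y\<^sup>2 / n" for y
      by (simp add: power_divide)
    ultimately show ?thesis by (simp only: sum_divide_distrib)
  qed
  then show ?thesis by (simp add: op_norm_sq_le_def)
qed simp

subsection \<open>Comparison of the two iterations\<close>

context smooth_nonlinearities
begin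

definition delta :: "nat \<Rightarrow> (nat \<Rightarrow> real) \<Rightarrow> nat \<Rightarrow> nat \<Rightarrow> (nat \<times> nat \<Rightarrow> real) \<Rightarrow> real" where
  "delta n u k i \<omega> = amp n (\<lambda>i j. ent n i j \<omega>) f u k i - cav n u k {} i \<omega>"

lemma delta_0: "delta n u 0 i \<omega> = 0"
  by (simp add: delta_def)

lemma delta_1:
  assumes "i \<in> {1..n}"
  shows "delta n u (Suc 0) i \<omega> = 0"
proof -
  have "(\<Sum>j\<in>{1..n} - {i}. ent n i j \<omega> * f 0 (u j)) = (\<Sum>j\<in>{1..n}. ent n i j \<omega> * f 0 (u j))"
    by (rule sum.mono_neutral_left) auto
  then show ?thesis by (simp add: delta_def cav_Suc)
qed

text \<open>The AMP step is evaluated at the cavity iterates plus \<open>delta\<close>.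
  \<open>Err\<close> is what is left for vanishing \<open>delta\<close>; the other three terms are
  controlled by \<open>delta\<close> at steps \<open>k + 1\<close> and \<open>k\<close>.\<close>

lemma delta_Suc_Suc:
  assumes i: "i \<in> {1..n}"
  shows "delta n u (Suc (Suc k)) i \<omega> =
    (1 / sqrt (real n)) * (\<Sum>j\<in>{1..n}. ent n i j \<omega> *
      (f (Suc k) (cav n u (Suc k) {} j \<omega> + delta n u (Suc k) j \<omega>) - f (Suc k) (cav n u (Suc k) {} j \<omega>)))
    + Err n u k i \<omega>
    + ((1 / real n) * (\<Sum>j\<in>{1..n}. deriv (f (Suc k)) (cav n u (Suc k) {} j \<omega>)
        - deriv (f (Suc k)) (cav n u (Suc k) {} j \<omega> + delta n u (Suc k) j \<omega>))) * f k (cav n u k {} i \<omega>)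
    + ((1 / real n) * (\<Sum>j\<in>{1..n}. deriv (f (Suc k)) (cav n u (Suc k) {} j \<omega> + delta n u (Suc k) j \<omega>)))
        * (f k (cav n u k {} i \<omega>) - f k (cav n u k {} i \<omega> + delta n u k i \<omega>))"
proof -
  let ?w = "\<lambda>j. cav n u (Suc k) {} j \<omega>" and ?d = "\<lambda>j. delta n u (Suc k) j \<omega>"
  have amp: "amp n (\<lambda>i j. ent n i j \<omega>) f u k j = cav n u k {} j \<omega> + delta n u k j \<omega>" for k j
    by (simp add: delta_def)
  have "(\<Sum>j\<in>{1..n} - {i}. ent n i j \<omega> * (f (Suc k) (?w j) - f (Suc k) (cav n u (Suc k) {i} j \<omega>)))
    = (\<Sum>j\<in>{1..n}. ent n i j \<omega> * f (Suc k) (?w j))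
      - (\<Sum>j\<in>{1..n} - {i}. ent n i j \<omega> * f (Suc k) (cav n u (Suc k) {i} j \<omega>))"
  proof -
    have "(\<Sum>j\<in>{1..n} - {i}. ent n i j \<omega> * f (Suc k) (?w j))
      = (\<Sum>j\<in>{1..n}. ent n i j \<omega> * f (Suc k) (?w j))"
      by (rule sum.mono_neutral_left) auto
    then show ?thesis by (simp only: right_diff_distrib sum_subtractf)
  qed
  then have Err: "Err n u k i \<omega> = (1 / sqrt (real n)) * (\<Sum>j\<in>{1..n}. ent n i j \<omega> * f (Suc k) (?w j))
      - (1 / sqrt (real n)) * (\<Sum>j\<in>{1..n} - {i}. ent n i j \<omega> * f (Suc k) (cav n u (Suc k) {i} j \<omega>))
     - ((1 / real n) * (\<Sum>j\<in>{1..n}. deriv (f (Suc k)) (?w j))) * f k (cav n u k {} i \<omega>)"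
    by (simp only: Err_def right_diff_distrib)
  have "delta n u (Suc (Suc k)) i \<omega> = (1 / sqrt (real n)) * (\<Sum>j\<in>{1..n}. ent n i j \<omega> * f (Suc k) (?w j + ?d j))
     - ((1 / real n) * (\<Sum>j\<in>{1..n}. deriv (f (Suc k)) (?w j + ?d j)))
         * f k (cav n u k {} i \<omega> + delta n u k i \<omega>)
     - (1 / sqrt (real n)) * (\<Sum>j\<in>{1..n} - {i}. ent n i j \<omega> * f (Suc k) (cav n u (Suc k) {i} j \<omega>))"
    unfolding delta_def[of n u "Suc (Suc k)"] amp.simps cav_Suc[of n u "Suc k"] amp by (rule refl)
  then show ?thesis
    unfolding Err by (simp only: right_diff_distrib left_diff_distrib sum_subtractf)
qed

text \<open>A discrete Gronwall argument for a fixed matrix. The matrix term is controlled by the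
  operator norm; the Onsager coefficient is an average, so its change is bounded by the mean square
  of \<open>delta\<close>.\<close>

lemma sum_delta_le:
  "\<exists>C\<ge>0. \<forall>n\<ge>1. \<forall>u \<omega>. op_norm_sq_le n K \<omega> \<longrightarrow>
    (\<Sum>i\<in>{1..n}. (delta n u k i \<omega>)\<^sup>2) \<le> C * (\<Sum>s<k. \<Sum>i\<in>{1..n}. (Err n u s i \<omega>)\<^sup>2)"
proof (induction k rule: less_induct)
  case (less k)
  consider "k = 0" | "k = Suc 0" | s where "k = Suc (Suc s)" by (metis not0_implies_Suc)
  then show ?case
  proof cases
    case 1
    then show ?thesis by (intro exI[of _ 0]) (simp add: delta_0)
  next
    case 2
    then show ?thesis by (intro exI[of _ 0]) (simp add: delta_1)
  next
    case (3 s)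
    obtain C1 where C1: "C1 \<ge> 0" "\<And>n u \<omega>. n \<ge> 1 \<Longrightarrow> op_norm_sq_le n K \<omega> \<Longrightarrow>
      (\<Sum>i\<in>{1..n}. (delta n u (Suc s) i \<omega>)\<^sup>2) \<le> C1 * (\<Sum>r<Suc s. \<Sum>i\<in>{1..n}. (Err n u r i \<omega>)\<^sup>2)"
      using less.IH[of "Suc s"] 3 by auto
    obtain C2 where C2: "C2 \<ge> 0" "\<And>n u \<omega>. n \<ge> 1 \<Longrightarrow> op_norm_sq_le n K \<omega> \<Longrightarrow>
      (\<Sum>i\<in>{1..n}. (delta n u s i \<omega>)\<^sup>2) \<le> C2 * (\<Sum>r<s. \<Sum>i\<in>{1..n}. (Err n u r i \<omega>)\<^sup>2)"
      using less.IH[of s] 3 by auto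
    define b where "b = max (B s) (B (Suc s))"
    have b: "b \<ge> 0" "B s \<le> b" "B (Suc s) \<le> b" using B_nonneg[of s] by (auto simp: b_def)
    define K' where "K' = max K 0"
    \<comment> \<open>The 4 comes from squaring a sum of four terms; the summands belong to the
      matrix term, to \<open>Err\<close>, and to the changes of the two factors of the Onsager
      term.\<close>
    define C where "C = 4 * (K' * b\<^sup>2 * C1 + 1 + b ^ 4 * C1 + b ^ 4 * C2)"
    have C0: "C \<ge> 0" using C1(1) C2(1) b by (auto simp: C_def K'_def)
    have "(\<Sum>i\<in>{1..n}. (delta n u k i \<omega>)\<^sup>2) \<le> C * (\<Sum>r<k. \<Sum>i\<in>{1..n}. (Err n u r i \<omega>)\<^sup>2)"
      if n: "n \<ge> 1" and G: "op_norm_sq_le n K \<omega>" for n u \<omega>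
    proof -
      let ?w = "\<lambda>j. cav n u (Suc s) {} j \<omega>" and ?d = "\<lambda>j. delta n u (Suc s) j \<omega>"
      let ?v = "\<lambda>i. cav n u s {} i \<omega>" and ?e = "\<lambda>i. delta n u s i \<omega>"
      define E where "E = (\<Sum>r<k. \<Sum>i\<in>{1..n}. (Err n u r i \<omega>)\<^sup>2)"
      let ?D1 = "\<Sum>i\<in>{1..n}. (delta n u (Suc s) i \<omega>)\<^sup>2"
      let ?D0 = "\<Sum>i\<in>{1..n}. (?e i)\<^sup>2"
      have E_ge: "(\<Sum>r<m. \<Sum>i\<in>{1..n}. (Err n u r i \<omega>)\<^sup>2) \<le> E" if "m \<le> k" for m
        unfolding E_def using that by (intro sum_mono2) (auto intro: sum_nonneg)
      have D1: "?D1 \<le> C1 * E"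
        using C1(2)[OF n G, of u] mult_left_mono[OF E_ge[of "Suc s"] C1(1)] 3 by linarith
      have D0: "?D0 \<le> C2 * E"
        using C2(2)[OF n G, of u] mult_left_mono[OF E_ge[of s] C2(1)] 3 by linarith
      have E0: "E \<ge> 0" using E_ge[of 0] by simp
      have Es: "(\<Sum>i\<in>{1..n}. (Err n u s i \<omega>)\<^sup>2) \<le> E"
        unfolding E_def using 3
        by (intro member_le_sum[of s "{..<k}" "\<lambda>r. \<Sum>i\<in>{1..n}. (Err n u r i \<omega>)\<^sup>2"]) (auto intro: sum_nonneg)
      define X where "X i = (1 / sqrt (real n)) * (\<Sum>j\<in>{1..n}. ent n i j \<omega> *
        (f (Suc s) (?w j + ?d j) - f (Suc s) (?w j)))" for i
      define m1 where "m1 = (1 / real n) * (\<Sum>j\<in>{1..n}. deriv (f (Suc s)) (?w j)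
        - deriv (f (Suc s)) (?w j + ?d j))"
      define m2 where "m2 = (1 / real n) * (\<Sum>j\<in>{1..n}. deriv (f (Suc s)) (?w j + ?d j))"
      define Y where "Y i = m1 * f s (?v i)" for i
      define W where "W i = m2 * (f s (?v i) - f s (?v i + ?e i))" for i
      have dec: "delta n u k i \<omega> = X i + Err n u s i \<omega> + Y i + W i" if "i \<in> {1..n}" for i
        unfolding 3 delta_Suc_Suc[OF that] X_def Y_def W_def m1_def m2_def by (rule refl)
      have X: "(\<Sum>i\<in>{1..n}. (X i)\<^sup>2) \<le> K' * b\<^sup>2 * C1 * E"
      proof -
        let ?x = "\<lambda>j. f (Suc s) (?w j + ?d j) - f (Suc s) (?w j)"
        have "(\<Sum>i\<in>{1..n}. (X i)\<^sup>2) \<le> K * (\<Sum>j\<in>{1..n}. (?x j)\<^sup>2)"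
          unfolding X_def by (rule G[unfolded op_norm_sq_le_def, THEN spec, of ?x])
        also have "\<dots> \<le> K' * (\<Sum>j\<in>{1..n}. (?x j)\<^sup>2)"
          by (intro mult_right_mono sum_nonneg) (auto simp: K'_def)
        also have "\<dots> \<le> K' * (\<Sum>j\<in>{1..n}. b\<^sup>2 * (?d j)\<^sup>2)"
        proof (intro mult_left_mono sum_mono)
          fix j
          have "\<bar>?x j\<bar> \<le> B (Suc s) * \<bar>?d j\<bar>"
            using f_lipschitz[of "Suc s" "?w j + ?d j" "?w j"] by simp
          also have "\<dots> \<le> b * \<bar>?d j\<bar>" by (intro mult_right_mono b) auto
          finally have "\<bar>?x j\<bar>\<^sup>2 \<le> (b * \<bar>?d j\<bar>)\<^sup>2" by (intro power_mono) auto
          then show "(?x j)\<^sup>2 \<le> b\<^sup>2 * (?d j)\<^sup>2" by (simp add: power_mult_distrib)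
        qed (auto simp: K'_def)
        also have "\<dots> = K' * b\<^sup>2 * ?D1" by (simp only: sum_distrib_left mult.assoc)
        also have "\<dots> \<le> K' * b\<^sup>2 * (C1 * E)"
          using D1 by (intro mult_left_mono) (auto simp: K'_def)
        finally show ?thesis by (simp only: mult.assoc)
      qed
      have m1: "m1\<^sup>2 \<le> b\<^sup>2 * (?D1 / n)"
      proof -
        let ?x = "\<lambda>j. deriv (f (Suc s)) (?w j) - deriv (f (Suc s)) (?w j + ?d j)"
        have "\<bar>m1\<bar> = \<bar>\<Sum>j\<in>{1..n}. ?x j\<bar> / n" by (simp add: m1_def abs_mult)
        also have "\<dots> \<le> (\<Sum>j\<in>{1..n}. \<bar>?x j\<bar>) / n" by (intro divide_right_mono sum_abs) auto
        finally have "\<bar>m1\<bar>\<^sup>2 \<le> ((\<Sum>j\<in>{1..n}. \<bar>?x j\<bar>) / n)\<^sup>2" by (intro power_mono) auto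
        also have "\<dots> \<le> (\<Sum>j\<in>{1..n}. \<bar>?x j\<bar>\<^sup>2) / n" by (rule power_mean_le) auto
        also have "\<dots> \<le> (\<Sum>j\<in>{1..n}. b\<^sup>2 * (?d j)\<^sup>2) / n"
        proof (intro divide_right_mono sum_mono)
          fix j
          have "\<bar>?x j\<bar> \<le> B (Suc s) * \<bar>?d j\<bar>"
            using df_lipschitz[of "Suc s" "?w j" "?w j + ?d j"] by simp
          also have "\<dots> \<le> b * \<bar>?d j\<bar>" by (intro mult_right_mono b) auto
          finally have "\<bar>?x j\<bar>\<^sup>2 \<le> (b * \<bar>?d j\<bar>)\<^sup>2" by (intro power_mono) auto
          then show "\<bar>?x j\<bar>\<^sup>2 \<le> b\<^sup>2 * (?d j)\<^sup>2" by (simp add: power_mult_distrib)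
        qed auto
        also have "\<dots> = b\<^sup>2 * (?D1 / n)" by (simp add: sum_distrib_left)
        finally show ?thesis by simp
      qed
      have Y: "(\<Sum>i\<in>{1..n}. (Y i)\<^sup>2) \<le> b ^ 4 * C1 * E"
      proof -
        have "(\<Sum>i\<in>{1..n}. (Y i)\<^sup>2) \<le> (\<Sum>i\<in>{1..n}. b\<^sup>2 * (?D1 / n) * b\<^sup>2)"
        proof (rule sum_mono)
          fix i
          have "\<bar>f s (?v i)\<bar>\<^sup>2 \<le> b\<^sup>2"
            using f_bounded[of s "?v i"] b by (intro power_mono) linarith+
          then show "(Y i)\<^sup>2 \<le> b\<^sup>2 * (?D1 / n) * b\<^sup>2"
            unfolding Y_def power_mult_distrib using m1 order_trans[OF zero_le_power2 m1] by (intro mult_mono) simp_all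
        qed
        also have "\<dots> = b ^ 4 * ?D1" using n by (simp add: power2_eq_square eval_nat_numeral)
        also have "\<dots> \<le> b ^ 4 * (C1 * E)" using D1 by (intro mult_left_mono) auto
        finally show ?thesis by (simp only: mult.assoc)
      qed
      have m2: "\<bar>m2\<bar> \<le> b"
      proof -
        let ?x = "\<lambda>j. deriv (f (Suc s)) (?w j + ?d j)"
        have "\<bar>m2\<bar> = \<bar>\<Sum>j\<in>{1..n}. ?x j\<bar> / n" by (simp add: m2_def abs_mult)
        also have "\<dots> \<le> (\<Sum>j\<in>{1..n}. \<bar>?x j\<bar>) / n" by (intro divide_right_mono sum_abs) auto
        also have "\<dots> \<le> (\<Sum>j\<in>{1..n}. b) / n"
          using order_trans[OF df_bounded b(3)] by (intro divide_right_mono sum_mono) auto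
        finally show ?thesis using n by simp
      qed
      have W: "(\<Sum>i\<in>{1..n}. (W i)\<^sup>2) \<le> b ^ 4 * C2 * E"
      proof -
        have "(\<Sum>i\<in>{1..n}. (W i)\<^sup>2) \<le> (\<Sum>i\<in>{1..n}. b ^ 4 * (?e i)\<^sup>2)"
        proof (rule sum_mono)
          fix i
          have "\<bar>f s (?v i) - f s (?v i + ?e i)\<bar> \<le> B s * \<bar>?e i\<bar>"
            using f_lipschitz[of s "?v i" "?v i + ?e i"] by simp
          also have "\<dots> \<le> b * \<bar>?e i\<bar>" by (intro mult_right_mono b) auto
          finally have "\<bar>W i\<bar> \<le> b * (b * \<bar>?e i\<bar>)"
            unfolding W_def abs_mult by (intro mult_mono m2 b) auto
          then have "\<bar>W i\<bar>\<^sup>2 \<le> (b * (b * \<bar>?e i\<bar>))\<^sup>2" by (intro power_mono) auto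
          then show "(W i)\<^sup>2 \<le> b ^ 4 * (?e i)\<^sup>2"
            by (simp add: power_mult_distrib power2_eq_square eval_nat_numeral mult_ac)
        qed
        also have "\<dots> = b ^ 4 * ?D0" by (simp only: sum_distrib_left)
        also have "\<dots> \<le> b ^ 4 * (C2 * E)" using D0 by (intro mult_left_mono) auto
        finally show ?thesis by (simp only: mult.assoc)
      qed
      have sq4: "(x + y + z + w)\<^sup>2 \<le> 4 * (x\<^sup>2 + y\<^sup>2 + z\<^sup>2 + w\<^sup>2)" for x y z w :: real
      proof -
        have "4 * (x\<^sup>2 + y\<^sup>2 + z\<^sup>2 + w\<^sup>2) - (x + y + z + w)\<^sup>2
          = (x - y)\<^sup>2 + (x - z)\<^sup>2 + (x - w)\<^sup>2 + (y - z)\<^sup>2 + (y - w)\<^sup>2 + (z - w)\<^sup>2" by algebra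
        also have "\<dots> \<ge> 0" by simp
        finally show ?thesis by simp
      qed
      have "(\<Sum>i\<in>{1..n}. (delta n u k i \<omega>)\<^sup>2)
        \<le> (\<Sum>i\<in>{1..n}. 4 * ((X i)\<^sup>2 + (Err n u s i \<omega>)\<^sup>2 + (Y i)\<^sup>2 + (W i)\<^sup>2))"
        by (intro sum_mono) (simp only: dec sq4)
      also have "\<dots> = 4 * ((\<Sum>i\<in>{1..n}. (X i)\<^sup>2) + (\<Sum>i\<in>{1..n}. (Err n u s i \<omega>)\<^sup>2) + (\<Sum>i\<in>{1..n}. (Y i)\<^sup>2) + (\<Sum>i\<in>{1..n}. (W i)\<^sup>2))"
        by (simp only: sum_distrib_left[symmetric] sum.distrib)
      also have "\<dots> \<le> 4 * (K' * b\<^sup>2 * C1 * E + E + b ^ 4 * C1 * E + b ^ 4 * C2 * E)"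
        by (intro mult_left_mono add_mono X Es Y W) simp
      also have "\<dots> = C * E" by (simp add: C_def algebra_simps)
      finally show ?thesis by (simp only: E_def)
    qed
    then show ?thesis using C0 by blast
  qed
qed

section \<open>A crude bound valid for every matrix\<close>

text \<open>Cauchy-Schwarz against at most n bounded coefficients uses up the prefactor
  exactly.\<close>

lemma linear_iterate_le:
  assumes n: "n \<ge> 1" and L: "L \<subseteq> {1..n}" and x: "\<And>j. \<bar>x j\<bar> \<le> b" and b: "b \<ge> 0"
  shows "((1 / sqrt (real n)) * (\<Sum>j\<in>L. ent n i j \<omega> * x j))\<^sup>2 \<le> b\<^sup>2 * (\<Sum>j\<in>{1..n}. (ent n i j \<omega>)\<^sup>2)"
proof -
  have fL: "finite L" using L by (rule finite_subset) simp
  have cL: "card L \<le> n" using card_mono[of "{1..n}" L] L by auto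
  have "((1 / sqrt (real n)) * (\<Sum>j\<in>L. ent n i j \<omega> * x j))\<^sup>2 = real n * \<bar>(\<Sum>j\<in>L. ent n i j \<omega> * x j) / n\<bar>\<^sup>2"
    using n by (simp add: power_mult_distrib power_divide) (simp add: power2_eq_square)
  also have "\<dots> \<le> real n * ((\<Sum>j\<in>L. \<bar>ent n i j \<omega> * x j\<bar>) / n)\<^sup>2"
    by (intro mult_left_mono power_mono) (auto simp: divide_right_mono)
  also have "\<dots> \<le> real n * ((\<Sum>j\<in>L. \<bar>ent n i j \<omega> * x j\<bar>\<^sup>2) / n)"
    by (intro mult_left_mono power_mean_le fL cL) auto
  also have "\<dots> = (\<Sum>j\<in>L. (ent n i j \<omega> * x j)\<^sup>2)" using n by simp
  also have "\<dots> \<le> (\<Sum>j\<in>L. b\<^sup>2 * (ent n i j \<omega>)\<^sup>2)"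
  proof (rule sum_mono)
    fix j
    have "\<bar>x j\<bar>\<^sup>2 \<le> b\<^sup>2" by (intro power_mono x) auto
    then show "(ent n i j \<omega> * x j)\<^sup>2 \<le> b\<^sup>2 * (ent n i j \<omega>)\<^sup>2"
      by (simp add: power_mult_distrib mult.commute[of "(ent n i j \<omega>)\<^sup>2"] mult_right_mono)
  qed
  also have "\<dots> \<le> (\<Sum>j\<in>{1..n}. b\<^sup>2 * (ent n i j \<omega>)\<^sup>2)" using L by (intro sum_mono2) auto
  finally show ?thesis by (simp only: sum_distrib_left)
qed

text \<open>The iterates agree at steps 0 and 1. From step 2 on they depend on their predecessors
  only through bounded functions, so a single step is estimated and no growth accumulates.\<close>

lemma delta_crude:
  "\<exists>C\<ge>0. \<forall>n\<ge>1. \<forall>u \<omega>. (1 / real n) * (\<Sum>i\<in>{1..n}. (delta n u k i \<omega>)\<^sup>2)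
    \<le> C * (1 + (\<Sum>i\<in>{1..n}. \<Sum>j\<in>{1..n}. (ent n i j \<omega>)\<^sup>2))"
proof -
  consider "k = 0" | "k = Suc 0" | s where "k = Suc (Suc s)" by (metis not0_implies_Suc)
  then show ?thesis
  proof cases
    case 1
    then show ?thesis by (intro exI[of _ 0]) (simp add: delta_0)
  next
    case 2
    then show ?thesis by (intro exI[of _ 0]) (simp add: delta_1)
  next
    case (3 s)
    define b where "b = max (B s) (B (Suc s))"
    have b: "b \<ge> 0" "B s \<le> b" "B (Suc s) \<le> b" using B_nonneg[of s] by (auto simp: b_def)
    define C where "C = 3 * (2 * b\<^sup>2 + b ^ 4)"
    have C0: "C \<ge> 0" by (simp add: C_def)
    have "(1 / real n) * (\<Sum>i\<in>{1..n}. (delta n u k i \<omega>)\<^sup>2)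
      \<le> C * (1 + (\<Sum>i\<in>{1..n}. \<Sum>j\<in>{1..n}. (ent n i j \<omega>)\<^sup>2))" if n: "n \<ge> 1" for n u \<omega>
    proof -
      let ?a = "\<lambda>k i. amp n (\<lambda>i j. ent n i j \<omega>) f u k i"
      define T where "T = (\<Sum>i\<in>{1..n}. \<Sum>j\<in>{1..n}. (ent n i j \<omega>)\<^sup>2)"
      have "(delta n u k i \<omega>)\<^sup>2 \<le> C * (1 + T)" if i: "i \<in> {1..n}" for i
      proof -
        define x where "x = (1 / sqrt (real n)) * (\<Sum>j\<in>{1..n}. ent n i j \<omega> * f (Suc s) (?a (Suc s) j))"
        define y where "y = (1 / sqrt (real n)) * (\<Sum>j\<in>{1..n} - {i}. ent n i j \<omega> * f (Suc s) (cav n u (Suc s) {i} j \<omega>))"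
        define z where "z = ((1 / real n) * (\<Sum>j\<in>{1..n}. deriv (f (Suc s)) (?a (Suc s) j))) * f s (?a s i)"
        have R: "(\<Sum>j\<in>{1..n}. (ent n i j \<omega>)\<^sup>2) \<le> T"
          unfolding T_def using i
          by (intro member_le_sum[of i _ "\<lambda>i. \<Sum>j\<in>{1..n}. (ent n i j \<omega>)\<^sup>2"]) (auto intro: sum_nonneg)
        have T0: "T \<ge> 0" unfolding T_def by (intro sum_nonneg) auto
        have x: "x\<^sup>2 \<le> b\<^sup>2 * T"
          unfolding x_def
          by (rule order_trans[OF linear_iterate_le[OF n _ _ b(1)] mult_left_mono[OF R]])
            (use order_trans[OF f_bounded b(3)] in auto)
        have y: "y\<^sup>2 \<le> b\<^sup>2 * T"
          unfolding y_def
          by (rule order_trans[OF linear_iterate_le[OF n _ _ b(1)] mult_left_mono[OF R]])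
            (use order_trans[OF f_bounded b(3)] in auto)
        have "\<bar>(1 / real n) * (\<Sum>j\<in>{1..n}. deriv (f (Suc s)) (?a (Suc s) j))\<bar> \<le> b"
        proof -
          have "\<bar>(1 / real n) * (\<Sum>j\<in>{1..n}. deriv (f (Suc s)) (?a (Suc s) j))\<bar>
            = \<bar>\<Sum>j\<in>{1..n}. deriv (f (Suc s)) (?a (Suc s) j)\<bar> / n" by (simp add: abs_mult)
          also have "\<dots> \<le> (\<Sum>j\<in>{1..n}. \<bar>deriv (f (Suc s)) (?a (Suc s) j)\<bar>) / n"
            by (intro divide_right_mono sum_abs) auto
          also have "\<dots> \<le> (\<Sum>j\<in>{1..n}. b) / n"
            using order_trans[OF df_bounded b(3)] by (intro divide_right_mono sum_mono) auto
          finally show ?thesis using n by simp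
        qed
        then have "\<bar>z\<bar> \<le> b * b"
          unfolding z_def abs_mult[of _ "f s (?a s i)"]
          using order_trans[OF f_bounded b(2)] b by (intro mult_mono) auto
        then have "\<bar>z\<bar>\<^sup>2 \<le> (b * b)\<^sup>2" by (intro power_mono) auto
        then have z: "z\<^sup>2 \<le> b ^ 4" by (simp add: power2_eq_square eval_nat_numeral mult_ac)
        have d: "delta n u k i \<omega> = x - z - y"
          unfolding 3 delta_def amp.simps cav_Suc x_def y_def z_def by (rule refl)
        have "3 * (x\<^sup>2 + y\<^sup>2 + z\<^sup>2) - (x - z - y)\<^sup>2 = (x + z)\<^sup>2 + (x + y)\<^sup>2 + (z - y)\<^sup>2" by algebra
        also have "\<dots> \<ge> 0" by simp
        finally have "(delta n u k i \<omega>)\<^sup>2 \<le> 3 * (x\<^sup>2 + y\<^sup>2 + z\<^sup>2)" unfolding d by simp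
        also have "\<dots> \<le> 3 * (b\<^sup>2 * T + b\<^sup>2 * T + b ^ 4)" by (intro mult_left_mono add_mono x y z) simp
        also have "\<dots> \<le> C * (1 + T)"
        proof -
          have "0 \<le> 6 * b\<^sup>2 + 3 * b ^ 4 * T" using T0 by simp
          then show ?thesis by (simp add: C_def algebra_simps)
        qed
        finally show ?thesis .
      qed
      then have "(\<Sum>i\<in>{1..n}. (delta n u k i \<omega>)\<^sup>2) \<le> (\<Sum>i\<in>{1..n}. C * (1 + T))" by (rule sum_mono)
      then have "(1 / real n) * (\<Sum>i\<in>{1..n}. (delta n u k i \<omega>)\<^sup>2) \<le> (1 / real n) * (\<Sum>i\<in>{1..n}. C * (1 + T))"
        by (rule mult_left_mono) simp
      then show ?thesis using n by (simp add: T_def)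
    qed
    then show ?thesis using C0 by blast
  qed
qed

lemma delta_measurable [measurable]: "delta n u k i \<in> borel_measurable (goe n)"
proof -
  have "(\<lambda>\<omega>. amp n (\<lambda>i j. ent n i j \<omega>) f u k i) \<in> borel_measurable (goe n)"
    by (rule amp_measurable) measurable
  then show ?thesis unfolding delta_def[abs_def] by measurable
qed

text \<open>The sum of all squared entries is of order n^2; normalised accordingly it has a bounded
  second moment.\<close>

lemma Ob_entries:
  "\<exists>C\<ge>0. \<forall>n\<ge>1. Ob n 2 0 C (\<lambda>\<omega>. 1 + (1 / real n) * (\<Sum>i\<in>{1..n}. (1 / real n) * (\<Sum>j\<in>{1..n}. (ent n i j \<omega>)\<^sup>2)))"
proof -
  define c :: real where "c = 4 * fact (2 * 2) + 4 * fact (2 * 2)"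
  have c0: "c \<ge> 0" by (simp add: c_def)
  have "Ob n 2 0 (2\<^sup>2 * (1\<^sup>2 + c)) (\<lambda>\<omega>. 1 + (1 / real n) * (\<Sum>i\<in>{1..n}. (1 / real n) * (\<Sum>j\<in>{1..n}. (ent n i j \<omega>)\<^sup>2)))"
    if n: "n \<ge> 1" for n
  proof (intro Ob_add Ob_average)
    show "Ob n 2 0 (1\<^sup>2) (\<lambda>\<omega>. 1)" by (rule Ob_bounded) auto
    fix i j
    have e: "Ob n (2 * 2) 0 (4 * fact (2 * 2)) (ent n i j)" by (rule Ob_ent[OF n]) auto
    have "Ob n 2 (0 + 0) c (\<lambda>\<omega>. ent n i j \<omega> * ent n i j \<omega>)"
      unfolding c_def by (rule Ob_mult[OF e e])
    then show "Ob n 2 0 c (\<lambda>\<omega>. (ent n i j \<omega>)\<^sup>2)" by (simp only: add_0 power2_eq_square)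
  qed (use c0 in auto)
  then show ?thesis using c0 by (intro exI[of _ "2\<^sup>2 * (1\<^sup>2 + c)"]) auto
qed

text \<open>Typical and exceptional matrices are covered by one pointwise inequality, in which
  \<open>tail_weight\<close> stands for the indicator of the latter. Each of its three terms has
  expectation of order \<open>1 / n\<close>.\<close>

lemma delta_bound:
  "\<exists>C>0. \<forall>n\<ge>1. \<forall>u. (\<integral>\<^sup>+ \<omega>. ennreal ((1 / real n) * (\<Sum>i\<in>{1..n}. (delta n u k i \<omega>)\<^sup>2)) \<partial>goe n) \<le> ennreal (C / n)"
proof -
  obtain C1 where C1: "C1 \<ge> 0" "\<And>n u \<omega>. n \<ge> 1 \<Longrightarrow> op_norm_sq_le n 3600 \<omega> \<Longrightarrow>
    (\<Sum>i\<in>{1..n}. (delta n u k i \<omega>)\<^sup>2) \<le> C1 * (\<Sum>s<k. \<Sum>i\<in>{1..n}. (Err n u s i \<omega>)\<^sup>2)"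
    using sum_delta_le[of 3600 k] by blast
  obtain C2 where C2: "C2 \<ge> 0" "\<And>n u \<omega>. n \<ge> 1 \<Longrightarrow> (1 / real n) * (\<Sum>i\<in>{1..n}. (delta n u k i \<omega>)\<^sup>2)
    \<le> C2 * (1 + (\<Sum>i\<in>{1..n}. \<Sum>j\<in>{1..n}. (ent n i j \<omega>)\<^sup>2))"
    using delta_crude[of k] by blast
  obtain C3 where C3: "C3 \<ge> 0" "\<And>n. n \<ge> 1 \<Longrightarrow> Ob n 2 0 C3 (\<lambda>\<omega>. 1 + (1 / real n) * (\<Sum>i\<in>{1..n}. (1 / real n) * (\<Sum>j\<in>{1..n}. (ent n i j \<omega>)\<^sup>2)))"
    using Ob_entries by blast
  have "\<exists>C\<ge>0. \<forall>s<k. \<forall>n\<ge>1. \<forall>u. \<forall>i\<in>{1..n}. Ob n 2 1 C (Err n u s i)"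
    by (rule uniform_constant[OF Err_bound]) (blast intro: Ob_weaken)
  then obtain C4 where C4: "C4 \<ge> 0" "\<And>s n u i. s < k \<Longrightarrow> n \<ge> 1 \<Longrightarrow> i \<in> {1..n} \<Longrightarrow> Ob n 2 1 C4 (Err n u s i)"
    by blast
  \<comment> \<open>720 is \<open>fact 6\<close>, from
    \<open>n ^ 6 * exp (- n) \<le> fact 6\<close>; the final 1 makes the constant positive.\<close>
  define C where "C = C1 * (k * C4) + C2 * C3 + C2 * 720 + 1"
  have C0: "C > 0" using C1 C2 C3 C4 by (simp add: C_def add_nonneg_pos)
  have "(\<integral>\<^sup>+ \<omega>. ennreal ((1 / real n) * (\<Sum>i\<in>{1..n}. (delta n u k i \<omega>)\<^sup>2)) \<partial>goe n) \<le> ennreal (C / n)"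
    if n: "n \<ge> 1" for n u
  proof -
    let ?S = "\<lambda>\<omega>. \<Sum>s<k. \<Sum>i\<in>{1..n}. (Err n u s i \<omega>)\<^sup>2"
    let ?D = "\<lambda>\<omega>. (1 / real n) * (\<Sum>i\<in>{1..n}. (delta n u k i \<omega>)\<^sup>2)"
    define Z where "Z \<omega> = 1 + (1 / real n) * (\<Sum>i\<in>{1..n}. (1 / real n) * (\<Sum>j\<in>{1..n}. (ent n i j \<omega>)\<^sup>2))" for \<omega>
    have [measurable]: "Z \<in> borel_measurable (goe n)" unfolding Z_def by measurable
    have [measurable]: "Err n u s i \<in> borel_measurable (goe n)" if "s < k" "i \<in> {1..n}" for s i
      using C4(2)[OF that(1) n that(2)] by (rule Ob_measurable)
    have Err_int: "(\<integral>\<^sup>+ \<omega>. ennreal ((Err n u s i \<omega>)\<^sup>2) \<partial>goe n) \<le> ennreal (C4 / n)" if si: "s < k" "i \<in> {1..n}" for s i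
    proof -
      have "(\<integral>\<^sup>+ \<omega>. ennreal ((Err n u s i \<omega>)\<^sup>2) \<partial>goe n)
        = (\<integral>\<^sup>+ \<omega>. ennreal (1 / n) * ennreal (\<bar>sqrt (real n) ^ 1 * Err n u s i \<omega>\<bar>\<^sup>2) \<partial>goe n)"
        using n by (intro nn_integral_cong) (simp add: power_mult_distrib ennreal_mult[symmetric])
      also have "\<dots> = ennreal (1 / n) * (\<integral>\<^sup>+ \<omega>. ennreal (\<bar>sqrt (real n) ^ 1 * Err n u s i \<omega>\<bar>\<^sup>2) \<partial>goe n)"
        using si by (intro nn_integral_cmult) measurable
      also have "\<dots> \<le> ennreal (1 / n) * ennreal C4"
        using C4(2)[OF si(1) n si(2), of u] by (intro mult_left_mono) (auto simp: Ob_def)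
      also have "\<dots> = ennreal (C4 / n)" using C4(1) by (simp add: ennreal_mult[symmetric])
      finally show ?thesis .
    qed
    have Z_int: "(\<integral>\<^sup>+ \<omega>. ennreal ((Z \<omega>)\<^sup>2) \<partial>goe n) \<le> ennreal C3"
      using C3(2)[OF n] by (simp add: Ob_def Z_def)
    have pt: "?D \<omega>
      \<le> (C1 / n) * ?S \<omega> + (C2 / n) * (Z \<omega>)\<^sup>2 + (C2 * real n ^ 5) * tail_weight n \<omega>" for \<omega>
    proof -
      have nonneg: "0 \<le> (C1 / n) * ?S \<omega>"
        "0 \<le> (C2 / n) * (Z \<omega>)\<^sup>2" "0 \<le> (C2 * real n ^ 5) * tail_weight n \<omega>"
        using C1 C2 tail_weight_nonneg[of n \<omega>] by (auto intro!: mult_nonneg_nonneg divide_nonneg_nonneg sum_nonneg)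
      from norm_bound_or_tail_weight[OF n, of \<omega>] show ?thesis
      proof
        assume "op_norm_sq_le n 3600 \<omega>"
        from mult_left_mono[OF C1(2)[OF n this, of u], of "1 / n"]
        have "?D \<omega> \<le> (C1 / n) * ?S \<omega>"
          by simp
        then show ?thesis using nonneg by linarith
      next
        assume t: "tail_weight n \<omega> \<ge> 1"
        define T where "T = (\<Sum>i\<in>{1..n}. \<Sum>j\<in>{1..n}. (ent n i j \<omega>)\<^sup>2)"
        have T0: "T \<ge> 0" unfolding T_def by (intro sum_nonneg) auto
        have ZT: "real n ^ 2 * Z \<omega> = real n ^ 2 + T"
        proof -
          have "Z \<omega> = 1 + (1 / real n) * ((1 / real n) * T)"
            by (simp only: Z_def T_def sum_distrib_left)
          then show ?thesis using n by (simp add: power2_eq_square field_simps)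
        qed
        have "1 + T \<le> real n ^ 2 * Z \<omega>" unfolding ZT using n by simp
        also have "\<dots> \<le> (Z \<omega>)\<^sup>2 / n + real n ^ 5"
        proof -
          \<comment> \<open>Balancing \<open>Z\<close> against n^3 separates the crude bound into
            \<open>Z^2 / n\<close>, whose mean is small on its own, and the deterministic n^5, which
            \<open>tail_weight\<close> may multiply.\<close>
          have "0 \<le> (Z \<omega> - real n ^ 3)\<^sup>2 + (Z \<omega>)\<^sup>2 + (real n ^ 3)\<^sup>2" by simp
          then have "2 * (real n ^ 3 * Z \<omega>) \<le> 2 * ((Z \<omega>)\<^sup>2 + real n ^ 6)"
            by (simp add: power2_eq_square algebra_simps eval_nat_numeral)
          then have "real n ^ 3 * Z \<omega> \<le> (Z \<omega>)\<^sup>2 + real n ^ 6" by simp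
          then have "(real n ^ 3 * Z \<omega>) / n \<le> ((Z \<omega>)\<^sup>2 + real n ^ 6) / n" by (intro divide_right_mono) auto
          then show ?thesis using n by (simp add: add_divide_distrib eval_nat_numeral)
        qed
        also have "\<dots> \<le> (Z \<omega>)\<^sup>2 / n + real n ^ 5 * tail_weight n \<omega>"
          using mult_left_mono[OF t, of "real n ^ 5"] by simp
        finally have "C2 * (1 + T) \<le> C2 * ((Z \<omega>)\<^sup>2 / n + real n ^ 5 * tail_weight n \<omega>)"
          by (rule mult_left_mono) (rule C2)
        also have "\<dots> = (C2 / n) * (Z \<omega>)\<^sup>2 + (C2 * real n ^ 5) * tail_weight n \<omega>"
          by (simp add: algebra_simps)
        finally show ?thesis using C2(2)[OF n, of u \<omega>] nonneg unfolding T_def by linarith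
      qed
    qed
    have "(\<integral>\<^sup>+ \<omega>. ennreal (?D \<omega>) \<partial>goe n)
      \<le> (\<integral>\<^sup>+ \<omega>. ennreal (C1 / n) * (\<Sum>s<k. \<Sum>i\<in>{1..n}. ennreal ((Err n u s i \<omega>)\<^sup>2))
          + ennreal (C2 / n) * ennreal ((Z \<omega>)\<^sup>2) + ennreal (C2 * real n ^ 5) * ennreal (tail_weight n \<omega>) \<partial>goe n)"
    proof (rule nn_integral_mono)
      fix \<omega>
      have "(\<Sum>s<k. \<Sum>i\<in>{1..n}. ennreal ((Err n u s i \<omega>)\<^sup>2)) = ennreal (?S \<omega>)"
        by (simp only: sum_ennreal zero_le_power2 sum_nonneg)
      then show "ennreal (?D \<omega>)
        \<le> ennreal (C1 / n) * (\<Sum>s<k. \<Sum>i\<in>{1..n}. ennreal ((Err n u s i \<omega>)\<^sup>2))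
          + ennreal (C2 / n) * ennreal ((Z \<omega>)\<^sup>2) + ennreal (C2 * real n ^ 5) * ennreal (tail_weight n \<omega>)"
        using pt[of \<omega>] C1(1) C2(1) tail_weight_nonneg[of n \<omega>]
        by (simp add: ennreal_mult[symmetric] ennreal_plus[symmetric] sum_nonneg ennreal_leI del: ennreal_plus)
    qed
    also have "\<dots> = ennreal (C1 / n) * (\<Sum>s<k. \<Sum>i\<in>{1..n}. \<integral>\<^sup>+ \<omega>. ennreal ((Err n u s i \<omega>)\<^sup>2) \<partial>goe n)
          + ennreal (C2 / n) * (\<integral>\<^sup>+ \<omega>. ennreal ((Z \<omega>)\<^sup>2) \<partial>goe n)
          + ennreal (C2 * real n ^ 5) * (\<integral>\<^sup>+ \<omega>. ennreal (tail_weight n \<omega>) \<partial>goe n)"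
    proof -
      have Em: "Err n u s i \<in> borel_measurable (goe n)" if "s \<in> {..<k}" "i \<in> {1..n}" for s i
        using C4(2)[of s n i u] that n by (auto dest: Ob_measurable)
      note [measurable] = Em
      have S: "(\<integral>\<^sup>+ \<omega>. (\<Sum>s<k. \<Sum>i\<in>{1..n}. ennreal ((Err n u s i \<omega>)\<^sup>2)) \<partial>goe n)
        = (\<Sum>s<k. \<Sum>i\<in>{1..n}. \<integral>\<^sup>+ \<omega>. ennreal ((Err n u s i \<omega>)\<^sup>2) \<partial>goe n)"
        by (subst nn_integral_sum, measurable, intro sum.cong refl, subst nn_integral_sum, measurable)
      have [measurable]: "(\<lambda>\<omega>. \<Sum>s<k. \<Sum>i\<in>{1..n}. ennreal ((Err n u s i \<omega>)\<^sup>2)) \<in> borel_measurable (goe n)"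
        by measurable
      show ?thesis
        by (subst nn_integral_add, measurable, subst nn_integral_add, measurable,
            subst nn_integral_cmult, measurable, subst nn_integral_cmult, measurable,
            subst nn_integral_cmult, measurable, subst S, rule refl)
    qed
    also have "\<dots> \<le> ennreal (C1 / n) * (\<Sum>s<k. \<Sum>i\<in>{1..n}. ennreal (C4 / n)) + ennreal (C2 / n) * ennreal C3
          + ennreal (C2 * real n ^ 5) * ennreal (exp (- real n))"
      by (intro add_mono mult_left_mono sum_mono Err_int Z_int tail_weight_integral n) auto
    also have "\<dots> = ennreal (C1 / n * (\<Sum>s<k. \<Sum>i\<in>{1..n}. C4 / n) + C2 / n * C3 + C2 * real n ^ 5 * exp (- real n))"
      using C1(1) C2(1) C3(1) C4(1)
      by (simp only: sum_ennreal sum_nonneg divide_nonneg_nonneg of_nat_0_le_iff ennreal_mult[symmetric]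
          ennreal_plus[symmetric] mult_nonneg_nonneg add_nonneg_nonneg zero_le_power exp_ge_zero)
    also have "\<dots> \<le> ennreal (C / n)"
    proof (rule ennreal_leI)
      have "real n ^ 6 \<le> fact 6 * exp (real n)" by (rule power_le_fact_exp) simp
      then have "real n ^ 6 * exp (- real n) \<le> fact 6" by (simp add: exp_minus divide_inverse[symmetric] divide_le_eq)
      then have "(real n ^ 6 * exp (- real n)) / n \<le> 720 / n"
        by (intro divide_right_mono) (auto simp: fact_numeral)
      then have "real n ^ 5 * exp (- real n) \<le> 720 / n" using n by (simp add: eval_nat_numeral)
      then have "C2 * (real n ^ 5 * exp (- real n)) \<le> C2 * (720 / n)" by (intro mult_left_mono C2)
      moreover have "C1 / n * (\<Sum>s<k. \<Sum>i\<in>{1..n}. C4 / n) = C1 * (k * C4) / n" using n by simp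
      moreover have "C / n = C1 * (k * C4) / n + C2 / n * C3 + C2 * (720 / n) + 1 / n"
        by (simp add: C_def add_divide_distrib)
      moreover have "0 \<le> 1 / real n" by simp
      ultimately show "C1 / n * (\<Sum>s<k. \<Sum>i\<in>{1..n}. C4 / n) + C2 / n * C3 + C2 * real n ^ 5 * exp (- real n) \<le> C / n"
        by (simp only: mult.assoc)
    qed
    finally show ?thesis .
  qed
  then show ?thesis using C0 by blast
qed

end

subsection \<open>From independent random variables to the product measure\<close>

lemma bounded_derivative_lipschitz:
  fixes g g' :: "real \<Rightarrow> real"
  assumes "\<And>z. (g has_real_derivative g' z) (at z)" "\<And>z. z \<in> closed_segment x y \<Longrightarrow> \<bar>g' z\<bar> \<le> b"
  shows "\<bar>g x - g y\<bar> \<le> b * \<bar>x - y\<bar>"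
proof -
  have "norm (g x - g y) \<le> b * norm (x - y)"
  proof (rule field_differentiable_bound[of "closed_segment x y" g g'])
    show "(g has_field_derivative g' z) (at z within closed_segment x y)" for z
      by (rule has_field_derivative_at_within[OF assms(1)])
  qed (use assms(2) in auto)
  then show ?thesis by simp
qed

lemma bounded_smooth_bound:
  assumes "bounded_smooth f"
  shows "\<exists>b\<ge>1. f \<in> borel_measurable borel \<and> deriv f \<in> borel_measurable borel \<and>
    (\<forall>x. \<bar>f x\<bar> \<le> b) \<and> (\<forall>x. \<bar>deriv f x\<bar> \<le> b) \<and> (\<forall>x y. \<bar>f x - f y\<bar> \<le> b * \<bar>x - y\<bar>) \<and>
    (\<forall>x y. \<bar>deriv f x - deriv f y\<bar> \<le> b * \<bar>x - y\<bar>) \<and>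
    (\<forall>x y. \<bar>f x - f y - deriv f y * (x - y)\<bar> \<le> b * (x - y)\<^sup>2)"
proof -
  have D: "((deriv ^^ m) f has_real_derivative (deriv ^^ Suc m) f x) (at x)" for m x
    using assms by (simp add: bounded_smooth_def differentiable_on_def DERIV_deriv_iff_real_differentiable)
  have f1: "(f has_real_derivative deriv f x) (at x)" for x using D[of 0 x] by simp
  have f2: "(deriv f has_real_derivative deriv (deriv f) x) (at x)" for x using D[of 1 x] by simp
  have "\<exists>c. \<forall>x. \<bar>(deriv ^^ m) f x\<bar> \<le> c" for m
    using assms by (auto simp: bounded_smooth_def bounded_iff)
  from this[of 0] this[of 1] this[of 2] obtain c0 c1 c2 where
    c: "\<And>x. \<bar>f x\<bar> \<le> c0" "\<And>x. \<bar>deriv f x\<bar> \<le> c1" "\<And>x. \<bar>deriv (deriv f) x\<bar> \<le> c2"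
    by (auto simp: numeral_2_eq_2)
  define b where "b = 1 + c0 + c1 + c2"
  have c0: "c0 \<ge> 0" "c1 \<ge> 0" "c2 \<ge> 0" using c[of 0] by (meson abs_ge_zero order_trans)+
  have b: "1 \<le> b" "\<bar>f x\<bar> \<le> b" "\<bar>deriv f x\<bar> \<le> b" "\<bar>deriv (deriv f) x\<bar> \<le> b" for x
    using c[of x] c0 by (auto simp: b_def)
  have lip: "\<bar>f x - f y\<bar> \<le> b * \<bar>x - y\<bar>" "\<bar>deriv f x - deriv f y\<bar> \<le> b * \<bar>x - y\<bar>" for x y
    by (rule bounded_derivative_lipschitz[OF f1 b(3)] bounded_derivative_lipschitz[OF f2 b(4)])+
  have taylor: "\<bar>f x - f y - deriv f y * (x - y)\<bar> \<le> b * (x - y)\<^sup>2" for x y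
  proof -
    \<comment> \<open>With the tangent slope at \<open>y\<close> subtracted, the derivative on the
      segment is at most \<open>b * \<bar>x - y\<bar>\<close>, and the mean value bound produces the
      quadratic error.\<close>
    define g where "g z = f z - deriv f y * z" for z
    have "(g has_real_derivative (deriv f z - deriv f y)) (at z)" for z
      unfolding g_def[abs_def] by (auto intro!: derivative_eq_intros f1)
    moreover have "\<bar>deriv f z - deriv f y\<bar> \<le> b * \<bar>x - y\<bar>" if "z \<in> closed_segment x y" for z
    proof -
      have "\<bar>z - y\<bar> \<le> \<bar>x - y\<bar>" using that by (auto simp: closed_segment_eq_real_ivl split: if_splits)
      then have "b * \<bar>z - y\<bar> \<le> b * \<bar>x - y\<bar>" using b(1) by (intro mult_left_mono) auto
      then show ?thesis using lip(2)[of z y] by linarith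
    qed
    ultimately have "\<bar>g x - g y\<bar> \<le> (b * \<bar>x - y\<bar>) * \<bar>x - y\<bar>" by (rule bounded_derivative_lipschitz)
    moreover have "g x - g y = f x - f y - deriv f y * (x - y)" by (simp add: g_def algebra_simps)
    moreover have "(b * \<bar>x - y\<bar>) * \<bar>x - y\<bar> = b * (x - y)\<^sup>2" by (simp add: power2_eq_square)
    ultimately show ?thesis by simp
  qed
  have "continuous_on UNIV f" "continuous_on UNIV (deriv f)"
    using DERIV_isCont[OF f1] DERIV_isCont[OF f2] by (simp_all add: continuous_on_eq_continuous_at)
  then have "f \<in> borel_measurable borel" "deriv f \<in> borel_measurable borel"
    by (auto intro: borel_measurable_continuous_onI)
  then show ?thesis using b lip taylor by blast
qed

lemma smooth_nonlinearities_exists: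
  assumes "\<And>k. bounded_smooth (f k)"
  shows "\<exists>B. smooth_nonlinearities f B"
proof -
  from bounded_smooth_bound[OF assms] obtain B where
    "\<And>k. B k \<ge> 1 \<and> f k \<in> borel_measurable borel \<and> deriv (f k) \<in> borel_measurable borel \<and>
    (\<forall>x. \<bar>f k x\<bar> \<le> B k) \<and> (\<forall>x. \<bar>deriv (f k) x\<bar> \<le> B k) \<and> (\<forall>x y. \<bar>f k x - f k y\<bar> \<le> B k * \<bar>x - y\<bar>) \<and>
    (\<forall>x y. \<bar>deriv (f k) x - deriv (f k) y\<bar> \<le> B k * \<bar>x - y\<bar>) \<and>
    (\<forall>x y. \<bar>f k x - f k y - deriv (f k) y * (x - y)\<bar> \<le> B k * (x - y)\<^sup>2)" by metis
  then show ?thesis by (intro exI[of _ B] smooth_nonlinearities.intro) auto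
qed

text \<open>Only indices in \<open>{1..n}\<close> are visited. This lets the given matrix be
  replaced by the one rebuilt from its upper triangle.\<close>

lemma cavity_cong:
  assumes "\<And>i j. i \<in> {1..n} \<Longrightarrow> j \<in> {1..n} \<Longrightarrow> a i j = a' i j" "\<And>i. i \<in> {1..n} \<Longrightarrow> u i = u' i"
    and "i \<in> {1..n}"
  shows "cavity n a f u k S i = cavity n a' f u' k S i"
  using assms(3)
proof (induction k arbitrary: S i)
  case (Suc k)
  have "(\<Sum>j\<in>{1..n} - (S \<union> {i}). a i j * f k (cavity n a f u k (S \<union> {i}) j))
    = (\<Sum>j\<in>{1..n} - (S \<union> {i}). a' i j * f k (cavity n a' f u' k (S \<union> {i}) j))"
    by (intro sum.cong refl arg_cong2[of _ _ _ _ "(*)"] arg_cong[of _ _ "f k"] Suc.IH assms(1) Suc.prems) auto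
  then show ?case by simp
qed (simp add: assms(2))

lemma amp_cong:
  assumes "\<And>i j. i \<in> {1..n} \<Longrightarrow> j \<in> {1..n} \<Longrightarrow> a i j = a' i j" "\<And>i. i \<in> {1..n} \<Longrightarrow> u i = u' i"
    and "i \<in> {1..n}"
  shows "amp n a f u k i = amp n a' f u' k i"
  using assms(3)
proof (induction k arbitrary: i rule: less_induct)
  case (less k)
  consider "k = 0" | "k = Suc 0" | s where "k = Suc (Suc s)" by (metis not0_implies_Suc)
  then show ?case
  proof cases
    case (3 s)
    have "amp n a f u (Suc s) j = amp n a' f u' (Suc s) j" "amp n a f u s j = amp n a' f u' s j"
      if "j \<in> {1..n}" for j using less.IH that 3 by auto
    then show ?thesis using less.prems unfolding 3 amp.simps by (simp add: assms(1))
  qed (use less.prems in \<open>simp_all add: assms\<close>)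
qed

text \<open>Independence makes the joint law a product, also for different value types; Fubini then
  integrates over \<open>Y\<close> with the value of \<open>X\<close> frozen.\<close>

lemma (in prob_space) nn_integral_indep_rvs:
  assumes indep: "indep_rvs M S X T Y"
    and [measurable]: "\<Phi> \<in> borel_measurable (S \<Otimes>\<^sub>M T)"
  shows "(\<integral>\<^sup>+ \<omega>. \<Phi> (X \<omega>, Y \<omega>) \<partial>M) = (\<integral>\<^sup>+ x. (\<integral>\<^sup>+ y. \<Phi> (x, y) \<partial>distr M T Y) \<partial>distr M S X)"
proof -
  have rv [measurable]: "X \<in> measurable M S" "Y \<in> measurable M T"
    using indep by (auto simp: indep_rvs_def)
  interpret X: prob_space "distr M S X" by (rule prob_space_distr) fact
  interpret Y: prob_space "distr M T Y" by (rule prob_space_distr) fact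
  have "distr M S X \<Otimes>\<^sub>M distr M T Y = distr M (S \<Otimes>\<^sub>M T) (\<lambda>x. (X x, Y x))"
  proof (rule pair_measure_eqI)
    fix A B assume A: "A \<in> sets (distr M S X)" and B: "B \<in> sets (distr M T Y)"
    have "prob ((X -` A \<inter> space M) \<inter> (Y -` B \<inter> space M)) = prob (X -` A \<inter> space M) * prob (Y -` B \<inter> space M)"
      using indep A B unfolding indep_rvs_def by (intro indep_setD) auto
    then have "emeasure M ((X -` A \<inter> space M) \<inter> (Y -` B \<inter> space M))
        = emeasure M (X -` A \<inter> space M) * emeasure M (Y -` B \<inter> space M)"
      by (simp add: emeasure_eq_measure ennreal_mult)
    moreover have "(\<lambda>x. (X x, Y x)) -` (A \<times> B) \<inter> space M = (X -` A \<inter> space M) \<inter> (Y -` B \<inter> space M)" by auto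
    ultimately show "emeasure (distr M S X) A * emeasure (distr M T Y) B
        = emeasure (distr M (S \<Otimes>\<^sub>M T) (\<lambda>x. (X x, Y x))) (A \<times> B)"
      using A B by (simp add: emeasure_distr)
  qed (unfold_locales, simp)
  then have "(\<integral>\<^sup>+ \<omega>. \<Phi> (X \<omega>, Y \<omega>) \<partial>M) = (\<integral>\<^sup>+ z. \<Phi> z \<partial>(distr M S X \<Otimes>\<^sub>M distr M T Y))"
    by (simp add: nn_integral_distr)
  also have "\<dots> = (\<integral>\<^sup>+ x. (\<integral>\<^sup>+ y. \<Phi> (x, y) \<partial>distr M T Y) \<partial>distr M S X)"
    by (rule Y.nn_integral_fst[symmetric]) simp
  finally show ?thesis .
qed

lemma (in prob_space) distr_iid_gauss:
  assumes fin: "finite E" and indep: "indep_vars (\<lambda>_. borel) X E"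
    and gauss: "\<And>e. e \<in> E \<Longrightarrow> distributed M lborel (X e) std_normal_density"
  shows "distr M (PiM E (\<lambda>_. borel)) (\<lambda>\<omega>. \<lambda>e\<in>E. X e \<omega>) = gauss_PiM E"
proof -
  have rv [measurable]: "X e \<in> borel_measurable M" if "e \<in> E" for e
    using indep that by (auto simp: indep_vars_def)
  have law: "distr M borel (X e) = std_gauss" if "e \<in> E" for e
  proof -
    have "distr M borel (X e) = distr M lborel (X e)" by (rule distr_cong) auto
    then show ?thesis using distributed_distr_eq_density[OF gauss[OF that]] by simp
  qed
  show ?thesis
  proof (cases "E = {}")
    \<comment> \<open>This occurs for a matrix of size 1; both laws are concentrated on the only
      function with empty domain.\<close>
    case True
    show ?thesis unfolding True
      by (rule gauss_PiM.PiM_eqI) (auto simp: emeasure_distr emeasure_space_1 PiM_empty restrict_def)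
  next
    case False
    have "distr M (PiM E (\<lambda>_. borel)) (\<lambda>\<omega>. \<lambda>e\<in>E. X e \<omega>) = PiM E (\<lambda>e. distr M borel (X e))"
      using indep_vars_iff_distr_eq_PiM'[OF False rv] indep by simp
    also have "\<dots> = gauss_PiM E" by (rule PiM_cong) (auto simp: law)
    finally show ?thesis .
  qed
qed

lemma nnorm_squared: "(nnorm n x)\<^sup>2 = (1 / real n) * (\<Sum>i=1..n. (x i)\<^sup>2)"
  unfolding nnorm_def by (rule real_sqrt_pow2) (intro mult_nonneg_nonneg sum_nonneg, auto)

theorem theorem2:
  fixes M :: "nat \<Rightarrow> 'a measure"
    and A :: "nat \<Rightarrow> nat \<Rightarrow> nat \<Rightarrow> 'a \<Rightarrow> real"
    and u :: "nat \<Rightarrow> nat \<Rightarrow> 'a \<Rightarrow> real"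
    and N :: "'b measure"
    and W0 :: "'b \<Rightarrow> real"
    and f :: "nat \<Rightarrow> real \<Rightarrow> real"
  assumes prob_M: "\<And>n. n \<ge> 1 \<Longrightarrow> prob_space (M n)"
    and A_sym: "\<And>n i j \<omega>. \<lbrakk>n \<ge> 1; i \<in> {1..n}; j \<in> {1..n}; \<omega> \<in> space (M n)\<rbrakk>
                  \<Longrightarrow> A n i j \<omega> = A n j i \<omega>"
    and A_diag: "\<And>n i \<omega>. \<lbrakk>n \<ge> 1; i \<in> {1..n}; \<omega> \<in> space (M n)\<rbrakk> \<Longrightarrow> A n i i \<omega> = 0"
    and A_indep: "\<And>n. n \<ge> 1 \<Longrightarrow>
                  prob_space.indep_vars (M n) (\<lambda>_. borel) (\<lambda>(i, j). A n i j) (strict_upper_pairs n)"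
    and A_gauss: "\<And>n i j. \<lbrakk>n \<ge> 1; (i, j) \<in> strict_upper_pairs n\<rbrakk>
                  \<Longrightarrow> distributed (M n) lborel (A n i j) std_normal_density"
    and u_indep_A: "\<And>n. n \<ge> 1 \<Longrightarrow>
                  indep_rvs (M n)
                    (PiM {1..n} (\<lambda>_. borel)) (\<lambda>\<omega>. \<lambda>i\<in>{1..n}. u n i \<omega>)
                    (PiM ({1..n} \<times> {1..n}) (\<lambda>_. borel))
                    (\<lambda>\<omega>. \<lambda>(i, j)\<in>{1..n} \<times> {1..n}. A n i j \<omega>)"
    and u_norm: "\<And>n. n \<ge> 1 \<Longrightarrow> AE \<omega> in M n. nnorm n (\<lambda>i. u n i \<omega>) \<le> 1"
    and prob_N: "prob_space N"
    and W0_rv: "W0 \<in> borel_measurable N"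
    and u_empirical: "\<And>(\<phi> :: real \<Rightarrow> real) \<epsilon>.
                  \<lbrakk>continuous_on UNIV \<phi>; bounded (range \<phi>); \<epsilon> > 0\<rbrakk> \<Longrightarrow>
                  (\<lambda>n. measure (M n) {\<omega> \<in> space (M n).
                      \<bar>(1 / real n) * (\<Sum>i=1..n. \<phi> (u n i \<omega>)) - (\<integral>x. \<phi> (W0 x) \<partial>N)\<bar> > \<epsilon>})
                    \<longlonglongrightarrow> 0"
    and f_smooth: "\<And>k. bounded_smooth (f k)"
  shows "\<forall>k. \<exists>C>0. \<forall>n\<ge>k + 1.
           integrable (M n) (\<lambda>\<omega>. (nnorm n (\<lambda>i.
               amp n (\<lambda>i j. A n i j \<omega>) f (\<lambda>i. u n i \<omega>) k i
               - cavity n (\<lambda>i j. A n i j \<omega>) f (\<lambda>i. u n i \<omega>) k {} i))\<^sup>2) \<and>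
           (\<integral>\<omega>. (nnorm n (\<lambda>i.
               amp n (\<lambda>i j. A n i j \<omega>) f (\<lambda>i. u n i \<omega>) k i
               - cavity n (\<lambda>i j. A n i j \<omega>) f (\<lambda>i. u n i \<omega>) k {} i))\<^sup>2 \<partial>M n) \<le> C / real n"
proof
  fix k
  obtain B where "smooth_nonlinearities f B"
    using smooth_nonlinearities_exists[of f] f_smooth by blast
  then interpret smooth_nonlinearities f B .
  obtain C where C: "C > 0" "\<And>n u. n \<ge> 1 \<Longrightarrow>
    (\<integral>\<^sup>+ \<omega>. ennreal ((1 / real n) * (\<Sum>i\<in>{1..n}. (delta n u k i \<omega>)\<^sup>2)) \<partial>goe n) \<le> ennreal (C / n)"
    using delta_bound[of k] by blast
  let ?F = "\<lambda>n \<omega>. (nnorm n (\<lambda>i. amp n (\<lambda>i j. A n i j \<omega>) f (\<lambda>i. u n i \<omega>) k i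
      - cavity n (\<lambda>i j. A n i j \<omega>) f (\<lambda>i. u n i \<omega>) k {} i))\<^sup>2"
  have "integrable (M n) (?F n) \<and> (\<integral>\<omega>. ?F n \<omega> \<partial>M n) \<le> C / real n" if "n \<ge> k + 1" for n
  proof -
    have n: "n \<ge> 1" using that by simp
    interpret prob_space "M n" by (rule prob_M[OF n])
    let ?E = "strict_upper_pairs n"
    let ?S = "PiM {1..n} (\<lambda>_. borel :: real measure)"
    let ?T = "PiM ({1..n} \<times> {1..n}) (\<lambda>_. borel :: real measure)"
    define U where "U \<omega> = (\<lambda>i\<in>{1..n}. u n i \<omega>)" for \<omega>
    define AA where "AA \<omega> = (\<lambda>(i, j)\<in>{1..n} \<times> {1..n}. A n i j \<omega>)" for \<omega>
    \<comment> \<open>The upper triangle determines the matrix and, unlike the full matrix, has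
      independent coordinates.\<close>
    define h where "h \<alpha> = (\<lambda>e\<in>?E. \<alpha> e)" for \<alpha> :: "nat \<times> nat \<Rightarrow> real"
    \<comment> \<open>Extension by 0 gives a vector with measurable coordinates at every
      index.\<close>
    define v where "v x i = (if i \<in> {1..n} then x i else 0)" for x :: "nat \<Rightarrow> real" and i
    define \<Psi> where "\<Psi> p = (1 / real n) * (\<Sum>i\<in>{1..n}. (delta n (v (fst p)) k i (snd p))\<^sup>2)" for p
    have indep: "indep_rvs (M n) ?S U ?T AA"
      using u_indep_A[OF n] by (simp add: U_def[abs_def] AA_def[abs_def])
    then have [measurable]: "U \<in> measurable (M n) ?S" "AA \<in> measurable (M n) ?T"
      by (auto simp: indep_rvs_def)
    have E_sub: "?E \<subseteq> {1..n} \<times> {1..n}" by (auto simp: strict_upper_pairs_def)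
    have sets_goe: "sets (goe n) = sets (PiM ?E (\<lambda>_. borel))" by (rule sets_PiM_cong) auto
    have "h \<in> measurable ?T (PiM ?E (\<lambda>_. borel))"
      unfolding h_def[abs_def] by (intro measurable_restrict measurable_component_singleton) (use E_sub in auto)
    then have h [measurable]: "h \<in> measurable ?T (goe n)"
      using measurable_cong_sets[OF refl sets_goe] by blast
    have v_meas: "(\<lambda>p. v (fst p) i) \<in> borel_measurable (?S \<Otimes>\<^sub>M goe n)" for i
    proof (cases "i \<in> {1..n}")
      case True
      then have "(\<lambda>p. fst p i) \<in> borel_measurable (?S \<Otimes>\<^sub>M goe n)"
        by (intro measurable_compose[OF measurable_fst] measurable_component_singleton)
      then show ?thesis using True by (simp add: v_def)
    next
      case False
      then have "v x i = 0" for x by (auto simp: v_def)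
      then show ?thesis by simp
    qed
    have e_meas: "(\<lambda>p. ent n i j (snd p)) \<in> borel_measurable (?S \<Otimes>\<^sub>M goe n)" for i j
      by measurable
    have [measurable]: "(\<lambda>p. delta n (v (fst p)) k i (snd p)) \<in> borel_measurable (?S \<Otimes>\<^sub>M goe n)" for i
      unfolding delta_def cav_def
      by (intro borel_measurable_diff amp_measurable cavity_measurable e_meas v_meas)
    have \<Psi>_meas [measurable]: "\<Psi> \<in> borel_measurable (?S \<Otimes>\<^sub>M goe n)"
      unfolding \<Psi>_def[abs_def] by measurable
    have F: "?F n \<omega> = \<Psi> (U \<omega>, h (AA \<omega>))" if \<omega>: "\<omega> \<in> space (M n)" for \<omega>
    proof -
      have a: "ent n i j (h (AA \<omega>)) = A n i j \<omega>" if ij: "i \<in> {1..n}" "j \<in> {1..n}" for i j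
      proof -
        consider "i < j" | "i = j" | "j < i" by linarith
        then show ?thesis
        proof cases
          case 1
          then show ?thesis using ij by (auto simp: ent_def h_def AA_def strict_upper_pairs_def min_def max_def)
        next
          case 2
          then show ?thesis using A_diag[OF n ij(1) \<omega>] by simp
        next
          case 3
          then show ?thesis using ij A_sym[OF n ij \<omega>]
            by (auto simp: ent_def h_def AA_def strict_upper_pairs_def min_def max_def)
        qed
      qed
      have b: "v (U \<omega>) i = u n i \<omega>" if "i \<in> {1..n}" for i using that by (simp add: v_def U_def)
      have "amp n (\<lambda>i j. A n i j \<omega>) f (\<lambda>i. u n i \<omega>) k i - cavity n (\<lambda>i j. A n i j \<omega>) f (\<lambda>i. u n i \<omega>) k {} i
        = delta n (v (U \<omega>)) k i (h (AA \<omega>))" if i: "i \<in> {1..n}" for i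
        unfolding delta_def cav_def
        by (intro arg_cong2[of _ _ _ _ "(-)"] amp_cong cavity_cong i) (simp_all add: a b)
      then show ?thesis unfolding nnorm_squared \<Psi>_def fst_conv snd_conv by simp
    qed
    \<comment> \<open>The law of the full matrix, pushed forward to the upper triangle, is the
      product measure for which the estimates are proved.\<close>
    have law: "distr (distr (M n) ?T AA) (goe n) h = goe n"
    proof -
      have "h (AA \<omega>) = (\<lambda>e\<in>?E. (case e of (i, j) \<Rightarrow> A n i j) \<omega>)" for \<omega>
        using E_sub by (auto simp: h_def AA_def restrict_def fun_eq_iff)
      then have "distr (distr (M n) ?T AA) (goe n) h = distr (M n) (PiM ?E (\<lambda>_. borel)) (\<lambda>\<omega>. \<lambda>e\<in>?E. (case e of (i, j) \<Rightarrow> A n i j) \<omega>)"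
        by (subst distr_distr, measurable) (intro distr_cong sets_goe, simp_all)
      also have "\<dots> = goe n"
        by (rule distr_iid_gauss[OF finite_strict_upper_pairs A_indep[OF n]]) (auto intro: A_gauss[OF n])
      finally show ?thesis .
    qed
    have [measurable]: "(\<lambda>p. ennreal (\<Psi> (fst p, h (snd p)))) \<in> borel_measurable (?S \<Otimes>\<^sub>M ?T)"
      by measurable
    have "(\<integral>\<^sup>+ \<omega>. ennreal (?F n \<omega>) \<partial>M n) = (\<integral>\<^sup>+ \<omega>. ennreal (\<Psi> (fst (U \<omega>, AA \<omega>), h (snd (U \<omega>, AA \<omega>)))) \<partial>M n)"
      by (intro nn_integral_cong) (simp only: F fst_conv snd_conv)
    also have "\<dots> = (\<integral>\<^sup>+ x. (\<integral>\<^sup>+ y. ennreal (\<Psi> (fst (x, y), h (snd (x, y)))) \<partial>distr (M n) ?T AA) \<partial>distr (M n) ?S U)"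
      by (rule nn_integral_indep_rvs[OF indep]) measurable
    also have "\<dots> \<le> (\<integral>\<^sup>+ x. ennreal (C / n) \<partial>distr (M n) ?S U)"
    \<comment> \<open>Here the uniformity in \<open>u\<close> pays off: for each fixed value
      \<open>x\<close> of \<open>U\<close> the same constant bounds the inner integral.\<close>
    proof (rule nn_integral_mono)
      fix x assume "x \<in> space (distr (M n) ?S U)"
      then have [measurable]: "(\<lambda>y. \<Psi> (x, y)) \<in> borel_measurable (goe n)"
        by (intro measurable_compose[OF measurable_Pair1' \<Psi>_meas]) simp
      have "(\<integral>\<^sup>+ y. ennreal (\<Psi> (x, h y)) \<partial>distr (M n) ?T AA)
        = (\<integral>\<^sup>+ y. ennreal (\<Psi> (x, y)) \<partial>distr (distr (M n) ?T AA) (goe n) h)"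
        by (rule nn_integral_distr[symmetric]) measurable
      also have "\<dots> \<le> ennreal (C / n)"
        unfolding law \<Psi>_def fst_conv snd_conv by (rule C(2)[OF n])
      finally show "(\<integral>\<^sup>+ y. ennreal (\<Psi> (fst (x, y), h (snd (x, y)))) \<partial>distr (M n) ?T AA) \<le> ennreal (C / n)"
        by simp
    qed
    also have "\<dots> = ennreal (C / n)"
    proof -
      have "prob_space (distr (M n) ?S U)" by (rule prob_space_distr) measurable
      then show ?thesis using prob_space.emeasure_space_1 by fastforce
    qed
    finally have bound: "(\<integral>\<^sup>+ \<omega>. ennreal (?F n \<omega>) \<partial>M n) \<le> ennreal (C / n)" .
    have "(\<lambda>\<omega>. \<Psi> (U \<omega>, h (AA \<omega>))) \<in> borel_measurable (M n)" by measurable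
    then have meas: "?F n \<in> borel_measurable (M n)"
      using measurable_cong[of "M n" "?F n" "\<lambda>\<omega>. \<Psi> (U \<omega>, h (AA \<omega>))"] F by blast
    have int: "integrable (M n) (?F n)"
      by (rule integrableI_nonneg[OF meas]) (use bound in \<open>auto intro: le_less_trans\<close>)
    have "(\<integral>\<omega>. ?F n \<omega> \<partial>M n) = enn2real (\<integral>\<^sup>+ \<omega>. ennreal (?F n \<omega>) \<partial>M n)"
      by (rule integral_eq_nn_integral[OF meas]) simp
    also have "\<dots> \<le> C / n" using bound C(1) by (intro enn2real_leI) auto
    finally show ?thesis using int by simp
  qed
  then show "\<exists>C>0. \<forall>n\<ge>k + 1. integrable (M n) (?F n) \<and> (\<integral>\<omega>. ?F n \<omega> \<partial>M n) \<le> C / real n"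
    using C(1) by blast
qed

end
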